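(* Let $G\subset\Gamma$ be a rational subgroup, i.e. a subgroup of $\Gamma$ generated as a group by elements of $\mathfrak{RS}$. If $G$ contains no non-cyclic free rational subsemigroup, then $G$ is amenable.
   Context: $\mathfrak{S}$ is the semigroup, under composition (substitution), of all formal power series $a_1z+a_2z^2+\dots$ in one variable with $a_i\in\mathbb{C}$. $\Gamma=\{s\in\mathfrak{S}: a_1\neq 0\}$ is the group of invertible elements of $\mathfrak{S}$. An element of $\mathfrak{S}$ is called rational if it has positive radius of convergence and converges to a rational function; $\mathfrak{RS}\subset\mathfrak{S}$ is the subsemigroup of all rational elements (identified with the semigroup of rational endomorphisms of $\overline{\mathbb{C}}$ fixing $0$). A group (respectively semigroup) contained in $\mathfrak{S}$ is called rational if it is generated as a group (respectively as a semigroup) by elements of $\mathfrak{RS}$. A non-cyclic free semigroup is a free semigroup on at least two generators. Amenability of $G$ is amenability as a discrete (abstract) group. *)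

theory Defs
  imports
    "HOL-Algebra.Generated_Groups"
    "HOL-Analysis.FPS_Convergence"
begin

definition fps_sgrp :: "complex fps monoid" where
  "fps_sgrp = \<lparr>carrier = {f. fps_nth f 0 = 0}, monoid.mult = fps_compose, one = fps_X\<rparr>"

definition fps_grp :: "complex fps monoid" where
  "fps_grp = fps_sgrp\<lparr>carrier := {f. fps_nth f 0 = 0 \<and> fps_nth f 1 \<noteq> 0}\<rparr>"

lemma monoid_fps_sgrp: "monoid fps_sgrp"
  by (rule monoidI) (auto simp: fps_sgrp_def fps_compose_assoc)

lemma fps_inv_in_fps_grp:
  assumes "f \<in> carrier fps_grp"
  shows "fps_inv f \<in> carrier fps_grp"
proof -
  have f: "fps_nth f 0 = 0" "fps_nth f 1 \<noteq> 0"
    using assms by (auto simp: fps_grp_def)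
  have "fps_nth (fps_inv f oo f) 1 = 1"
    using fps_inv[OF f] by simp
  then have "fps_nth (fps_inv f) 1 \<noteq> 0"
    by (auto simp: fps_compose_nth f)
  then show ?thesis
    by (simp add: fps_grp_def fps_inv_def)
qed

lemma group_fps_grp: "group fps_grp"
proof (rule groupI)
  fix x y assume "x \<in> carrier fps_grp" "y \<in> carrier fps_grp"
  then show "x \<otimes>\<^bsub>fps_grp\<^esub> y \<in> carrier fps_grp"
    by (simp add: fps_grp_def fps_sgrp_def fps_compose_nth)
next
  fix x assume x: "x \<in> carrier fps_grp"
  then have "fps_inv x \<otimes>\<^bsub>fps_grp\<^esub> x = \<one>\<^bsub>fps_grp\<^esub>"
    by (simp add: fps_grp_def fps_sgrp_def fps_inv)
  then show "\<exists>y\<in>carrier fps_grp. y \<otimes>\<^bsub>fps_grp\<^esub> x = \<one>\<^bsub>fps_grp\<^esub>"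
    using fps_inv_in_fps_grp[OF x] by blast
qed (auto simp: fps_grp_def fps_sgrp_def fps_compose_assoc)

lemma carrier_fps_grp: "carrier fps_grp = Units fps_sgrp"
proof
  show "carrier fps_grp \<subseteq> Units fps_sgrp"
  proof
    fix f assume "f \<in> carrier fps_grp"
    then show "f \<in> Units fps_sgrp"
      using fps_inv_in_fps_grp[of f] fps_inv[of f] fps_inv_right[of f]
      by (auto simp: Units_def fps_grp_def fps_sgrp_def)
  qed
  show "Units fps_sgrp \<subseteq> carrier fps_grp"
  proof
    fix f assume "f \<in> Units fps_sgrp"
    then obtain g where fg: "fps_nth f 0 = 0" "fps_nth g 0 = 0" "f oo g = fps_X"
      by (auto simp: Units_def fps_sgrp_def)
    then have "fps_nth (f oo g) 1 = 1" by simp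
    then show "f \<in> carrier fps_grp"
      using fg(1) by (auto simp: fps_grp_def fps_compose_nth)
  qed
qed

text \<open>
  A rational function is given by a fraction \<open>p / q\<close> of polynomials. The sum of \<open>f\<close> is finite at
  \<open>0\<close>, so the fraction can be chosen with \<open>q(0) \<noteq> 0\<close>.
\<close>

definition rational_elements :: "complex fps set" where
  "rational_elements =
     {f \<in> carrier fps_sgrp.
        \<exists>p q. poly q 0 \<noteq> 0 \<and> (\<lambda>z. poly p z / poly q z) has_fps_expansion f}"

inductive_set semigroup_generate :: "('a, 'b) monoid_scheme \<Rightarrow> 'a set \<Rightarrow> 'a set"
  for M and A where
    incl: "a \<in> A \<Longrightarrow> a \<in> semigroup_generate M A"
  | mult: "x \<in> semigroup_generate M A \<Longrightarrow> y \<in> semigroup_generate M A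
      \<Longrightarrow> x \<otimes>\<^bsub>M\<^esub> y \<in> semigroup_generate M A"

definition word_prod :: "('a, 'b) monoid_scheme \<Rightarrow> 'a list \<Rightarrow> 'a" where
  "word_prod M w = foldr (monoid.mult M) w \<one>\<^bsub>M\<^esub>"

text \<open>
  The free semigroup on \<open>B\<close> consists of the nonempty words over \<open>B\<close>, so \<open>T\<close> is free on \<open>B\<close> iff the
  product in \<open>M\<close> identifies the nonempty words over \<open>B\<close> with \<open>T\<close>.
\<close>

definition free_semigroup_on :: "('a, 'b) monoid_scheme \<Rightarrow> 'a set \<Rightarrow> 'a set \<Rightarrow> bool" where
  "free_semigroup_on M T B \<longleftrightarrow>
     B \<subseteq> carrier M \<and> bij_betw (word_prod M) {w \<in> lists B. w \<noteq> []} T"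

definition noncyclic_free_semigroup :: "('a, 'b) monoid_scheme \<Rightarrow> 'a set \<Rightarrow> bool" where
  "noncyclic_free_semigroup M T \<longleftrightarrow>
     (\<exists>B. free_semigroup_on M T B \<and> (\<exists>b\<in>B. \<exists>c\<in>B. b \<noteq> c))"

definition rational_semigroup :: "complex fps set \<Rightarrow> bool" where
  "rational_semigroup T \<longleftrightarrow>
     (\<exists>A. A \<noteq> {} \<and> A \<subseteq> rational_elements \<and> T = semigroup_generate fps_sgrp A)"

definition rational_subgroup :: "complex fps set \<Rightarrow> bool" where
  "rational_subgroup G \<longleftrightarrow>
     subgroup G fps_grp \<and>
     (\<exists>A. A \<subseteq> rational_elements \<inter> carrier fps_grp \<and> G = generate fps_grp A)"

text \<open>
  Amenability of a discrete group: there is a left-invariant finitely additive probability measure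
  defined on all subsets.
\<close>

definition amenable :: "('a, 'b) monoid_scheme \<Rightarrow> bool" where
  "amenable G \<longleftrightarrow>
     (\<exists>\<mu> :: 'a set \<Rightarrow> real.
        (\<forall>S. S \<subseteq> carrier G \<longrightarrow> 0 \<le> \<mu> S) \<and>
        \<mu> (carrier G) = 1 \<and>
        (\<forall>S T. S \<subseteq> carrier G \<longrightarrow> T \<subseteq> carrier G \<longrightarrow> S \<inter> T = {} \<longrightarrow> \<mu> (S \<union> T) = \<mu> S + \<mu> T) \<and>
        (\<forall>g\<in>carrier G. \<forall>S. S \<subseteq> carrier G \<longrightarrow> \<mu> (g <#\<^bsub>G\<^esub> S) = \<mu> S))"

end

theory Submission
  imports Defs "HOL-Complex_Analysis.Complex_Analysis"
    "HOL-Computational_Algebra.Computational_Algebra" "HOL-Computational_Algebra.Field_as_Ring"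
begin

text \<open>
  The group \<open>G\<close> is metabelian: its elements tangent to the identity commute with each other. A
  metabelian group is amenable, because the finitely additive probability measures on it form a
  compact convex set on which an abelian normal subgroup has a fixed point, and the abelian
  quotient then has a fixed point among these fixed points (\<open>amenable_metabelian\<close>).

  Let \<open>S\<close> be the semigroup of rational elements of \<open>G\<close>. Two different elements of \<open>S\<close> do not freely
  generate a semigroup, so two different words in them agree; cancellation turns this into
  an equality between two words of the same length with different last letters (\<open>collideI\<close>).
  This has two uses. First, it gives common left multiples in \<open>S\<close>, so that each \<open>g\<close> in \<open>G\<close> is a
  fraction, \<open>t \<circ> g = s\<close> with \<open>s\<close>, \<open>t\<close> in \<open>S\<close>, and commutation can be tested inside \<open>S\<close>. Second, it
  is applied to \<open>a = f \<circ> g\<close> and \<open>b = g \<circ> f\<close>, which have the same multiplier and the same degree,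
  and to all the pairs of iterates of \<open>a\<close> and \<open>b\<close>, in order to prove \<open>a = b\<close>.

  Suppose that the common multiplier \<open>l\<close> is not a root of unity and \<open>b = a + \<delta> z ^ (k + 1) + \<dots>\<close>
  with \<open>\<delta> \<noteq> 0\<close>. In a word in \<open>a\<close> and \<open>b\<close>, a letter \<open>b\<close> followed by exactly \<open>m\<close> letters changes the
  coefficient of \<open>z ^ (k + 1)\<close> by an amount proportional to \<open>l ^ (k m)\<close>. The equality of two words
  thus makes \<open>l ^ k\<close> a root of a polynomial with coefficients \<open>-1\<close>, \<open>0\<close>, \<open>1\<close>. The iterates of
  \<open>a\<close> and \<open>b\<close> give the same for every power of \<open>l ^ k\<close>. Only roots of unity have this property
  (\<open>root_of_unity_if_powers_height_one\<close>), so \<open>a = b\<close> (\<open>equal_multiplier_root_of_unity\<close>).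

  Suppose that the multiplier is \<open>1\<close> and the degree is \<open>d \<ge> 2\<close>. Lift \<open>a\<close> and \<open>b\<close> to homogeneous maps
  \<open>A\<close> and \<open>B\<close> of \<open>\<complex>\<^sup>2\<close>. The equalities between words bound \<open>ln \<bar>A\<^sup>n X\<bar> - ln \<bar>B\<^sup>n X\<bar>\<close> uniformly in \<open>n\<close> and
  \<open>X\<close>, so that \<open>A\<close> and \<open>B\<close> have the same Green function, the limit of \<open>ln \<bar>A\<^sup>n X\<bar> / d\<^sup>n\<close>. Up to the
  logarithm of the modulus of a nonvanishing holomorphic function, it is then invariant under the
  germ \<open>c = inverse a \<circ> b\<close>. If \<open>c\<close> is not the identity, adding up along the orbits of \<open>c\<close> in its petals shows
  that the Green function is locally the real part of a holomorphic function around \<open>0\<close>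
  (\<open>harmonic_near_parabolic_symmetry\<close>). But then the iterates of \<open>a\<close> are uniformly bounded on a
  neighbourhood of \<open>0\<close>, while their first nontrivial coefficient grows linearly unless \<open>a = z\<close>
  (\<open>harmonic_green_imp_identity\<close>). Hence \<open>a = b\<close> (\<open>parabolic_collisions_trivial\<close>).
\<close>

unbundle no vec_syntax

section \<open>Fixed points of commuting actions and amenability\<close>

lemma compact_closed_unit_functions:
  fixes K :: "('i \<Rightarrow> real) set"
  assumes "closed K" and "\<And>\<mu> i. \<mu> \<in> K \<Longrightarrow> \<mu> i \<in> {0..1}"
  shows "compact K"
proof -
  have "compactin (product_topology (\<lambda>i. euclidean) UNIV) (PiE UNIV (\<lambda>i::'i. {0..1::real}))"
    by (simp add: compactin_PiE)
  hence "compact (PiE UNIV (\<lambda>i::'i. {0..1::real}))"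
    by (simp add: euclidean_product_topology)
  moreover have "K \<subseteq> PiE UNIV (\<lambda>i::'i. {0..1::real})"
    using assms(2) by (auto simp: PiE_def)
  ultimately show ?thesis
    using assms(1) by (metis closed_Int_compact inf.absorb_iff1)
qed

text \<open>
  The Markov--Kakutani theorem, for actions that permute the index set of a family of numbers.
  Averaging over \<open>n\<close> iterates of one map makes a point almost invariant under it, up to \<open>1 / n\<close>, and
  by commutation this keeps the almost invariance under the maps treated earlier. Compactness passes
  from finitely many approximate conditions to all the exact ones. The indices of interest form the
  set \<open>J\<close>; below they are the subsets of the group.
\<close>

theorem Markov_Kakutani_reindexing:
  fixes K :: "('i \<Rightarrow> real) set" and \<phi> :: "'t \<Rightarrow> 'i \<Rightarrow> 'i"
  assumes "closed K" "K \<noteq> {}" and unit: "\<And>\<mu> i. \<mu> \<in> K \<Longrightarrow> \<mu> i \<in> {0..1}"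
    and avg: "\<And>(n::nat) \<nu>. (\<And>k. \<nu> k \<in> K) \<Longrightarrow> (\<lambda>i. (\<Sum>k<Suc n. \<nu> k i) / Suc n) \<in> K"
    and act: "\<And>t \<mu>. t \<in> T \<Longrightarrow> \<mu> \<in> K \<Longrightarrow> (\<lambda>i. \<mu> (\<phi> t i)) \<in> K"
    and J: "\<And>t i. t \<in> T \<Longrightarrow> i \<in> J \<Longrightarrow> \<phi> t i \<in> J"
    and comm: "\<And>s t \<mu> i. s \<in> T \<Longrightarrow> t \<in> T \<Longrightarrow> \<mu> \<in> K \<Longrightarrow> i \<in> J
                 \<Longrightarrow> \<mu> (\<phi> s (\<phi> t i)) = \<mu> (\<phi> t (\<phi> s i))"
  shows "\<exists>\<mu>\<in>K. \<forall>t\<in>T. \<forall>i\<in>J. \<mu> (\<phi> t i) = \<mu> i"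
proof -
  \<comment> \<open>The points of \<open>K\<close> that the action of \<open>t\<close> moves by at most \<open>1 / (n + 1)\<close>.\<close>
  define C where "C = (\<lambda>(t,n::nat). {\<mu>\<in>K. \<forall>i\<in>J. \<bar>\<mu> (\<phi> t i) - \<mu> i\<bar> \<le> 1 / Suc n})"
  have K: "compact K"
    by (rule compact_closed_unit_functions[OF assms(1)]) (rule unit)
  have ev: "continuous_on UNIV (\<lambda>\<mu>::'i \<Rightarrow> real. \<mu> i)" for i
    by simp
  have clC: "closed (C x)" for x
  proof -
    obtain t n where x: "x = (t,n)" by force
    have "C x = K \<inter> (\<Inter>i\<in>J. {\<mu>. \<bar>\<mu> (\<phi> t i) - \<mu> i\<bar> \<le> 1 / Suc n})"
      by (auto simp: C_def x)
    moreover have "closed {\<mu>::'i \<Rightarrow> real. \<bar>\<mu> (\<phi> t i) - \<mu> i\<bar> \<le> 1 / Suc n}" for i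
      by (intro closed_Collect_le continuous_intros ev)
    ultimately show ?thesis
      using assms(1) by (auto intro!: closed_Int closed_INT)
  qed
  have iter_act: "(\<lambda>i. \<mu> ((\<phi> t ^^ k) i)) \<in> K" if "t \<in> T" "\<mu> \<in> K" for t \<mu> k
  proof (induction k)
    case (Suc k)
    show ?case using act[OF that(1) Suc] by (simp add: funpow_swap1)
  qed (use that in simp)
  have iter_J: "(\<phi> t ^^ k) i \<in> J" if "t \<in> T" "i \<in> J" for t i k
    using that by (induction k) (auto simp: J)
  have iter_comm: "\<mu> ((\<phi> t ^^ k) (\<phi> s i)) = \<mu> (\<phi> s ((\<phi> t ^^ k) i))"
    if "s \<in> T" "t \<in> T" "\<mu> \<in> K" "i \<in> J" for s t \<mu> i k
    using that(4)
  proof (induction k arbitrary: i)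
    case (Suc k)
    have "\<mu> ((\<phi> t ^^ Suc k) (\<phi> s i)) = (\<lambda>i. \<mu> ((\<phi> t ^^ k) i)) (\<phi> t (\<phi> s i))"
      by (simp add: funpow_swap1)
    also have "\<dots> = (\<lambda>i. \<mu> ((\<phi> t ^^ k) i)) (\<phi> s (\<phi> t i))"
      using comm[OF that(2,1) iter_act[OF that(2,3)] Suc.prems] .
    also have "\<dots> = \<mu> (\<phi> s ((\<phi> t ^^ Suc k) i))"
      using Suc.IH[OF J[OF that(2) Suc.prems]] by (simp add: funpow_swap1)
    finally show ?case .
  qed simp
  have fin: "\<exists>\<mu>. \<mu> \<in> K \<and> (\<forall>x\<in>F. \<mu> \<in> C x)" if "finite F" "F \<subseteq> T \<times> UNIV" for F
    using that
  proof (induction F rule: finite_induct)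
    case empty
    then show ?case using assms(2) by auto
  next
    case (insert x F)
    then obtain \<mu> where \<mu>: "\<mu> \<in> K" "\<forall>x\<in>F. \<mu> \<in> C x" by auto
    obtain t n where x: "x = (t,n)" "t \<in> T" using insert.prems by auto
    define \<nu> where "\<nu> = (\<lambda>i. (\<Sum>k<Suc n. \<mu> ((\<phi> t ^^ k) i)) / Suc n)"
    have \<nu>K: "\<nu> \<in> K"
      unfolding \<nu>_def using avg[of "\<lambda>k i. \<mu> ((\<phi> t ^^ k) i)"] iter_act[OF x(2) \<mu>(1)] by blast
    have "\<bar>\<nu> (\<phi> t i) - \<nu> i\<bar> \<le> 1 / Suc n" for i
    proof -
      have "(\<Sum>k<Suc n. \<mu> ((\<phi> t ^^ k) (\<phi> t i))) - (\<Sum>k<Suc n. \<mu> ((\<phi> t ^^ k) i))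
              = (\<Sum>k<Suc n. \<mu> ((\<phi> t ^^ Suc k) i) - \<mu> ((\<phi> t ^^ k) i))"
        by (simp only: sum_subtractf funpow_Suc_right o_apply)
      also have "\<dots> = \<mu> ((\<phi> t ^^ Suc n) i) - \<mu> i"
        by (subst sum_lessThan_telescope) simp
      finally have "\<nu> (\<phi> t i) - \<nu> i = (\<mu> ((\<phi> t ^^ Suc n) i) - \<mu> i) / Suc n"
        unfolding \<nu>_def by (metis diff_divide_distrib)
      moreover have "\<bar>\<mu> ((\<phi> t ^^ Suc n) i) - \<mu> i\<bar> \<le> 1"
        using unit[OF \<mu>(1), of i] unit[OF \<mu>(1), of "(\<phi> t ^^ Suc n) i"] by (simp add: abs_le_iff)
      ultimately show ?thesis
        by (simp add: divide_right_mono abs_divide)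
    qed
    hence "\<nu> \<in> C x" using \<nu>K by (auto simp: C_def x)
    moreover have "\<nu> \<in> C y" if y: "y \<in> F" for y
    proof -
      obtain s l where sl: "y = (s,l)" "s \<in> T" using insert.prems y by auto
      have "\<bar>\<nu> (\<phi> s i) - \<nu> i\<bar> \<le> 1 / Suc l" if i: "i \<in> J" for i
      proof -
        have le: "\<bar>\<mu> ((\<phi> t ^^ k) (\<phi> s i)) - \<mu> ((\<phi> t ^^ k) i)\<bar> \<le> 1 / Suc l" for k
          using \<mu>(2) y iter_J[OF x(2) i, of k] unfolding iter_comm[OF sl(2) x(2) \<mu>(1) i]
          by (auto simp: C_def sl)
        have "\<nu> (\<phi> s i) - \<nu> i = (\<Sum>k<Suc n. \<mu> ((\<phi> t ^^ k) (\<phi> s i)) - \<mu> ((\<phi> t ^^ k) i)) / Suc n"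
          unfolding \<nu>_def by (simp only: sum_subtractf diff_divide_distrib)
        moreover have "\<bar>\<Sum>k<Suc n. \<mu> ((\<phi> t ^^ k) (\<phi> s i)) - \<mu> ((\<phi> t ^^ k) i)\<bar>
                \<le> (\<Sum>k<Suc n. 1 / Suc l)"
          by (intro order_trans[OF sum_abs] sum_mono le)
        ultimately have "\<bar>\<nu> (\<phi> s i) - \<nu> i\<bar> \<le> (\<Sum>k<Suc n. 1 / Suc l) / Suc n"
          by (simp only: abs_divide abs_of_nat divide_right_mono of_nat_0_le_iff)
        thus ?thesis by simp
      qed
      thus ?thesis using \<nu>K by (auto simp: C_def sl)
    qed
    ultimately show ?case using \<nu>K by blast
  qed
  have "K \<inter> \<Inter>(C ` (T \<times> UNIV)) \<noteq> {}"
  proof (rule compact_imp_fip_image[OF K])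
    show "closed (C i)" for i by (rule clC)
    show "K \<inter> \<Inter> (C ` I') \<noteq> {}" if "finite I'" "I' \<subseteq> T \<times> UNIV" for I'
      using fin[OF that] by auto
  qed
  then obtain \<mu> where \<mu>: "\<mu> \<in> K" "\<And>t n. t \<in> T \<Longrightarrow> \<mu> \<in> C (t,n)" by blast
  have "\<mu> (\<phi> t i) = \<mu> i" if "t \<in> T" "i \<in> J" for t i
  proof -
    have "\<bar>\<mu> (\<phi> t i) - \<mu> i\<bar> \<le> 1 / Suc n" for n
      using \<mu>(2)[OF that(1), of n] that(2) by (auto simp: C_def)
    hence "\<bar>\<mu> (\<phi> t i) - \<mu> i\<bar> \<le> 0"
      by (intro LIMSEQ_le_const[OF LIMSEQ_inverse_real_of_nat]) (auto simp: inverse_eq_divide)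
    thus ?thesis by simp
  qed
  thus ?thesis using \<mu>(1) by blast
qed

text \<open>
  The fixed point theorem is applied twice to finitely additive measures. The measures invariant
  under the abelian set \<open>N\<close> are permuted by the group, since \<open>N\<close> is normal, and on them the group acts
  through commuting maps, since its commutators lie in \<open>N\<close>.
\<close>

theorem amenable_metabelian:
  fixes H (structure)
  assumes "group H" and N: "N \<subseteq> carrier H"
    and comm_N: "\<And>m n. m \<in> N \<Longrightarrow> n \<in> N \<Longrightarrow> m \<otimes> n = n \<otimes> m"
    and normal: "\<And>g n. g \<in> carrier H \<Longrightarrow> n \<in> N \<Longrightarrow> \<exists>n'\<in>N. g \<otimes> n = n' \<otimes> g"
    and quotient: "\<And>g h. g \<in> carrier H \<Longrightarrow> h \<in> carrier H \<Longrightarrow> \<exists>n\<in>N. h \<otimes> g = n \<otimes> (g \<otimes> h)"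
  shows "amenable H"
proof -
  interpret group H by fact
  define J where "J = Pow (carrier H)"
  define K where "K = {\<mu> :: 'a set \<Rightarrow> real. (\<forall>S. \<mu> S \<in> {0..1}) \<and> \<mu> (carrier H) = 1 \<and>
     (\<forall>S\<in>J. \<forall>T\<in>J. S \<inter> T = {} \<longrightarrow> \<mu> (S \<union> T) = \<mu> S + \<mu> T)}"
  define act (infixr \<open>\<cdot>\<close> 70) where "act = l_coset H"
  \<comment> \<open>The normal subgroup acts on \<open>K\<close>, and the whole group acts on the set \<open>K'\<close> of its fixed points.\<close>
  define K' where "K' = {\<mu>\<in>K. \<forall>n\<in>N. \<forall>S\<in>J. \<mu> (n \<cdot> S) = \<mu> S}"
  have ev: "continuous_on UNIV (\<lambda>\<mu>::'a set \<Rightarrow> real. \<mu> i)" for i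
    by simp
  have coset_eq: "g \<cdot> S = (\<lambda>x. g \<otimes> x) ` S" for g S
    by (auto simp: act_def l_coset_def)
  have coset_J: "g \<cdot> S \<in> J" if "g \<in> carrier H" "S \<in> J" for g S
    using that by (auto simp: J_def coset_eq)
  have assoc: "g \<cdot> (h \<cdot> S) = (g \<otimes> h) \<cdot> S"
    if "g \<in> carrier H" "h \<in> carrier H" "S \<in> J" for g h S
    using that by (simp add: J_def act_def lcos_m_assoc)
  have closedK: "closed K"
  proof -
    have "K = (\<Inter>S. {\<mu>. \<mu> S \<in> {0..1}}) \<inter> {\<mu>. \<mu> (carrier H) = 1} \<inter>
      (\<Inter>S\<in>J. \<Inter>T\<in>{T\<in>J. S \<inter> T = {}}. {\<mu>. \<mu> (S \<union> T) = \<mu> S + \<mu> T})"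
      by (auto simp: K_def)
    moreover have "closed {\<mu> :: 'a set \<Rightarrow> real. \<mu> S \<in> {0..1}}" for S
      unfolding atLeastAtMost_iff
      by (intro closed_Collect_conj closed_Collect_le continuous_intros ev)
    moreover have "closed {\<mu> :: 'a set \<Rightarrow> real. \<mu> (carrier H) = 1}"
      by (intro closed_Collect_eq continuous_intros ev)
    moreover have "closed {\<mu> :: 'a set \<Rightarrow> real. \<mu> (S \<union> T) = \<mu> S + \<mu> T}" for S T
      by (intro closed_Collect_eq continuous_intros ev)
    ultimately show ?thesis
      by (auto intro!: closed_Int closed_INT)
  qed
  \<comment> \<open>The set \<open>K\<close> is not empty: it contains the point mass at \<open>\<one>\<close>.\<close>
  have "(\<lambda>S. if \<one> \<in> S then 1 else 0) \<in> K"
    by (auto simp: K_def)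
  hence K_ne: "K \<noteq> {}" by blast
  have avgK: "(\<lambda>i. (\<Sum>k<Suc n. \<nu> k i) / Suc n) \<in> K" if \<nu>: "\<And>k. \<nu> k \<in> K" for n \<nu>
  proof -
    have "(\<Sum>k<Suc n. \<nu> k S) \<le> (\<Sum>k<Suc n. 1)" "(\<Sum>k<Suc n. \<nu> k S) \<ge> 0" for S
      using \<nu> by (auto simp only: K_def mem_Collect_eq atLeastAtMost_iff intro!: sum_mono sum_nonneg)
    hence "(\<Sum>k<Suc n. \<nu> k S) / Suc n \<in> {0..1}" for S
      by (simp del: sum.lessThan_Suc)
    moreover have "(\<Sum>k<Suc n. \<nu> k (carrier H)) = (\<Sum>k<Suc n. 1)"
      using \<nu> by (intro sum.cong) (auto simp: K_def)
    moreover have "(\<Sum>k<Suc n. \<nu> k (S \<union> T)) = (\<Sum>k<Suc n. \<nu> k S) + (\<Sum>k<Suc n. \<nu> k T)"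
      if "S \<in> J" "T \<in> J" "S \<inter> T = {}" for S T
      unfolding sum.distrib[symmetric] using \<nu> that by (intro sum.cong) (auto simp: K_def)
    ultimately show ?thesis
      by (simp add: K_def add_divide_distrib del: sum.lessThan_Suc of_nat_Suc)
  qed
  have actK: "(\<lambda>S. \<mu> (g \<cdot> S)) \<in> K" if g: "g \<in> carrier H" and \<mu>: "\<mu> \<in> K" for g \<mu>
  proof -
    have "g \<cdot> carrier H = carrier H"
    proof
      show "carrier H \<subseteq> g \<cdot> carrier H"
      proof
        fix x assume "x \<in> carrier H"
        hence "x = g \<otimes> (inv g \<otimes> x)" "inv g \<otimes> x \<in> carrier H"
          using g by (auto simp: m_assoc[symmetric])
        thus "x \<in> g \<cdot> carrier H" unfolding coset_eq by blast
      qed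
    qed (use g in \<open>auto simp: coset_eq\<close>)
    moreover have "\<mu> (g \<cdot> (S \<union> T)) = \<mu> (g \<cdot> S) + \<mu> (g \<cdot> T)"
      if ST: "S \<in> J" "T \<in> J" "S \<inter> T = {}" for S T
    proof -
      have "(g \<cdot> S) \<inter> (g \<cdot> T) = {}"
      proof -
        have "x = y" if "x \<in> S" "y \<in> T" "g \<otimes> x = g \<otimes> y" for x y
        proof -
          have "x \<in> carrier H" "y \<in> carrier H" using that ST(1,2) by (auto simp: J_def)
          moreover have "inv g \<otimes> (g \<otimes> x) = inv g \<otimes> (g \<otimes> y)" using that(3) by simp
          ultimately show ?thesis using g by (simp add: m_assoc[symmetric])
        qed
        thus ?thesis using ST(3) by (force simp: coset_eq)
      qed
      moreover have "g \<cdot> (S \<union> T) = (g \<cdot> S) \<union> (g \<cdot> T)"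
        by (auto simp: coset_eq)
      ultimately show ?thesis
        using \<mu> coset_J[OF g ST(1)] coset_J[OF g ST(2)] unfolding K_def by auto
    qed
    ultimately show ?thesis
      using \<mu> by (auto simp: K_def)
  qed
  have "\<exists>\<mu>\<in>K. \<forall>n\<in>N. \<forall>S\<in>J. \<mu> (n \<cdot> S) = \<mu> S"
  proof (rule Markov_Kakutani_reindexing[where \<phi> = "\<lambda>n S. n \<cdot> S"])
    fix s t \<mu> i assume "s \<in> N" "t \<in> N" "i \<in> J"
    thus "\<mu> (s \<cdot> (t \<cdot> i)) = \<mu> (t \<cdot> (s \<cdot> i))"
      using N by (simp add: assoc subset_iff comm_N)
  qed (use closedK K_ne N avgK actK coset_J in \<open>auto simp: K_def\<close>)
  hence K'_ne: "K' \<noteq> {}" by (auto simp: K'_def)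
  have closedK': "closed K'"
  proof -
    have "K' = K \<inter> (\<Inter>n\<in>N. \<Inter>S\<in>J. {\<mu>. \<mu> (n \<cdot> S) = \<mu> S})"
      by (auto simp: K'_def)
    moreover have "closed {\<mu> :: 'a set \<Rightarrow> real. \<mu> (n \<cdot> S) = \<mu> S}" for n S
      by (intro closed_Collect_eq continuous_intros ev)
    ultimately show ?thesis
      using closedK by (auto intro!: closed_Int closed_INT)
  qed
  have "\<exists>\<mu>\<in>K'. \<forall>g\<in>carrier H. \<forall>S\<in>J. \<mu> (g \<cdot> S) = \<mu> S"
  proof (rule Markov_Kakutani_reindexing[where \<phi> = "\<lambda>n S. n \<cdot> S"])
    fix n :: nat and \<nu> :: "nat \<Rightarrow> 'a set \<Rightarrow> real" assume \<nu>: "\<And>k. \<nu> k \<in> K'"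
    have "(\<Sum>k<Suc n. \<nu> k (m \<cdot> S)) = (\<Sum>k<Suc n. \<nu> k S)" if "m \<in> N" "S \<in> J" for m S
      using \<nu> that by (intro sum.cong) (auto simp: K'_def)
    thus "(\<lambda>i. (\<Sum>k<Suc n. \<nu> k i) / real (Suc n)) \<in> K'"
      using avgK[of \<nu>] \<nu> by (simp add: K'_def del: sum.lessThan_Suc of_nat_Suc)
  next
    fix g \<mu> assume g: "g \<in> carrier H" and \<mu>: "\<mu> \<in> K'"
    have "\<mu> (g \<cdot> (n \<cdot> S)) = \<mu> (g \<cdot> S)" if n: "n \<in> N" and S: "S \<in> J" for n S
    proof -
      obtain n' where n': "n' \<in> N" "g \<otimes> n = n' \<otimes> g" using normal[OF g n] by blast
      have "g \<cdot> (n \<cdot> S) = n' \<cdot> (g \<cdot> S)"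
        using n' n N g S by (simp add: assoc subset_iff)
      thus ?thesis using \<mu> n'(1) coset_J[OF g S] by (simp add: K'_def)
    qed
    thus "(\<lambda>S. \<mu> (g \<cdot> S)) \<in> K'"
      using actK[OF g] \<mu> by (simp add: K'_def)
  next
    fix h g \<mu> S assume h: "h \<in> carrier H" and g: "g \<in> carrier H" and \<mu>: "\<mu> \<in> K'" and S: "S \<in> J"
    obtain n where n: "n \<in> N" "h \<otimes> g = n \<otimes> (g \<otimes> h)" using quotient[OF g h] by blast
    have "h \<cdot> (g \<cdot> S) = n \<cdot> (g \<cdot> (h \<cdot> S))"
      using n N g h S coset_J by (simp add: assoc subset_iff m_assoc)
    thus "\<mu> (h \<cdot> (g \<cdot> S)) = \<mu> (g \<cdot> (h \<cdot> S))"
      using \<mu> n(1) coset_J[OF g coset_J[OF h S]] by (simp add: K'_def)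
  qed (use closedK' K'_ne coset_J in \<open>auto simp: K'_def K_def\<close>)
  then obtain \<mu> where "\<mu> \<in> K" "\<forall>g\<in>carrier H. \<forall>S\<in>J. \<mu> (g \<cdot> S) = \<mu> S"
    by (auto simp: K'_def)
  thus ?thesis
    unfolding amenable_def by (intro exI[of _ \<mu>]) (auto simp: K_def J_def act_def)
qed

section \<open>Numbers whose powers are roots of polynomials of height one\<close>

abbreviation eval_int_poly :: "int poly \<Rightarrow> complex \<Rightarrow> complex" where
  "eval_int_poly p \<equiv> poly (map_poly of_int p)"

lemma eval_int_poly_mult: "eval_int_poly (p * q) y = eval_int_poly p y * eval_int_poly q y"
proof -
  have "map_poly of_int (p * q) = (map_poly of_int p * map_poly of_int q :: complex poly)"
    by (intro poly_eqI) (simp add: coeff_mult coeff_map_poly)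
  thus ?thesis by simp
qed

lemma eval_int_poly_diff: "eval_int_poly (p - q) y = eval_int_poly p y - eval_int_poly q y"
proof -
  have "map_poly of_int (p - q) = (map_poly of_int p - map_poly of_int q :: complex poly)"
    by (intro poly_eqI) (simp add: coeff_map_poly)
  thus ?thesis by simp
qed

lemma eval_int_poly_smult: "eval_int_poly (smult c p) y = of_int c * eval_int_poly p y"
proof -
  have "map_poly of_int (smult c p) = (smult (of_int c) (map_poly of_int p) :: complex poly)"
    by (intro poly_eqI) (simp add: coeff_map_poly)
  thus ?thesis by simp
qed

text \<open>
  Nonzero polynomials of height one, in the sense that the largest absolute value of a coefficient is \<open>1\<close>.
\<close>

definition height_one :: "int poly \<Rightarrow> bool" where
  "height_one p \<longleftrightarrow> p \<noteq> 0 \<and> (\<forall>i. coeff p i \<in> {-1, 0, 1})"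

lemma height_one_root_norm:
  assumes p: "height_one p" and y: "eval_int_poly p y = 0"
  shows "norm y \<le> 2"
proof (rule ccontr)
  assume "\<not> norm y \<le> 2"
  hence y2: "norm y > 2" by simp
  define n where "n = degree p"
  have "coeff p n \<noteq> 0" "coeff p n \<in> {-1,0,1}"
    using p unfolding n_def height_one_def by auto
  hence lc: "norm (of_int (coeff p n) :: complex) = 1" by auto
  have "eval_int_poly p y = (\<Sum>i\<le>n. of_int (coeff p i) * y ^ i)"
    by (subst poly_altdef) (simp add: degree_map_poly coeff_map_poly n_def)
  also have "\<dots> = (\<Sum>i<n. of_int (coeff p i) * y ^ i) + of_int (coeff p n) * y ^ n"
    by (simp add: lessThan_Suc_atMost[symmetric])
  finally have "of_int (coeff p n) * y ^ n = - (\<Sum>i<n. of_int (coeff p i) * y ^ i)"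
    using y by (simp add: add_eq_0_iff)
  hence "norm (of_int (coeff p n) * y ^ n) = norm (\<Sum>i<n. of_int (coeff p i) * y ^ i)"
    by simp
  also have "\<dots> \<le> (\<Sum>i<n. norm y ^ i)"
  proof (intro order_trans[OF norm_sum] sum_mono)
    fix i
    have "coeff p i \<in> {-1,0,1}" using p unfolding height_one_def by auto
    thus "norm (of_int (coeff p i) * y ^ i) \<le> norm y ^ i"
      by (auto simp: norm_mult norm_power)
  qed
  also have "\<dots> = (norm y ^ n - 1) / (norm y - 1)"
    using y2 by (subst sum_gp_strict) (auto simp: divide_simps, (simp add: algebra_simps)?)
  also have "\<dots> < norm y ^ n"
  proof -
    have "norm y ^ n * 1 \<le> norm y ^ n * (norm y - 1)"
      using y2 by (intro mult_left_mono) auto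
    thus ?thesis using y2 by (simp add: divide_less_eq)
  qed
  finally show False using lc by (simp add: norm_mult norm_power)
qed

text \<open>
  The coefficients are, up to a factor of modulus one, elementary symmetric functions of the roots;
  the moduli of the two coefficients of a factor \<open>z - r\<close> add up to at most \<open>3\<close>.
\<close>

lemma coeff_bound_of_roots:
  fixes p :: "complex poly"
  assumes "norm (lead_coeff p) = 1" and "\<And>r. poly p r = 0 \<Longrightarrow> norm r \<le> 2"
  shows "norm (coeff p i) \<le> 3 ^ degree p"
  using assms
proof (induction "degree p" arbitrary: p i)
  case 0
  hence "norm (coeff p i) \<le> norm (coeff p 0)"
    by (cases i) (auto simp: coeff_eq_0)
  thus ?case using 0 by simp
next
  case (Suc n)
  obtain r where r: "poly p r = 0"
    using alg_closed_imp_poly_has_root[of p] Suc.hyps(2) by auto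
  then obtain q where q: "p = [:-r, 1:] * q" by (auto simp: poly_eq_0_iff_dvd dvd_def)
  have q0: "q \<noteq> 0" using q Suc.hyps(2) by auto
  have "degree p = degree [:-r, 1:] + degree q"
    unfolding q using q0 by (intro degree_mult_eq) auto
  hence dq: "degree q = n" using Suc.hyps(2) by simp
  have lq: "norm (lead_coeff q) = 1"
    using Suc.prems(1) unfolding q lead_coeff_mult by simp
  have IH: "norm (coeff q j) \<le> 3 ^ n" for j
  proof -
    have "norm (coeff q j) \<le> 3 ^ degree q"
      using Suc.hyps(1)[of q j] dq lq Suc.prems(2) q by auto
    thus ?thesis by (simp add: dq)
  qed
  have "coeff p i = - r * coeff q i + (if i = 0 then 0 else coeff q (i - 1))"
    unfolding q by (cases i) auto
  also have "norm \<dots> \<le> norm r * norm (coeff q i) + norm (if i = 0 then 0 else coeff q (i - 1))"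
    by (metis norm_minus_cancel norm_mult norm_triangle_ineq)
  also have "\<dots> \<le> 2 * 3 ^ n + 3 ^ n"
    using IH Suc.prems(2)[OF r] by (intro add_mono mult_mono) auto
  finally show ?case using Suc.hyps(2)[symmetric] by simp
qed

lemma finite_bounded_int_polys:
  "finite {p :: int poly. degree p \<le> D \<and> (\<forall>i. \<bar>coeff p i\<bar> \<le> B)}" (is "finite ?A")
proof -
  have "?A \<subseteq> Poly ` {xs. set xs \<subseteq> {-B..B} \<and> length xs = Suc D}"
  proof
    fix p assume p: "p \<in> ?A"
    have "p = Poly (map (coeff p) [0..<Suc D])"
    proof (rule poly_eqI)
      fix i
      show "coeff p i = coeff (Poly (map (coeff p) [0..<Suc D])) i"
        using p by (cases "i < Suc D") (auto simp: nth_default_def coeff_eq_0 simp del: upt_Suc)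
    qed
    moreover have "map (coeff p) [0..<Suc D] \<in> {xs. set xs \<subseteq> {-B..B} \<and> length xs = Suc D}"
      using p by (auto simp: abs_le_iff minus_le_iff simp del: upt_Suc)
    ultimately show "p \<in> Poly ` {xs. set xs \<subseteq> {-B..B} \<and> length xs = Suc D}" by blast
  qed
  thus ?thesis by (rule finite_subset) (intro finite_imageI finite_lists_length_eq, simp)
qed

text \<open>
  The complex numbers as a rational vector space, for dimension counts.
\<close>

interpretation rat_complex: vector_space "\<lambda>(q::rat) (z::complex). of_rat q * z"
  by unfold_locales (auto simp: algebra_simps of_rat_add of_rat_mult)

lemma clear_denominators:
  fixes u :: "'a \<Rightarrow> rat"
  assumes "finite A"
  shows "\<exists>d::int. d \<noteq> 0 \<and> (\<forall>x\<in>A. \<exists>z. of_int d * u x = of_int z)"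
  using assms
proof (induction A rule: finite_induct)
  case empty
  show ?case by (intro exI[of _ 1]) auto
next
  case (insert y A)
  then obtain d where d: "d \<noteq> 0" "\<forall>x\<in>A. \<exists>z. of_int d * u x = of_int z" by blast
  obtain a b where ab: "quotient_of (u y) = (a, b)" by force
  have b: "b > 0" "u y = of_int a / of_int b"
    using quotient_of_denom_pos[OF ab] quotient_of_div[OF ab] by auto
  have "of_int (d * b) * u y = of_int (d * a)" using b by (simp add: field_simps)
  hence "\<exists>z. of_int (d * b) * u y = of_int z" by blast
  moreover have "\<exists>z. of_int (d * b) * u x = of_int z" if "x \<in> A" for x
  proof -
    from bspec[OF d(2) that] obtain z where z: "of_int d * u x = of_int z" ..
    have "of_int (d * b) * u x = (of_int d * u x) * of_int b" by (simp add: mult_ac)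
    also have "\<dots> = of_int (z * b)" by (simp add: z)
    finally have "of_int (d * b) * u x = of_int (z * b)" .
    thus ?thesis by blast
  qed
  ultimately show ?case using d(1) b(1) by (intro exI[of _ "d * b"]) (simp del: of_int_mult)
qed

text \<open>
  A polynomial of height one has leading coefficient \<open>1\<close> or \<open>-1\<close>, so all powers of its root \<open>\<mu>\<close> lie in the
  rational span of the first \<open>degree P\<close> ones. Among the first \<open>degree P + 1\<close> powers of \<open>\<mu> ^ j\<close> there
  is thus a rational relation.
\<close>

lemma power_has_bounded_degree_annihilator:
  assumes P: "height_one P" and \<mu>: "eval_int_poly P \<mu> = 0"
  shows "\<exists>R. R \<noteq> 0 \<and> degree R \<le> degree P \<and> eval_int_poly R (\<mu> ^ j) = 0"
proof -
  define D where "D = degree P"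
  define V where "V = rat_complex.span ((\<lambda>i. \<mu> ^ i) ` {..<D})"
  have lc: "coeff P D \<in> {-1,1}"
    using P leading_coeff_0_iff[of P] unfolding height_one_def D_def by (metis insertE insertI1 singletonD insertI2)
  have "eval_int_poly P \<mu> = (\<Sum>i\<le>D. of_int (coeff P i) * \<mu> ^ i)"
    by (subst poly_altdef) (simp add: degree_map_poly coeff_map_poly D_def)
  also have "\<dots> = (\<Sum>i<D. of_int (coeff P i) * \<mu> ^ i) + of_int (coeff P D) * \<mu> ^ D"
    by (simp add: lessThan_Suc_atMost[symmetric])
  finally have eq: "of_int (coeff P D) * \<mu> ^ D = - (\<Sum>i<D. of_int (coeff P i) * \<mu> ^ i)"
    using \<mu> by (simp add: add_eq_0_iff)
  have "of_int (coeff P D) * (of_int (coeff P D) * \<mu> ^ D) = \<mu> ^ D"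
    using lc by auto
  hence "\<mu> ^ D = (\<Sum>i<D. of_rat (of_int (- coeff P D * coeff P i)) * \<mu> ^ i)"
    unfolding eq by (simp add: sum_distrib_left sum_negf mult_ac of_rat_mult of_rat_minus)
  hence \<mu>D: "\<mu> ^ D = (\<Sum>i<D. of_rat (of_int (- coeff P D * coeff P i)) * \<mu> ^ i)" .
  have memV: "\<mu> ^ n \<in> V" for n
  proof (induction n rule: less_induct)
    case (less n)
    show ?case
    proof (cases "n < D")
      case True
      thus ?thesis unfolding V_def by (intro rat_complex.span_base) auto
    next
      case False
      then obtain m where m: "n = D + m" by (metis le_Suc_ex not_less)
      have "\<mu> ^ n = (\<Sum>i<D. of_rat (of_int (- coeff P D * coeff P i)) * \<mu> ^ (i + m))"
        unfolding m power_add by (subst \<mu>D) (simp only: sum_distrib_right mult.assoc)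
      also have "\<dots> \<in> V"
        unfolding V_def
        by (intro rat_complex.span_sum rat_complex.span_scale) (use less m in \<open>auto simp: V_def\<close>)
      finally show ?thesis .
    qed
  qed
  define y where "y = \<mu> ^ j"
  show ?thesis
  proof (cases "inj_on (\<lambda>i. y ^ i) {..D}")
    case False
    then obtain a b where ab: "a < b" "b \<le> D" "y ^ a = y ^ b"
      unfolding inj_on_def by (metis atMost_iff linorder_neqE_nat)
    define R :: "int poly" where "R = monom 1 b - monom 1 a"
    have "coeff R b = 1" using ab by (simp add: R_def)
    moreover have "degree R \<le> D"
      unfolding R_def using ab by (intro degree_diff_le) (auto intro: order_trans[OF degree_monom_le])
    moreover have "eval_int_poly R y = 0"
      using ab by (simp add: R_def eval_int_poly_diff map_poly_monom poly_monom)
    ultimately show ?thesis unfolding y_def D_def by (intro exI[of _ R]) auto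
  next
    case inj: True
    define Y where "Y = (\<lambda>i. y ^ i) ` {..D}"
    have cY: "card Y = Suc D" unfolding Y_def using inj by (simp add: card_image)
    have "\<not> rat_complex.independent Y"
    proof
      assume ind: "rat_complex.independent Y"
      have "Y \<subseteq> V" unfolding Y_def y_def using memV by (auto simp: power_mult[symmetric])
      hence "card Y \<le> card ((\<lambda>i. \<mu> ^ i) ` {..<D})"
        using rat_complex.independent_span_bound[OF _ ind, of "(\<lambda>i. \<mu> ^ i) ` {..<D}"]
        unfolding V_def by auto
      also have "\<dots> \<le> D" using card_image_le[of "{..<D}"] by auto
      finally show False using cY by simp
    qed
    moreover have fY: "finite Y" by (simp add: Y_def)
    ultimately obtain u where u: "\<exists>v\<in>Y. u v \<noteq> 0" "(\<Sum>v\<in>Y. of_rat (u v) * v) = (0::complex)"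
      using rat_complex.dependent_finite[OF fY] by auto
    obtain d where d: "d \<noteq> 0" "\<forall>v\<in>Y. \<exists>z. of_int d * u v = of_int z"
      using clear_denominators[OF fY, of u] by auto
    then obtain z where z: "\<And>v. v \<in> Y \<Longrightarrow> of_int d * u v = of_int (z v)" by metis
    define R :: "int poly" where "R = (\<Sum>i\<le>D. monom (z (y ^ i)) i)"
    have cR: "coeff R i = (if i \<le> D then z (y ^ i) else 0)" for i
      by (simp add: R_def coeff_sum)
    have "\<exists>i\<le>D. z (y ^ i) \<noteq> 0"
    proof -
      obtain i where i: "i \<le> D" "u (y ^ i) \<noteq> 0" using u(1) by (auto simp: Y_def)
      hence "of_int (z (y ^ i)) \<noteq> (0::rat)"
        using z[of "y ^ i"] d(1) by (auto simp: Y_def simp flip: z)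
      thus ?thesis using i by auto
    qed
    hence "R \<noteq> 0" using cR by (metis coeff_0)
    moreover have dR: "degree R \<le> D" by (rule degree_le) (simp add: cR)
    moreover have "eval_int_poly R y = 0"
    proof -
      have "eval_int_poly R y = (\<Sum>i\<le>D. of_int (z (y ^ i)) * y ^ i)"
      proof -
        have "eval_int_poly R y = (\<Sum>i\<le>degree R. of_int (coeff R i) * y ^ i)"
          by (subst poly_altdef) (simp add: degree_map_poly coeff_map_poly)
        also have "\<dots> = (\<Sum>i\<le>D. of_int (coeff R i) * y ^ i)"
          by (intro sum.mono_neutral_left) (use dR in \<open>auto simp: coeff_eq_0\<close>)
        finally show ?thesis by (simp add: cR)
      qed
      also have "\<dots> = (\<Sum>v\<in>Y. of_int (z v) * v)"
        unfolding Y_def using inj by (simp add: sum.reindex)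
      also have "\<dots> = (\<Sum>v\<in>Y. of_int d * (of_rat (u v) * v))"
      proof (rule sum.cong)
        fix v assume "v \<in> Y"
        hence "(of_rat (of_int d * u v) :: complex) = of_rat (of_int (z v))" by (simp only: z)
        thus "of_int (z v) * v = of_int d * (of_rat (u v) * v)" by (simp add: of_rat_mult)
      qed simp
      finally show ?thesis using u(2) by (simp flip: sum_distrib_left)
    qed
    ultimately show ?thesis unfolding y_def D_def by (intro exI[of _ R]) auto
  qed
qed

text \<open>
  A primitive integer polynomial of least degree vanishing at \<open>y\<close> divides \<open>P\<close> over the rationals, by
  division with remainder, and hence over the integers, by Gauss's lemma.
\<close>

lemma minimal_int_poly_dvd:
  assumes R: "R \<noteq> 0" "eval_int_poly R y = 0" and P: "eval_int_poly P y = 0"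
  shows "\<exists>m. m \<noteq> 0 \<and> degree m \<le> degree R \<and> eval_int_poly m y = 0 \<and> m dvd P"
proof -
  define d where "d = (LEAST d. \<exists>m. m \<noteq> 0 \<and> eval_int_poly m y = 0 \<and> degree m = d)"
  have "\<exists>m. m \<noteq> 0 \<and> eval_int_poly m y = 0 \<and> degree m = d"
    unfolding d_def by (rule LeastI) (use R in blast)
  then obtain m0 where m0: "m0 \<noteq> 0" "eval_int_poly m0 y = 0" "degree m0 = d" by blast
  have min: "d \<le> degree m" if "m \<noteq> 0" "eval_int_poly m y = 0" for m
    unfolding d_def by (rule Least_le) (use that in blast)
  define m where "m = primitive_part m0"
  have m_nz: "m \<noteq> 0" and cm: "Polynomial.content m = 1" using m0(1) by (auto simp: m_def)
  have "eval_int_poly m0 y = of_int (Polynomial.content m0) * eval_int_poly m y"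
    unfolding m_def by (subst eval_int_poly_smult[symmetric]) simp
  hence my: "eval_int_poly m y = 0" using m0 by simp
  have dm: "degree m = d" using m0 by (simp add: m_def)
  obtain a q where aq: "a \<noteq> 0" "smult a P = m * q + pseudo_mod P m"
    using pseudo_mod(1)[OF m_nz, of P] by blast
  have "eval_int_poly (pseudo_mod P m) y = 0"
  proof -
    have "pseudo_mod P m = smult a P - m * q" using aq(2) by simp
    thus ?thesis by (simp add: eval_int_poly_diff eval_int_poly_smult eval_int_poly_mult my P)
  qed
  hence "pseudo_mod P m = 0"
    using pseudo_mod(2)[OF m_nz, of P] min[of "pseudo_mod P m"] dm by force
  hence "m dvd smult a P" using aq(2) by simp
  hence "fract_poly m dvd smult (to_fract a) (fract_poly P)"
    by (subst fract_poly_smult[symmetric], rule fract_poly_dvd)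
  hence "fract_poly m dvd fract_poly P" using aq(1) by (simp add: dvd_smult_iff)
  hence "m dvd P" using cm by (rule fract_poly_dvdD)
  thus ?thesis using m_nz my dm min[OF R] by auto
qed

text \<open>
  Each \<open>\<mu> ^ j\<close> is a root of an integer polynomial whose degree is at most that of a polynomial for \<open>\<mu>\<close>
  and which divides a polynomial of height one. The roots of the latter have modulus at most \<open>2\<close>, so
  the former has bounded coefficients. Only finitely many numbers arise in this way, so two powers of
  \<open>\<mu>\<close> coincide.
\<close>

theorem root_of_unity_if_powers_height_one:
  fixes \<mu> :: complex
  assumes "\<mu> \<noteq> 0" and P: "\<And>j. j \<ge> 1 \<Longrightarrow> \<exists>p. height_one p \<and> eval_int_poly p (\<mu> ^ j) = 0"
  shows "\<exists>n>0. \<mu> ^ n = 1"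
proof -
  obtain P1 where P1: "height_one P1" "eval_int_poly P1 \<mu> = 0" using P[of 1] by auto
  define D where "D = degree P1"
  define \<M> where "\<M> = {m :: int poly. degree m \<le> D \<and> (\<forall>i. \<bar>coeff m i\<bar> \<le> 3 ^ D)} - {0}"
  have "finite (\<Union>m\<in>\<M>. {y. eval_int_poly m y = 0})"
  proof (intro finite_UN_I)
    show "finite \<M>" unfolding \<M>_def using finite_bounded_int_polys by blast
    show "finite {y. eval_int_poly m y = 0}" if "m \<in> \<M>" for m
      using that by (intro poly_roots_finite) (auto simp: \<M>_def map_poly_eq_0_iff)
  qed
  moreover have "\<mu> ^ j \<in> (\<Union>m\<in>\<M>. {y. eval_int_poly m y = 0})" if j: "j \<ge> 1" for j
  proof -
    obtain p where p: "height_one p" "eval_int_poly p (\<mu> ^ j) = 0" using P[OF j] by blast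
    obtain R where R: "R \<noteq> 0" "degree R \<le> D" "eval_int_poly R (\<mu> ^ j) = 0"
      using power_has_bounded_degree_annihilator[OF P1] unfolding D_def by blast
    obtain m where m: "m \<noteq> 0" "degree m \<le> D" "eval_int_poly m (\<mu> ^ j) = 0" "m dvd p"
      using minimal_int_poly_dvd[OF R(1,3) p(2)] R(2) by (meson order_trans)
    have "lead_coeff m dvd lead_coeff p" using m(4) by (auto simp: dvd_def lead_coeff_mult)
    moreover have "lead_coeff p dvd 1"
    proof -
      have "lead_coeff p \<noteq> 0" "lead_coeff p \<in> {-1,0,1}" using p(1) unfolding height_one_def by auto
      thus ?thesis by auto
    qed
    ultimately have "\<bar>lead_coeff m\<bar> = 1" by (meson dvd_trans zdvd1_eq)
    hence "norm (of_int (lead_coeff m) :: complex) = 1"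
      by (metis norm_of_int of_int_1 of_int_abs)
    hence "norm (lead_coeff (map_poly of_int m :: complex poly)) = 1"
      by (simp add: degree_map_poly coeff_map_poly)
    moreover have "norm r \<le> 2" if "eval_int_poly m r = 0" for r
      using height_one_root_norm[OF p(1)] m(4) that by (auto simp: dvd_def eval_int_poly_mult)
    ultimately have *: "norm (coeff (map_poly of_int m :: complex poly) i) \<le> 3 ^ degree m" for i
      using coeff_bound_of_roots[of "map_poly of_int m" i] by (simp add: degree_map_poly)
    have "\<bar>coeff m i\<bar> \<le> 3 ^ D" for i
    proof -
      have "real_of_int \<bar>coeff m i\<bar> \<le> 3 ^ degree m" using *[of i] by (simp add: coeff_map_poly)
      also have "\<dots> \<le> 3 ^ D" using m(2) by (intro power_increasing) auto
      finally show ?thesis by (metis of_int_le_iff of_int_numeral of_int_power)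
    qed
    thus ?thesis using m by (auto simp: \<M>_def)
  qed
  ultimately have "finite ((\<lambda>j. \<mu> ^ j) ` {1..})"
    by (intro finite_subset[of "(\<lambda>j. \<mu> ^ j) ` {1..}"]) auto
  hence "\<not> inj_on (\<lambda>j. \<mu> ^ j) {1..}"
    using finite_imageD infinite_Ici by blast
  then obtain i j where ij: "i < j" "\<mu> ^ i = \<mu> ^ j"
    unfolding inj_on_def by (metis linorder_neqE_nat)
  have "\<mu> ^ i * \<mu> ^ (j - i) = \<mu> ^ (i + (j - i))" by (rule power_add[symmetric])
  hence "\<mu> ^ i * \<mu> ^ (j - i) = \<mu> ^ i * 1" using ij by simp
  thus ?thesis using assms(1) ij(1) by (intro exI[of _ "j - i"]) simp
qed

section \<open>Coinciding words in two power series\<close>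

abbreviation comp_word :: "complex fps list \<Rightarrow> complex fps" where
  "comp_word w \<equiv> foldr fps_compose w fps_X"

lemma comp_word_nth_0: "(\<And>x. x \<in> set w \<Longrightarrow> x $ 0 = 0) \<Longrightarrow> comp_word w $ 0 = 0"
  by (induction w) auto

lemma comp_word_nth_1:
  "(\<And>x. x \<in> set w \<Longrightarrow> x $ 0 = 0 \<and> x $ 1 = l) \<Longrightarrow> comp_word w $ 1 = l ^ length w"
  by (induction w) (auto simp: fps_compose_nth)

lemma comp_word_append:
  "(\<And>x. x \<in> set w \<union> set v \<Longrightarrow> x $ 0 = 0) \<Longrightarrow>
     comp_word (w @ v) = comp_word w oo comp_word v"
proof (induction w)
  case (Cons x w)
  thus ?case
    using comp_word_nth_0[of w] comp_word_nth_0[of v] by (simp add: fps_compose_assoc)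
qed (use comp_word_nth_0[of v] in simp)

text \<open>
  The words have the same length and end in different letters. The equal length makes the two sides
  comparable coefficient by coefficient and in degree.
\<close>

definition collide :: "complex fps \<Rightarrow> complex fps \<Rightarrow> bool" where
  "collide a b \<longleftrightarrow> (\<exists>u v. set u \<subseteq> {a, b} \<and> set v \<subseteq> {a, b} \<and> length u = length v \<and>
     comp_word (u @ [a]) = comp_word (v @ [b]))"

lemma fps_compose_cancel_right:
  fixes f g h :: "complex fps"
  assumes "f oo h = g oo h" "h $ 0 = 0" "h $ 1 \<noteq> 0"
  shows "f = g"
proof -
  have "f oo h oo fps_inv h = g oo h oo fps_inv h" using assms(1) by simp
  moreover have "fps_inv h $ 0 = 0" by (simp add: fps_inv_def)
  ultimately show ?thesis
    using fps_inv_right[OF assms(2,3)] assms(2) by (simp flip: fps_compose_assoc)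
qed

text \<open>
  Cancel the common suffix of the two words. If one of them is used up, the rest of the other is a
  nonempty word equal to the identity, and multiplying it by the letter that does not end it gives
  the required equality.
\<close>

lemma distinct_words_last_letters_differ:
  assumes a: "a $ 0 = 0" "a $ 1 \<noteq> 0" and b: "b $ 0 = 0" "b $ 1 \<noteq> 0"
    and "w1 \<noteq> w2" "set w1 \<subseteq> {a, b}" "set w2 \<subseteq> {a, b}" "comp_word w1 = comp_word w2"
  shows "\<exists>u v. set u \<subseteq> {a, b} \<and> set v \<subseteq> {a, b} \<and> comp_word (u @ [a]) = comp_word (v @ [b])"
proof -
  have ab0: "x $ 0 = 0" "x $ 1 \<noteq> 0" if "x \<in> {a, b}" for x using that a b by auto
  have trivial: ?thesis if w: "w \<noteq> []" "set w \<subseteq> {a, b}" "comp_word w = fps_X" for w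
  proof -
    obtain u x where ux: "w = u @ [x]" using w(1) by (metis rev_exhaust)
    have id: "comp_word (y # w) = comp_word [y]" if "y \<in> {a, b}" for y
      using w(3) by simp
    show ?thesis
    proof (cases "x = a")
      case True
      have "comp_word ((b # u) @ [a]) = comp_word ([] @ [b])"
        using id[of b] unfolding ux True by simp
      thus ?thesis using w(2) ux by (intro exI[of _ "b # u"] exI[of _ "[]"]) auto
    next
      case False
      hence x: "x = b" using w(2) ux by auto
      have "comp_word ([] @ [a]) = comp_word ((a # u) @ [b])"
        using id[of a] unfolding ux x by simp
      thus ?thesis using w(2) ux by (intro exI[of _ "[]"] exI[of _ "a # u"]) auto
    qed
  qed
  from assms(5-) show ?thesis
  proof (induction "length w1" arbitrary: w1 w2)
    case 0
    thus ?case using trivial[of w2] by auto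
  next
    case (Suc n)
    obtain u x where ux: "w1 = u @ [x]" using Suc.hyps(2) by (metis length_0_conv nat.distinct(1) rev_exhaust)
    show ?case
    proof (cases "w2 = []")
      case True
      thus ?thesis using trivial[of w1] Suc.prems by auto
    next
      case False
      then obtain v y where vy: "w2 = v @ [y]" by (metis rev_exhaust)
      have set: "set u \<subseteq> {a, b}" "set v \<subseteq> {a, b}" "x \<in> {a, b}" "y \<in> {a, b}"
        using Suc.prems ux vy by auto
      show ?thesis
      proof (cases "x = y")
        case True
        have "comp_word (u @ [x]) = comp_word u oo comp_word [x]"
          "comp_word (v @ [x]) = comp_word v oo comp_word [x]"
          by (rule comp_word_append; use set ab0 in auto)+
        hence "comp_word u oo x = comp_word v oo x"
          using Suc.prems(4) unfolding ux vy True by simp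
        hence "comp_word u = comp_word v"
          using fps_compose_cancel_right ab0 set(3) by blast
        moreover have "n = length u" using Suc.hyps(2) ux by simp
        moreover have "u \<noteq> v" using Suc.prems(1) ux vy True by simp
        ultimately show ?thesis by (intro Suc.hyps(1)[of u v] set)
      next
        case False
        hence "x = a \<and> y = b \<or> x = b \<and> y = a" using set by auto
        thus ?thesis
        proof (elim disjE conjE)
          assume "x = a" "y = b"
          thus ?thesis using Suc.prems(4) set(1,2) unfolding ux vy by (intro exI[of _ u] exI[of _ v]) simp
        next
          assume "x = b" "y = a"
          thus ?thesis using Suc.prems(4) set(1,2) unfolding ux vy by (intro exI[of _ v] exI[of _ u]) simp
        qed
      qed
    qed
  qed
qed

text \<open>
  The two equal words can be given the same length: if \<open>x\<close> ends in \<open>a\<close>, \<open>y\<close> ends in \<open>b\<close>, and \<open>x = y\<close>,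
  then \<open>y @ x\<close> and \<open>x @ y\<close> are equal, have the same length, and end in \<open>a\<close> and \<open>b\<close>.
\<close>

lemma collideI:
  assumes a: "a $ 0 = 0" "a $ 1 \<noteq> 0" and b: "b $ 0 = 0" "b $ 1 \<noteq> 0"
    and "w1 \<noteq> w2" "set w1 \<subseteq> {a, b}" "set w2 \<subseteq> {a, b}" "comp_word w1 = comp_word w2"
  shows "collide a b"
proof -
  obtain u v where uv: "set u \<subseteq> {a, b}" "set v \<subseteq> {a, b}"
    "comp_word (u @ [a]) = comp_word (v @ [b])"
    using distinct_words_last_letters_differ[OF assms] by blast
  have z: "x $ 0 = 0" if "x \<in> {a, b}" for x using that a b by auto
  have "comp_word ((v @ [b]) @ (u @ [a])) = comp_word (v @ [b]) oo comp_word (u @ [a])"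
    by (rule comp_word_append) (use uv z in auto)
  also have "\<dots> = comp_word (u @ [a]) oo comp_word (v @ [b])"
    using uv(3) by simp
  also have "\<dots> = comp_word ((u @ [a]) @ (v @ [b]))"
    by (rule comp_word_append[symmetric]) (use uv z in auto)
  finally show ?thesis
    unfolding collide_def using uv
    by (intro exI[of _ "v @ [b] @ u"] exI[of _ "u @ [a] @ v"]) auto
qed

text \<open>
  As \<open>x\<close> and \<open>y\<close> have no constant term, a product of at least two factors sees their coefficients of
  index \<open>k + 1\<close> only in higher degree.
\<close>

lemma jet_power:
  fixes x y :: "complex fps"
  assumes "x $ 0 = 0" "y $ 0 = 0" "\<forall>n\<le>k. x $ n = y $ n"
  shows "(\<forall>n\<le>k. (x ^ i) $ n = (y ^ i) $ n) \<and> (2 \<le> i \<longrightarrow> (x ^ i) $ Suc k = (y ^ i) $ Suc k)"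
proof (induction i)
  case (Suc i)
  have "(x ^ Suc i) $ n = (y ^ Suc i) $ n" if "n \<le> k" for n
    unfolding power_Suc fps_mult_nth using that Suc assms by (intro sum.cong) auto
  moreover have "(x ^ Suc i) $ Suc k = (y ^ Suc i) $ Suc k" if "2 \<le> Suc i"
    unfolding power_Suc fps_mult_nth
  proof (intro sum.cong refl)
    fix j assume "j \<in> {0..Suc k}"
    then consider "j = 0" | "j = Suc k" | "1 \<le> j" "j \<le> k" by fastforce
    thus "x $ j * (x ^ i) $ (Suc k - j) = y $ j * (y ^ i) $ (Suc k - j)"
    proof cases
      case 2
      have "i > 0" using that by simp
      hence "(x ^ i) $ 0 = 0" "(y ^ i) $ 0 = 0"
        using assms(1,2) by (simp_all add: fps_power_zeroth)
      thus ?thesis by (simp only: 2 diff_self_eq_0 mult_zero_right)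
    qed (use assms Suc in auto)
  qed
  ultimately show ?case by auto
qed auto

lemma jet_compose:
  fixes f g x y :: "complex fps"
  assumes "x $ 0 = 0" "y $ 0 = 0" "\<forall>n\<le>k. x $ n = y $ n" "\<forall>n\<le>k. f $ n = g $ n" "k \<ge> 1"
  shows "\<forall>n\<le>k. (f oo x) $ n = (g oo y) $ n"
    and "(f oo x) $ Suc k - (g oo y) $ Suc k
           = g $ 1 * (x $ Suc k - y $ Suc k) + (f $ Suc k - g $ Suc k) * (x $ 1) ^ Suc k"
proof -
  note J = jet_power[OF assms(1-3)]
  show "\<forall>n\<le>k. (f oo x) $ n = (g oo y) $ n"
  proof (intro allI impI)
    fix n assume "n \<le> k"
    thus "(f oo x) $ n = (g oo y) $ n"
      unfolding fps_compose_nth using J assms(4) by (intro sum.cong refl) (simp add: order_trans)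
  qed
  have "(f oo x) $ Suc k - (g oo y) $ Suc k
          = (\<Sum>i=0..Suc k. f $ i * (x ^ i) $ Suc k - g $ i * (y ^ i) $ Suc k)"
    unfolding fps_compose_nth by (simp only: sum_subtractf)
  also have "\<dots> = (\<Sum>i=0..Suc k. (if i = 1 then g $ 1 * (x $ Suc k - y $ Suc k) else 0) +
                     (if i = Suc k then (f $ Suc k - g $ Suc k) * (x $ 1) ^ Suc k else 0))"
  proof (intro sum.cong refl)
    fix i assume i: "i \<in> {0..Suc k}"
    then consider "i = 0" | "i = 1" | "i = Suc k" | "2 \<le> i" "i \<le> k" by fastforce
    thus "f $ i * (x ^ i) $ Suc k - g $ i * (y ^ i) $ Suc k
      = (if i = 1 then g $ 1 * (x $ Suc k - y $ Suc k) else 0) +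
        (if i = Suc k then (f $ Suc k - g $ Suc k) * (x $ 1) ^ Suc k else 0)"
    proof cases
      case 3
      have "(x ^ Suc k) $ Suc k = (x $ 1) ^ Suc k"
        using startsby_zero_power_nth_same[OF assms(1)] by blast
      moreover have "(y ^ Suc k) $ Suc k = (x ^ Suc k) $ Suc k" using J[of "Suc k"] assms(5) by simp
      ultimately have "f $ i * (x ^ i) $ Suc k - g $ i * (y ^ i) $ Suc k
          = (f $ Suc k - g $ Suc k) * (x $ 1) ^ Suc k"
        unfolding 3 by (simp only: left_diff_distrib)
      thus ?thesis using 3 assms(5) by (simp del: power_Suc)
    next
      case 4
      have "f $ i = g $ i" "(x ^ i) $ Suc k = (y ^ i) $ Suc k" using J[of i] assms(4) 4 by auto
      thus ?thesis using 4 by simp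
    qed (use assms in \<open>auto simp: algebra_simps\<close>)
  qed
  also have "\<dots> = g $ 1 * (x $ Suc k - y $ Suc k) + (f $ Suc k - g $ Suc k) * (x $ 1) ^ Suc k"
    by (simp add: sum.distrib)
  finally show "(f oo x) $ Suc k - (g oo y) $ Suc k
           = g $ 1 * (x $ Suc k - y $ Suc k) + (f $ Suc k - g $ Suc k) * (x $ 1) ^ Suc k" .
qed

text \<open>
  The exponents are the numbers of letters to the right of the occurrences of \<open>b\<close>.
\<close>

fun position_poly :: "'a \<Rightarrow> 'a list \<Rightarrow> int poly" where
  "position_poly b [] = 0"
| "position_poly b (x # w) = position_poly b w + (if x = b then monom 1 (length w) else 0)"

declare position_poly.simps(2) [simp del]

lemma coeff_position_poly:
  "coeff (position_poly b w) i = (if i < length w \<and> w ! (length w - Suc i) = b then 1 else 0)"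
proof (induction w)
  case (Cons x w)
  consider "i < length w" | "i = length w" | "i > length w" by linarith
  thus ?case
    by cases (use Cons in \<open>auto simp: nth_Cons' position_poly.simps(2)\<close>)
qed simp

lemma eval_position_poly_Cons:
  "eval_int_poly (position_poly b (x # w)) y
     = eval_int_poly (position_poly b w) y + (if x = b then y ^ length w else 0)"
  using eval_int_poly_diff[of "position_poly b (x # w)" "position_poly b w" y]
  by (auto simp: map_poly_monom poly_monom position_poly.simps(2) split: if_splits)

text \<open>
  Replacing one letter \<open>a\<close> by \<open>b\<close> changes the coefficient of index \<open>k + 1\<close> by \<open>b $ Suc k - a $ Suc k\<close>, times
  \<open>l\<close> for each letter on its left and \<open>l ^ (k + 1)\<close> for each letter on its right. The replacements in
  a word add up, because lower coefficients do not change. The factor \<open>l\<close> on the left avoids the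
  exponent \<open>length w - 1\<close>.
\<close>

lemma jet_comp_word:
  assumes a: "a $ 0 = 0" "a $ 1 = l" and b: "b $ 0 = 0" "b $ 1 = l"
    and k: "k \<ge> 1" "\<forall>n\<le>k. b $ n = a $ n" and w: "set w \<subseteq> {a, b}"
  shows "(\<forall>n\<le>k. comp_word w $ n = comp_word (replicate (length w) a) $ n) \<and>
         l * (comp_word w $ Suc k - comp_word (replicate (length w) a) $ Suc k)
           = (b $ Suc k - a $ Suc k) * l ^ length w * eval_int_poly (position_poly b w) (l ^ k)"
  using w
proof (induction w)
  case (Cons x w)
  define y where "y = comp_word (replicate (length w) a)"
  have w0: "comp_word w $ 0 = 0" "comp_word w $ 1 = l ^ length w"
    using Cons.prems a b by (auto intro!: comp_word_nth_0 comp_word_nth_1[unfolded One_nat_def])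
  have y0: "y $ 0 = 0" unfolding y_def by (intro comp_word_nth_0) (use a in auto)
  have IH: "\<forall>n\<le>k. comp_word w $ n = y $ n"
    "l * (comp_word w $ Suc k - y $ Suc k)
           = (b $ Suc k - a $ Suc k) * l ^ length w * eval_int_poly (position_poly b w) (l ^ k)"
    using Cons unfolding y_def by auto
  have x: "\<forall>n\<le>k. x $ n = a $ n" using Cons.prems k by auto
  have xd: "x $ Suc k - a $ Suc k = (if x = b then b $ Suc k - a $ Suc k else 0)"
    using Cons.prems by auto
  note J = jet_compose[OF w0(1) y0 IH(1) x k(1)]
  have "l * ((x oo comp_word w) $ Suc k - (a oo y) $ Suc k)
     = l * (l * (comp_word w $ Suc k - y $ Suc k)) +
         (x $ Suc k - a $ Suc k) * l ^ length (x # w) * (l ^ k) ^ length w"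
    unfolding J(2) w0(2) a(2) by (simp add: algebra_simps power_mult_distrib flip: power_mult)
  also have "\<dots> = (b $ Suc k - a $ Suc k) * l ^ length (x # w)
                   * eval_int_poly (position_poly b (x # w)) (l ^ k)"
    unfolding IH(2) eval_position_poly_Cons xd by (simp add: algebra_simps)
  finally show ?case using J(1) unfolding y_def by simp
qed simp

lemma collide_imp_height_one:
  assumes a: "a $ 0 = 0" "a $ 1 = l" and b: "b $ 0 = 0" "b $ 1 = l" and "l \<noteq> 0"
    and k: "k \<ge> 1" "\<forall>n\<le>k. b $ n = a $ n" "b $ Suc k \<noteq> a $ Suc k" and "collide a b"
  shows "\<exists>p. height_one p \<and> eval_int_poly p (l ^ k) = 0"
proof -
  obtain u v where uv: "set u \<subseteq> {a, b}" "set v \<subseteq> {a, b}" "length u = length v"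
     "comp_word (u @ [a]) = comp_word (v @ [b])"
    using \<open>collide a b\<close> unfolding collide_def by blast
  define p where "p = position_poly b (v @ [b]) - position_poly b (u @ [a])"
  have "l * (comp_word (u @ [a]) $ Suc k - comp_word (replicate (Suc (length u)) a) $ Suc k)
           = (b $ Suc k - a $ Suc k) * l ^ Suc (length u) * eval_int_poly (position_poly b (u @ [a])) (l ^ k)"
    using jet_comp_word[OF a b k(1,2), of "u @ [a]"] uv(1) by simp
  moreover have "l * (comp_word (v @ [b]) $ Suc k - comp_word (replicate (Suc (length u)) a) $ Suc k)
           = (b $ Suc k - a $ Suc k) * l ^ Suc (length u) * eval_int_poly (position_poly b (v @ [b])) (l ^ k)"
    using jet_comp_word[OF a b k(1,2), of "v @ [b]"] uv(2,3) by simp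
  ultimately have "eval_int_poly p (l ^ k) = 0"
    using uv(4) k(3) \<open>l \<noteq> 0\<close> by (simp add: p_def eval_int_poly_diff)
  moreover have "coeff p 0 = 1"
    using k(3) by (auto simp: p_def coeff_position_poly)
  hence "p \<noteq> 0" by auto
  moreover have "coeff p i \<in> {-1, 0, 1}" for i
    by (auto simp: p_def coeff_position_poly)
  ultimately show ?thesis by (auto simp: height_one_def)
qed

lemma comp_word_replicate_nth:
  assumes "a $ 0 = 0"
  shows "comp_word (replicate j a) $ 0 = 0" "comp_word (replicate j a) $ 1 = (a $ 1) ^ j"
proof -
  show "comp_word (replicate j a) $ 0 = 0"
    by (rule comp_word_nth_0) (use assms in auto)
  have "comp_word (replicate j a) $ 1 = (a $ 1) ^ length (replicate j a)"
    by (rule comp_word_nth_1) (use assms in auto)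
  thus "comp_word (replicate j a) $ 1 = (a $ 1) ^ j"
    by (simp only: length_replicate)
qed

text \<open>
  If \<open>l\<close> is not a root of unity, the iterates of \<open>a\<close> and \<open>b\<close> still differ first at the index \<open>k + 1\<close> at which
  \<open>a\<close> and \<open>b\<close> do, since the difference gets multiplied by a geometric sum in \<open>l ^ k\<close>. Their coinciding
  words make every power of \<open>l ^ k\<close> a root of a polynomial of height one.
\<close>

theorem equal_multiplier_root_of_unity:
  assumes a: "a $ 0 = 0" "a $ 1 = l" and b: "b $ 0 = 0" "b $ 1 = l" and l: "l \<noteq> 0" and "a \<noteq> b"
    and col: "\<And>j. collide (comp_word (replicate j a)) (comp_word (replicate j b))"
  shows "\<exists>n>0. l ^ n = 1"
proof -
  define m where "m = (LEAST n. a $ n \<noteq> b $ n)"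
  have "\<exists>n. a $ n \<noteq> b $ n" using \<open>a \<noteq> b\<close> by (auto simp: fps_eq_iff)
  from LeastI_ex[OF this] have m: "a $ m \<noteq> b $ m" "\<And>n. n < m \<Longrightarrow> a $ n = b $ n"
    unfolding m_def by (auto dest: not_less_Least)
  have "m \<noteq> 0" "m \<noteq> 1" using m(1) a b by metis+
  then obtain k where k: "m = Suc k" "k \<ge> 1" by (metis One_nat_def Suc_leI gr0I not0_implies_Suc)
  show ?thesis
  proof (rule ccontr)
    assume not: "\<not> ?thesis"
    hence notk: "\<not> (\<exists>n>0. (l ^ k) ^ n = 1)"
      using k(2) by (metis nat_0_less_mult_iff power_mult zero_less_one less_le_trans)
    have "\<exists>n>0. (l ^ k) ^ n = 1"
    proof (rule root_of_unity_if_powers_height_one)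
      fix j :: nat assume j: "j \<ge> 1"
      define A B where "A = comp_word (replicate j a)" and "B = comp_word (replicate j b)"
      have jet: "\<forall>n\<le>k. B $ n = A $ n"
         "l * (B $ Suc k - A $ Suc k) = (b $ Suc k - a $ Suc k) * l ^ j *
            eval_int_poly (position_poly b (replicate j b)) (l ^ k)"
      proof -
        have "\<forall>n\<le>k. b $ n = a $ n" "set (replicate j b) \<subseteq> {a, b}" using m(2) k by auto
        from jet_comp_word[OF a b k(2) this]
        show "\<forall>n\<le>k. B $ n = A $ n"
         "l * (B $ Suc k - A $ Suc k) = (b $ Suc k - a $ Suc k) * l ^ j *
            eval_int_poly (position_poly b (replicate j b)) (l ^ k)"
          unfolding A_def B_def length_replicate by blast+
      qed
      have "((l ^ k) - 1) * eval_int_poly (position_poly b (replicate j b)) (l ^ k) = (l ^ k) ^ j - 1"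
        by (induction j) (simp_all add: eval_position_poly_Cons algebra_simps)
      moreover have "(l ^ k) ^ j \<noteq> 1" using notk j by (metis less_le_trans zero_less_one)
      ultimately have "eval_int_poly (position_poly b (replicate j b)) (l ^ k) \<noteq> 0" by auto
      hence ne: "B $ Suc k \<noteq> A $ Suc k" using jet(2) m(1) k(1) l by auto
      have "A $ 0 = 0" "A $ 1 = l ^ j" "B $ 0 = 0" "B $ 1 = l ^ j"
        unfolding A_def B_def comp_word_replicate_nth[OF a(1)] comp_word_replicate_nth[OF b(1)]
        by (simp_all only: a b)
      moreover have "collide A B" using col unfolding A_def B_def .
      ultimately have "\<exists>p. height_one p \<and> eval_int_poly p ((l ^ j) ^ k) = 0"
        using collide_imp_height_one[of A "l ^ j" B k] l k(2) jet(1) ne by auto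
      thus "\<exists>p. height_one p \<and> eval_int_poly p ((l ^ k) ^ j) = 0"
        by (metis power_mult mult.commute)
    qed (use l in simp)
    thus False using notk by blast
  qed
qed

section \<open>Homogeneous lifts of rational power series\<close>

text \<open>
  The homogenization of \<open>p\<close> in degree \<open>d\<close>.
\<close>

definition hom_eval :: "nat \<Rightarrow> complex poly \<Rightarrow> complex \<Rightarrow> complex \<Rightarrow> complex" where
  "hom_eval d p x y = (\<Sum>i\<le>d. coeff p i * x ^ i * y ^ (d - i))"

lemma poly_eq_sum_atMost:
  fixes p :: "complex poly"
  assumes "degree p \<le> d"
  shows "poly p x = (\<Sum>i\<le>d. coeff p i * x ^ i)"
  unfolding poly_altdef by (rule sum.mono_neutral_left) (use assms in \<open>auto simp: coeff_eq_0\<close>)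

lemma hom_eval_1: "degree p \<le> d \<Longrightarrow> hom_eval d p z 1 = poly p z"
  by (simp add: hom_eval_def poly_eq_sum_atMost)

lemma hom_eval_0: "hom_eval d p x 0 = coeff p d * x ^ d"
proof -
  have "hom_eval d p x 0 = (\<Sum>i\<le>d. if i = d then coeff p d * x ^ d else 0)"
    unfolding hom_eval_def by (intro sum.cong) (auto simp: power_0_left)
  thus ?thesis by simp
qed

lemma hom_eval_scale: "hom_eval d p (t * x) (t * y) = t ^ d * hom_eval d p x y"
proof -
  have "(t * x) ^ i * (t * y) ^ (d - i) = t ^ d * (x ^ i * y ^ (d - i))" if "i \<le> d" for i
  proof -
    have "t ^ d = t ^ i * t ^ (d - i)" using that by (simp flip: power_add)
    thus ?thesis by (simp add: power_mult_distrib)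
  qed
  thus ?thesis
    unfolding hom_eval_def sum_distrib_left by (intro sum.cong) (auto simp: mult_ac)
qed

lemma hom_eval_eq_poly:
  assumes "y \<noteq> 0" "degree p \<le> d"
  shows "hom_eval d p x y = y ^ d * poly p (x / y)"
  using hom_eval_scale[of d p y "x / y" 1] hom_eval_1[OF assms(2)] assms(1) by simp

lemma coeff_mult_degree_bounds:
  fixes p q :: "complex poly"
  assumes "degree p \<le> d" "degree q \<le> e"
  shows "coeff (p * q) (d + e) = coeff p d * coeff q e"
proof -
  have "coeff (p * q) (d + e) = (\<Sum>i\<le>d+e. if i = d then coeff p d * coeff q e else 0)"
    unfolding coeff_mult
  proof (intro sum.cong refl)
    fix i
    show "coeff p i * coeff q (d + e - i) = (if i = d then coeff p d * coeff q e else 0)"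
    proof (cases i d rule: linorder_cases)
      case less
      hence "degree q < d + e - i" using assms(2) by linarith
      thus ?thesis using less by (simp add: coeff_eq_0)
    next
      case greater
      hence "degree p < i" using assms(1) by linarith
      thus ?thesis using greater by (simp add: coeff_eq_0)
    qed simp
  qed
  thus ?thesis by simp
qed

lemma hom_eval_mult:
  assumes "degree p \<le> d" "degree q \<le> e"
  shows "hom_eval d p x y * hom_eval e q x y = hom_eval (d + e) (p * q) x y"
proof (cases "y = 0")
  case False
  have "degree (p * q) \<le> d + e" using degree_mult_le[of p q] assms by linarith
  thus ?thesis using False assms by (simp add: hom_eval_eq_poly power_add)
next
  case True
  thus ?thesis by (simp add: hom_eval_0 coeff_mult_degree_bounds assms power_add)
qed

lemma hom_eval_power:
  assumes "degree p \<le> d"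
  shows "hom_eval d p x y ^ n = hom_eval (d * n) (p ^ n) x y"
proof (induction n)
  case (Suc n)
  have "degree (p ^ n) \<le> d * n"
    using degree_power_le[of p n] mult_le_mono1[OF assms, of n] by (rule order_trans)
  thus ?case using hom_eval_mult[OF assms, of "p ^ n" "d * n" x y] Suc by simp
qed (simp add: hom_eval_def)

lemma hom_eval_sum: "hom_eval d (\<Sum>i\<in>I. P i) x y = (\<Sum>i\<in>I. hom_eval d (P i) x y)"
  unfolding hom_eval_def coeff_sum sum_distrib_right by (rule sum.swap)

lemma hom_eval_smult: "hom_eval d (smult c p) x y = c * hom_eval d p x y"
  unfolding hom_eval_def sum_distrib_left by (simp add: mult_ac)

text \<open>
  The numerator of \<open>p\<close> composed with the fraction \<open>r / s\<close>, over the denominator \<open>s ^ d\<close>.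
\<close>

definition hom_comp :: "nat \<Rightarrow> complex poly \<Rightarrow> complex poly \<Rightarrow> complex poly \<Rightarrow> complex poly" where
  "hom_comp d p r s = (\<Sum>i\<le>d. smult (coeff p i) (r ^ i * s ^ (d - i)))"

lemma degree_hom_comp_summand:
  assumes "degree r \<le> e" "degree s \<le> e" "i \<le> d"
  shows "degree (r ^ i * s ^ (d - i)) \<le> d * e"
proof -
  have "degree (r ^ i * s ^ (d - i)) \<le> degree r * i + degree s * (d - i)"
    using degree_mult_le[of "r ^ i" "s ^ (d - i)"] degree_power_le[of r i] degree_power_le[of s "d - i"]
    by linarith
  also have "\<dots> \<le> e * i + e * (d - i)"
    using assms by (intro add_mono mult_right_mono) auto
  also have "\<dots> = d * e" using assms(3) by (simp flip: distrib_left)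
  finally show ?thesis .
qed

lemma degree_hom_comp:
  assumes "degree r \<le> e" "degree s \<le> e"
  shows "degree (hom_comp d p r s) \<le> d * e"
  unfolding hom_comp_def
  by (intro degree_sum_le) (auto intro!: order_trans[OF degree_smult_le] degree_hom_comp_summand assms)

lemma hom_eval_hom_comp:
  assumes "degree r \<le> e" "degree s \<le> e"
  shows "hom_eval d p (hom_eval e r x y) (hom_eval e s x y) = hom_eval (d * e) (hom_comp d p r s) x y"
proof -
  have "hom_eval (d * e) (hom_comp d p r s) x y
     = (\<Sum>i\<le>d. coeff p i * hom_eval (d * e) (r ^ i * s ^ (d - i)) x y)"
    by (simp add: hom_comp_def hom_eval_sum hom_eval_smult)
  also have "\<dots> = (\<Sum>i\<le>d. coeff p i * (hom_eval e r x y ^ i * hom_eval e s x y ^ (d - i)))"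
  proof (intro sum.cong refl)
    fix i assume "i \<in> {..d}"
    hence i: "d * e = e * i + e * (d - i)" by (simp flip: distrib_left)
    have "degree (r ^ i) \<le> e * i" "degree (s ^ (d - i)) \<le> e * (d - i)"
      using degree_power_le[of r i] degree_power_le[of s "d - i"] assms
      by (meson mult_le_mono1 order_trans)+
    from hom_eval_mult[OF this, of x y]
    show "coeff p i * hom_eval (d * e) (r ^ i * s ^ (d - i)) x y
        = coeff p i * (hom_eval e r x y ^ i * hom_eval e s x y ^ (d - i))"
      unfolding i using assms by (simp add: hom_eval_power)
  qed
  finally show ?thesis by (simp add: hom_eval_def mult.assoc)
qed

lemma fps_of_poly_compose:
  assumes "degree p \<le> d" "(g :: complex fps) $ 0 = 0"
  shows "fps_of_poly p oo g = (\<Sum>i\<le>d. fps_const (coeff p i) * g ^ i)"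
proof -
  have "fps_of_poly p = (\<Sum>i\<le>d. fps_const (coeff p i) * fps_X ^ i)"
    using arg_cong[OF poly_as_sum_of_monoms'[OF assms(1)], of fps_of_poly]
    by (simp add: fps_of_poly_sum fps_of_poly_monom)
  hence "fps_of_poly p oo g = (\<Sum>i\<le>d. (fps_const (coeff p i) * fps_X ^ i) oo g)"
    by (simp add: fps_compose_sum_distrib)
  also have "\<dots> = (\<Sum>i\<le>d. fps_const (coeff p i) * g ^ i)"
    using assms(2) by (simp add: fps_compose_mult_distrib fps_compose_power[symmetric])
  finally show ?thesis .
qed

lemma fps_of_poly_hom_comp:
  assumes p: "degree p \<le> d" and g: "(g :: complex fps) $ 0 = 0"
    and "fps_of_poly r = g * fps_of_poly s"
  shows "fps_of_poly (hom_comp d p r s) = (fps_of_poly p oo g) * fps_of_poly s ^ d"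
proof -
  have "fps_of_poly (hom_comp d p r s)
      = (\<Sum>i\<le>d. fps_const (coeff p i) * (fps_of_poly r ^ i * fps_of_poly s ^ (d - i)))"
    by (simp add: hom_comp_def fps_of_poly_sum fps_of_poly_smult fps_of_poly_mult fps_of_poly_power)
  also have "\<dots> = (\<Sum>i\<le>d. fps_const (coeff p i) * g ^ i * fps_of_poly s ^ d)"
  proof (intro sum.cong refl)
    fix i assume "i \<in> {..d}"
    hence "fps_of_poly s ^ d = fps_of_poly s ^ i * fps_of_poly s ^ (d - i)"
      by (simp flip: power_add)
    thus "fps_const (coeff p i) * (fps_of_poly r ^ i * fps_of_poly s ^ (d - i))
        = fps_const (coeff p i) * g ^ i * fps_of_poly s ^ d"
      unfolding assms(3) by (simp add: power_mult_distrib mult_ac)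
  qed
  finally show ?thesis
    by (simp add: fps_of_poly_compose[OF p g] sum_distrib_right)
qed

definition lift_map :: "nat \<Rightarrow> complex poly \<Rightarrow> complex poly \<Rightarrow> complex \<times> complex \<Rightarrow> complex \<times> complex" where
  "lift_map d p q = (\<lambda>(x, y). (hom_eval d p x y, hom_eval d q x y))"

text \<open>
  The fraction \<open>p / q\<close> expands to \<open>f\<close> and is reduced, which is expressed by the lift to \<open>\<complex>\<^sup>2\<close> having no
  zero but the origin; then \<open>d\<close> is the degree of the rational function. The normalization
  \<open>poly q 0 = 1\<close> makes the lift unique and makes it fix the point \<open>(0, 1)\<close> over \<open>0\<close>, and it is
  preserved by composition.
\<close>

definition is_lift :: "nat \<Rightarrow> complex poly \<Rightarrow> complex poly \<Rightarrow> complex fps \<Rightarrow> bool" where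
  "is_lift d p q f \<longleftrightarrow> degree p \<le> d \<and> degree q \<le> d \<and> poly p 0 = 0 \<and> poly q 0 = 1 \<and>
     (\<forall>X. X \<noteq> 0 \<longrightarrow> lift_map d p q X \<noteq> 0) \<and> f * fps_of_poly q = fps_of_poly p"

lemma lift_map_scale: "lift_map d p q (t * x, t * y) =
    (t ^ d * fst (lift_map d p q (x, y)), t ^ d * snd (lift_map d p q (x, y)))"
  by (simp add: lift_map_def hom_eval_scale)

lemma is_lift_id: "is_lift 1 [:0, 1:] 1 fps_X" "lift_map 1 [:0, 1:] 1 = id"
proof -
  show "lift_map 1 [:0, 1:] 1 = id"
    by (auto simp: lift_map_def hom_eval_def fun_eq_iff)
  thus "is_lift 1 [:0, 1:] 1 fps_X"
    by (simp add: is_lift_def)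
qed

lemma is_lift_nth_0: "is_lift d p q f \<Longrightarrow> f $ 0 = 0"
proof -
  assume "is_lift d p q f"
  hence "(f * fps_of_poly q) $ 0 = fps_of_poly p $ 0" "poly p 0 = 0" "poly q 0 = 1"
    by (auto simp: is_lift_def)
  thus "f $ 0 = 0" by (simp add: poly_0_coeff_0)
qed

lemma lift_map_hom_comp:
  assumes "degree r \<le> e" "degree s \<le> e"
  shows "lift_map (d * e) (hom_comp d p r s) (hom_comp d q r s) = lift_map d p q \<circ> lift_map e r s"
  by (auto simp: lift_map_def hom_eval_hom_comp[OF assms] fun_eq_iff)

lemma is_lift_compose:
  assumes f: "is_lift d p q f" and g: "is_lift e r s g"
  shows "is_lift (d * e) (hom_comp d p r s) (hom_comp d q r s) (f oo g)"
proof -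
  have rs: "degree r \<le> e" "degree s \<le> e" using g by (auto simp: is_lift_def)
  note L = lift_map_hom_comp[OF rs, of d p q]
  have 01: "lift_map d p q (0, 1) = (0, 1)" "lift_map e r s (0, 1) = (0, 1)"
    using f g by (auto simp: is_lift_def lift_map_def hom_eval_1)
  have dg: "degree (hom_comp d p r s) \<le> d * e" "degree (hom_comp d q r s) \<le> d * e"
    using degree_hom_comp[OF rs] by auto
  have "lift_map (d * e) (hom_comp d p r s) (hom_comp d q r s) (0, 1) = (0, 1)"
    unfolding L using 01 by simp
  hence "poly (hom_comp d p r s) 0 = 0" "poly (hom_comp d q r s) 0 = 1"
    using dg by (auto simp: lift_map_def hom_eval_1)
  moreover have "lift_map (d * e) (hom_comp d p r s) (hom_comp d q r s) X \<noteq> 0" if "X \<noteq> 0" for X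
    unfolding L o_apply using f g that unfolding is_lift_def by blast
  moreover have "(f oo g) * fps_of_poly (hom_comp d q r s) = fps_of_poly (hom_comp d p r s)"
  proof -
    have g0: "g $ 0 = 0" using is_lift_nth_0[OF g] .
    have rs': "fps_of_poly r = g * fps_of_poly s" using g by (simp add: is_lift_def)
    have "(f oo g) * (fps_of_poly q oo g) = fps_of_poly p oo g"
      using f g0 by (simp add: is_lift_def flip: fps_compose_mult_distrib)
    thus ?thesis
      using f by (simp add: fps_of_poly_hom_comp[OF _ g0 rs'] is_lift_def flip: mult.assoc)
  qed
  ultimately show ?thesis using dg unfolding is_lift_def by blast
qed

lemma coprime_of_no_common_root:
  fixes p q :: "complex poly"
  assumes "\<And>z. poly p z = 0 \<Longrightarrow> poly q z \<noteq> 0" "q \<noteq> 0"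
  shows "coprime p q"
proof (rule coprimeI)
  fix c assume c: "c dvd p" "c dvd q"
  show "is_unit c"
  proof (cases "degree c = 0")
    case True
    moreover have "c \<noteq> 0" using c(2) assms(2) by auto
    ultimately show ?thesis by (simp add: is_unit_iff_degree)
  next
    case False
    then obtain z where "poly c z = 0" using alg_closed_imp_poly_has_root[of c] by auto
    thus ?thesis using c assms(1)[of z] by (auto simp: dvd_def)
  qed
qed

lemma is_lift_coprime:
  assumes "is_lift d p q f"
  shows "coprime p q"
proof (rule coprime_of_no_common_root)
  fix z assume "poly p z = 0"
  moreover have "lift_map d p q (z, 1) \<noteq> 0" using assms by (auto simp: is_lift_def zero_prod_def)
  ultimately show "poly q z \<noteq> 0"
    using assms by (auto simp: lift_map_def is_lift_def hom_eval_1 zero_prod_def)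
qed (use assms in \<open>auto simp: is_lift_def\<close>)

text \<open>
  Two reduced fractions with the same value have proportional denominators, and the
  normalization at \<open>0\<close> fixes the factor.
\<close>

lemma is_lift_unique:
  assumes 1: "is_lift d p q f" and 2: "is_lift e r s f"
  shows "p = r" "q = s"
proof -
  have "fps_of_poly (p * s) = fps_of_poly (r * q)"
    using 1 2 unfolding is_lift_def fps_of_poly_mult by (metis mult.assoc mult.commute)
  hence eq: "p * s = r * q" by (simp add: fps_of_poly_eq_iff)
  have q0: "poly q 0 = 1" "poly s 0 = 1" using 1 2 by (auto simp: is_lift_def)
  have "q dvd p * s" "s dvd r * q" using eq by (metis dvd_triv_right)+
  hence qs: "q dvd s" "s dvd q"
    using is_lift_coprime[OF 1] is_lift_coprime[OF 2]
      coprime_dvd_mult_right_iff[of q p s] coprime_dvd_mult_right_iff[of s r q]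
    by (auto simp: coprime_commute)
  from qs(1) obtain c where c1: "s = q * c" by (rule dvdE)
  from qs(2) obtain e where c2: "q = s * e" by (rule dvdE)
  note c = c1 c2
  have "q \<noteq> 0" using q0 by auto
  moreover have "q * (c * e) = q * 1" using c by (metis mult.assoc mult.right_neutral)
  ultimately have "c * e = 1" by (metis mult_cancel_left)
  hence "is_unit c" by (metis dvd_triv_left)
  then obtain k where "c = [:k:]" by (metis is_unit_poly_iff)
  hence "c = 1" using q0 c1 by simp
  thus "q = s" using c1 by simp
  hence "p * q = r * q" using eq by simp
  thus "p = r" using q0 by auto
qed

lemma has_fps_expansion_poly: "poly p has_fps_expansion fps_of_poly (p :: complex poly)"
proof (induction p)
  case (pCons a p)
  have "(\<lambda>z. a + z * poly p z) has_fps_expansion (fps_const a + fps_X * fps_of_poly p)"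
    by (intro fps_expansion_intros pCons)
  thus ?case by (simp add: fps_of_poly_pCons mult.commute)
qed (use has_fps_expansion_0 in simp)

lemma is_lift_imp_rational:
  assumes "is_lift d p q f"
  shows "(\<lambda>z. poly p z / poly q z) has_fps_expansion f" "f \<in> rational_elements"
proof -
  have q0: "poly q 0 \<noteq> 0" using assms by (simp add: is_lift_def)
  hence "fps_of_poly q $ 0 \<noteq> 0" by (simp add: poly_0_coeff_0)
  hence "fps_of_poly q \<noteq> 0" by (metis fps_zero_nth)
  note div = nonzero_mult_div_cancel_right[OF this, of f]
  have eq: "f * fps_of_poly q = fps_of_poly p" using assms unfolding is_lift_def by blast
  have "f = fps_of_poly p / fps_of_poly q" using div unfolding eq by (rule sym)
  note f_eq = this
  have *: "(\<lambda>z. poly p z / poly q z) has_fps_expansion f"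
    using has_fps_expansion_divide'[OF has_fps_expansion_poly has_fps_expansion_poly \<open>fps_of_poly q $ 0 \<noteq> 0\<close>]
    f_eq by simp
  thus "(\<lambda>z. poly p z / poly q z) has_fps_expansion f" .
  show "f \<in> rational_elements"
    using q0 * is_lift_nth_0[OF assms] by (auto simp: rational_elements_def fps_sgrp_def)
qed

lemma rational_imp_is_lift:
  assumes "f \<in> rational_elements"
  shows "\<exists>d p q. is_lift d p q f"
proof -
  obtain P Q where PQ: "poly Q 0 \<noteq> 0" "(\<lambda>z. poly P z / poly Q z) has_fps_expansion f"
    and f0: "f $ 0 = 0"
    using assms by (auto simp: rational_elements_def fps_sgrp_def)
  have Qn: "fps_of_poly Q $ 0 \<noteq> 0" using PQ(1) by (simp add: poly_0_coeff_0)
  have "(\<lambda>z. poly P z / poly Q z) has_fps_expansion fps_of_poly P / fps_of_poly Q"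
    using has_fps_expansion_divide'[OF has_fps_expansion_poly has_fps_expansion_poly Qn] .
  hence "f = fps_of_poly P / fps_of_poly Q" using PQ(2) fps_expansion_unique_complex by blast
  hence fPQ: "f * fps_of_poly Q = fps_of_poly P" using Qn by (simp add: fps_divide_unit inverse_mult_eq_1 mult.assoc)
  define g where "g = gcd P Q"
  have Q0: "Q \<noteq> 0" using PQ by auto
  hence g0: "g \<noteq> 0" by (simp add: g_def)
  obtain P' Q' where P': "P = g * P'" and Q': "Q = g * Q'" by (metis g_def dvd_def gcd_dvd1 gcd_dvd2)
  have cop: "coprime P' Q'"
    using Q0 gcd_coprime[of P Q P' Q'] P' Q' g_def by (metis gcd_eq_0_iff mult.commute)
  define c where "c = poly Q' 0"
  have c: "c \<noteq> 0" using PQ(1) Q' by (auto simp: c_def)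
  define p q where "p = smult (1 / c) P'" and "q = smult (1 / c) Q'"
  define d where "d = max (degree p) (degree q)"
  have "fps_of_poly g * (f * fps_of_poly Q') = fps_of_poly g * fps_of_poly P'"
    using fPQ unfolding P' Q' fps_of_poly_mult by (simp add: mult_ac)
  hence "f * fps_of_poly Q' = fps_of_poly P'" using g0 fps_of_poly_eq_iff[of g 0] by simp
  hence fpq: "f * fps_of_poly q = fps_of_poly p"
    unfolding p_def q_def fps_of_poly_smult by (simp add: mult_ac)
  have q0: "poly q 0 = 1" using c by (simp add: q_def c_def)
  have "(f * fps_of_poly q) $ 0 = fps_of_poly p $ 0" using fpq by simp
  hence p0: "poly p 0 = 0" using f0 by (simp add: poly_0_coeff_0)
  have nz: "lift_map d p q X \<noteq> 0" if "X \<noteq> 0" for X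
  proof -
    obtain x y where X: "X = (x, y)" by force
    show ?thesis
    proof (cases "y = 0")
      case False
      have "poly P' (x / y) \<noteq> 0 \<or> poly Q' (x / y) \<noteq> 0" using coprime_poly_0[OF cop] .
      hence "poly p (x / y) \<noteq> 0 \<or> poly q (x / y) \<noteq> 0" using c by (auto simp: p_def q_def)
      thus ?thesis using False by (auto simp: X lift_map_def hom_eval_eq_poly d_def zero_prod_def)
    next
      case True
      hence x: "x \<noteq> 0" using that X by (auto simp: zero_prod_def)
      have "coeff p d \<noteq> 0 \<or> coeff q d \<noteq> 0"
      proof (cases "degree p \<le> degree q")
        case True
        moreover have "q \<noteq> 0" using q0 by auto
        ultimately show ?thesis by (simp add: d_def max_def)
      next
        case False
        hence "p \<noteq> 0" by auto
        thus ?thesis using False by (simp add: d_def max_def)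
      qed
      thus ?thesis using True x by (auto simp: X lift_map_def hom_eval_0 zero_prod_def)
    qed
  qed
  have "is_lift d p q f" unfolding is_lift_def using p0 q0 nz fpq by (auto simp: d_def)
  thus ?thesis by blast
qed

lemma rational_elements_compose:
  assumes "f \<in> rational_elements" "g \<in> rational_elements"
  shows "f oo g \<in> rational_elements"
proof -
  obtain d p q where f: "is_lift d p q f" using rational_imp_is_lift[OF assms(1)] by blast
  obtain e r s where g: "is_lift e r s g" using rational_imp_is_lift[OF assms(2)] by blast
  show ?thesis using is_lift_imp_rational(2)[OF is_lift_compose[OF f g]] .
qed

lemma is_lift_degree_pos:
  assumes "is_lift d p q f" "f $ 1 \<noteq> 0"
  shows "d \<ge> 1"
proof (rule ccontr)
  assume "\<not> d \<ge> 1"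
  hence "degree p = 0" using assms(1) by (simp add: is_lift_def)
  then obtain c where "p = [:c:]" by (metis degree_eq_zeroE)
  hence "p = 0" using assms(1) by (simp add: is_lift_def)
  hence "f * fps_of_poly q = 0" using assms(1) by (simp add: is_lift_def)
  moreover have "fps_of_poly q \<noteq> 0"
    using assms(1) fps_of_poly_eq_iff[of q 0] by (auto simp: is_lift_def)
  ultimately show False using assms(2) by simp
qed

lemma degree_le_1_form:
  fixes p :: "complex poly"
  assumes "degree p \<le> 1"
  shows "p = [:coeff p 0, coeff p 1:]"
proof (rule poly_eqI)
  fix n
  show "coeff p n = coeff [:coeff p 0, coeff p 1:] n"
    using assms by (cases "n \<le> 1") (auto simp: coeff_pCons coeff_eq_0 le_Suc_eq split: nat.split)
qed

text \<open>
  Such a germ is \<open>z / (1 + c z)\<close>, and composing two of them adds the parameters \<open>c\<close>.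
\<close>

lemma degree_1_lifts_commute:
  assumes f: "is_lift 1 p q f" "f $ 1 = 1" and g: "is_lift 1 r s g" "g $ 1 = 1"
  shows "f oo g = g oo f"
proof -
  have form: "\<exists>c. fps_of_poly p = fps_X \<and> fps_of_poly q = 1 + fps_const c * fps_X"
    if "is_lift 1 p q f" "f $ 1 = 1" for p q f
  proof -
    have deg: "degree p \<le> 1" "degree q \<le> 1" using that(1) unfolding is_lift_def by auto
    obtain a b where p: "p = [:a, b:]"
      using degree_le_1_form[OF deg(1)] by blast
    obtain c e where q: "q = [:c, e:]"
      using degree_le_1_form[OF deg(2)] by blast
    have a: "a = 0" "c = 1" using that(1) by (auto simp: is_lift_def p q)
    have "(f * fps_of_poly q) $ 1 = fps_of_poly p $ 1" using that(1) by (simp add: is_lift_def)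
    hence "b = 1" using that is_lift_nth_0[OF that(1)] by (simp add: fps_mult_nth p q a)
    thus ?thesis using a by (intro exI[of _ e]) (simp add: p q fps_of_poly_pCons mult.commute)
  qed
  obtain c where c: "fps_of_poly p = fps_X" "fps_of_poly q = 1 + fps_const c * fps_X"
    using form[OF f] by blast
  obtain e where e: "fps_of_poly r = fps_X" "fps_of_poly s = 1 + fps_const e * fps_X"
    using form[OF g] by blast
  have rel: "(f oo g) * (1 + fps_const (c + e) * fps_X) = fps_X"
    if f: "f * (1 + fps_const c * fps_X) = fps_X" and g: "g * (1 + fps_const e * fps_X) = fps_X" "g $ 0 = 0"
    for f g :: "complex fps" and c e
  proof -
    have "(f oo g) * (1 + fps_const c * g) = g"
      using arg_cong[OF f, of "\<lambda>h. h oo g"] g(2)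
      by (simp add: fps_compose_mult_distrib fps_compose_add_distrib)
    hence "(f oo g) * ((1 + fps_const c * g) * (1 + fps_const e * fps_X)) = fps_X"
      using g(1) by (simp flip: mult.assoc)
    moreover have "(1 + fps_const c * g) * (1 + fps_const e * fps_X)
        = 1 + fps_const e * fps_X + fps_const c * (g * (1 + fps_const e * fps_X))"
      by (simp add: algebra_simps)
    moreover have "\<dots> = 1 + fps_const (c + e) * fps_X"
      unfolding g(1) by (simp add: algebra_simps flip: fps_const_add)
    ultimately show ?thesis by simp
  qed
  have 1: "f * (1 + fps_const c * fps_X) = fps_X" "g * (1 + fps_const e * fps_X) = fps_X"
    using f g c e by (simp_all add: is_lift_def)
  have "(f oo g) * (1 + fps_const (c + e) * fps_X) = (g oo f) * (1 + fps_const (c + e) * fps_X)"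
    using rel[OF 1 is_lift_nth_0[OF g(1)]] rel[OF 1(2,1) is_lift_nth_0[OF f(1)]]
    by (simp add: add.commute)
  moreover have "(1 + fps_const (c + e) * fps_X :: complex fps) \<noteq> 0"
  proof
    assume "(1 + fps_const (c + e) * fps_X :: complex fps) = 0"
    hence "(1 + fps_const (c + e) * fps_X :: complex fps) $ 0 = 0" by simp
    thus False by simp
  qed
  ultimately show ?thesis by simp
qed

section \<open>Growth of lifts and Green functions\<close>

text \<open>
  The factor \<open>d - 1\<close> in the error makes the class of maps with a given \<open>m\<close> closed under composition, so
  that words of any length in such maps satisfy the bound with the same \<open>m\<close>.
\<close>

definition growth_bound :: "real \<Rightarrow> nat \<Rightarrow> ('a::real_normed_vector \<Rightarrow> 'a) \<Rightarrow> bool" where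
  "growth_bound m d F \<longleftrightarrow> (\<forall>X. X \<noteq> 0 \<longrightarrow> F X \<noteq> 0) \<and>
     (\<forall>X. X \<noteq> 0 \<longrightarrow> \<bar>ln (norm (F X)) - d * ln (norm X)\<bar> \<le> m * (real d - 1))"

lemma growth_bound_nonzero: "growth_bound m d F \<Longrightarrow> X \<noteq> 0 \<Longrightarrow> F X \<noteq> 0"
  by (simp add: growth_bound_def)

lemma growth_boundD:
  "growth_bound m d F \<Longrightarrow> X \<noteq> 0 \<Longrightarrow> \<bar>ln (norm (F X)) - d * ln (norm X)\<bar> \<le> m * (real d - 1)"
  by (simp add: growth_bound_def)

lemma growth_bound_id: "growth_bound m 1 id"
  by (simp add: growth_bound_def)

lemma growth_bound_mono:
  assumes "growth_bound m d F" "m \<le> m'" "d \<ge> 1"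
  shows "growth_bound m' d F"
proof -
  have "m * (real d - 1) \<le> m' * (real d - 1)"
    using assms(2,3) by (intro mult_right_mono) auto
  thus ?thesis using assms(1) unfolding growth_bound_def by fastforce
qed

lemma growth_bound_compose:
  assumes F: "growth_bound m d F" and H: "growth_bound m e H"
  shows "growth_bound m (d * e) (F \<circ> H)"
  unfolding growth_bound_def
proof (intro conjI allI impI)
  fix X :: 'a assume X: "X \<noteq> 0"
  have H0: "H X \<noteq> 0" using growth_bound_nonzero[OF H X] .
  thus "(F \<circ> H) X \<noteq> 0" using growth_bound_nonzero[OF F] by simp
  have "\<bar>real d * ln (norm (H X)) - real d * (e * ln (norm X))\<bar>
          = real d * \<bar>ln (norm (H X)) - e * ln (norm X)\<bar>"
    by (simp add: abs_mult flip: right_diff_distrib)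
  also have "\<dots> \<le> real d * (m * (real e - 1))"
    by (intro mult_left_mono growth_boundD[OF H X]) simp
  finally have "\<bar>ln (norm (F (H X))) - real d * (e * ln (norm X))\<bar>
      \<le> m * (real d - 1) + real d * (m * (real e - 1))"
    using growth_boundD[OF F H0] by linarith
  thus "\<bar>ln (norm ((F \<circ> H) X)) - real (d * e) * ln (norm X)\<bar> \<le> m * (real (d * e) - 1)"
    by (simp add: algebra_simps)
qed

lemma growth_bound_funpow: "growth_bound m d F \<Longrightarrow> growth_bound m (d ^ n) (F ^^ n)"
  by (induction n) (auto simp: growth_bound_id[unfolded One_nat_def] intro: growth_bound_compose)

lemma continuous_on_hom_eval [continuous_intros]:
  "continuous_on S f \<Longrightarrow> continuous_on S g \<Longrightarrow> continuous_on S (\<lambda>x. hom_eval d p (f x) (g x))"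
  unfolding hom_eval_def by (intro continuous_intros)

lemma continuous_on_lift_map: "continuous_on S (lift_map d p q)"
  unfolding lift_map_def case_prod_unfold by (intro continuous_intros)

lemma norm_scale_pair: "norm (t * x, t * y) = norm t * norm (x :: complex, y :: complex)"
  by (simp add: norm_Pair norm_mult power_mult_distrib real_sqrt_mult flip: distrib_left)

lemma norm_lift_map_scale:
  "norm (lift_map d p q (t * x, t * y)) = norm t ^ d * norm (lift_map d p q (x, y))"
  by (simp add: lift_map_scale norm_scale_pair norm_power)

text \<open>
  By homogeneity the error is determined by its values on the unit sphere, where it is bounded by compactness.
\<close>

lemma is_lift_growth_bound:
  assumes L: "is_lift d p q f" and d: "d \<ge> 2"
  shows "\<exists>m\<ge>0. growth_bound m d (lift_map d p q)"
proof -
  define F where "F = lift_map d p q"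
  have nz: "F X \<noteq> 0" if "X \<noteq> 0" for X using L that unfolding F_def is_lift_def by blast
  have nzS: "norm (F X) \<noteq> 0" if "X \<in> sphere 0 1" for X
  proof -
    have "X \<noteq> 0"
    proof
      assume "X = 0"
      with that show False by simp
    qed
    thus ?thesis using nz by simp
  qed
  have "compact ((\<lambda>X. ln (norm (F X))) ` sphere 0 1)"
    by (intro compact_continuous_image continuous_on_ln continuous_on_norm compact_sphere ballI)
       (simp_all only: F_def continuous_on_lift_map nzS[unfolded F_def] not_False_eq_True)
  then obtain B where B': "\<forall>y\<in>(\<lambda>X. ln (norm (F X))) ` sphere 0 1. norm y \<le> B"
    using compact_imp_bounded bounded_iff by blast
  have B: "\<bar>ln (norm (F X))\<bar> \<le> B" if "norm X = 1" for X
  proof -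
    have "X \<in> sphere 0 1" using that by simp
    thus ?thesis using B' by force
  qed
  have B0: "B \<ge> 0" using B[of "(1, 0)"] by (simp add: norm_Pair)
  have "\<bar>ln (norm (F X)) - d * ln (norm X)\<bar> \<le> B" if X: "X \<noteq> 0" for X
  proof -
    obtain x y where xy: "X = (x, y)" by force
    define t where "t = complex_of_real (norm X)"
    have t: "t \<noteq> 0" "norm t = norm X" using X by (auto simp: t_def)
    define Y where "Y = (x / t, y / t)"
    have "norm t * norm Y = norm X"
      unfolding Y_def norm_scale_pair[symmetric] using t by (simp add: xy)
    hence nY: "norm Y = 1" using t X by auto
    have "norm (F X) = norm t ^ d * norm (F Y)"
      unfolding F_def Y_def norm_lift_map_scale[symmetric] using t by (simp add: xy)
    moreover have "norm (F Y) > 0" using nzS[of Y] nY by simp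
    ultimately have "ln (norm (F X)) = d * ln (norm X) + ln (norm (F Y))"
      using t X by (simp add: ln_mult ln_realpow)
    thus ?thesis using B[OF nY] by simp
  qed
  moreover have "B \<le> B * (real d - 1)" using B0 d by (simp add: mult_le_cancel_left1)
  ultimately have "growth_bound B d F" unfolding growth_bound_def using nz order_trans by blast
  thus ?thesis using B0 unfolding F_def by blast
qed

lemma is_lift_word:
  assumes "\<And>x. x \<in> set w \<Longrightarrow> \<exists>p q. is_lift d p q x \<and> growth_bound m d (lift_map d p q)"
  shows "\<exists>p q. is_lift (d ^ length w) p q (comp_word w) \<and>
               growth_bound m (d ^ length w) (lift_map (d ^ length w) p q)"
  using assms
proof (induction w)
  case Nil
  show ?case
    by (rule exI[of _ "[:0,1:]"], rule exI[of _ "1 :: complex poly"])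
       (use is_lift_id growth_bound_id in \<open>simp add: id_def\<close>)
next
  case (Cons x w)
  obtain p q where x: "is_lift d p q x" "growth_bound m d (lift_map d p q)"
    using Cons.prems[of x] by auto
  obtain r s where w: "is_lift (d ^ length w) r s (comp_word w)"
      "growth_bound m (d ^ length w) (lift_map (d ^ length w) r s)"
    using Cons by auto
  have "degree r \<le> d ^ length w" "degree s \<le> d ^ length w" using w(1) unfolding is_lift_def by auto
  note L = lift_map_hom_comp[OF this, of d p q]
  show ?case
    using is_lift_compose[OF x(1) w(1)] growth_bound_compose[OF x(2) w(2)]
    unfolding L[symmetric] by auto
qed

lemma is_lift_iterate:
  assumes "is_lift d p q f"
  shows "\<exists>P Q. is_lift (d ^ n) P Q (comp_word (replicate n f)) \<and>
               lift_map (d ^ n) P Q = lift_map d p q ^^ n"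
proof (induction n)
  case 0
  show ?case
    by (rule exI[of _ "[:0,1:]"], rule exI[of _ "1 :: complex poly"]) (use is_lift_id in simp)
next
  case (Suc n)
  then obtain P Q where PQ: "is_lift (d ^ n) P Q (comp_word (replicate n f))"
      "lift_map (d ^ n) P Q = lift_map d p q ^^ n" by blast
  have "degree P \<le> d ^ n" "degree Q \<le> d ^ n" using PQ(1) unfolding is_lift_def by auto
  note L = lift_map_hom_comp[OF this, of d p q]
  show ?case
    by (rule exI[of _ "hom_comp d p P Q"], rule exI[of _ "hom_comp d q P Q"])
       (use is_lift_compose[OF assms PQ(1)] L PQ(2) in auto)
qed

text \<open>
  Coinciding words \<open>u a = v b\<close> have equal lifts. Up to a bounded error, the lifts of \<open>u\<close> and \<open>v\<close> multiply
  \<open>ln \<bar>X\<bar>\<close> by the same large number, so the norms of the points they are applied to have a bounded quotient. The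
  bound depends only on \<open>m\<close>, which is common to all iterates of \<open>a\<close> and \<open>b\<close>.
\<close>

lemma collide_norm_bound:
  assumes a: "is_lift e p q a" "growth_bound m e (lift_map e p q)"
    and b: "is_lift e r s b" "growth_bound m e (lift_map e r s)"
    and m: "m \<ge> 0" and e: "e \<ge> 1" and "collide a b" and X: "X \<noteq> 0"
  shows "\<bar>ln (norm (lift_map e p q X)) - ln (norm (lift_map e r s X))\<bar> \<le> 2 * m"
proof -
  obtain u v where uv: "set u \<subseteq> {a, b}" "set v \<subseteq> {a, b}" "length u = length v"
     "comp_word (u @ [a]) = comp_word (v @ [b])"
    using \<open>collide a b\<close> unfolding collide_def by blast
  have z: "x $ 0 = 0" if "x \<in> {a, b}" for x
    using that is_lift_nth_0[OF a(1)] is_lift_nth_0[OF b(1)] by auto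
  have letters: "\<exists>p q. is_lift e p q x \<and> growth_bound m e (lift_map e p q)" if "x \<in> {a, b}" for x
    using that a b by blast
  define D where "D = e ^ length u"
  have D: "D \<ge> 1" using e by (simp add: D_def)
  obtain U1 U2 where U: "is_lift D U1 U2 (comp_word u)" "growth_bound m D (lift_map D U1 U2)"
    using is_lift_word[of u e m] letters uv(1) unfolding D_def by blast
  obtain V1 V2 where V: "is_lift D V1 V2 (comp_word v)" "growth_bound m D (lift_map D V1 V2)"
    using is_lift_word[of v e m] letters uv(2) unfolding D_def uv(3) by blast
  have "comp_word (u @ [a]) = comp_word u oo comp_word [a]"
    "comp_word (v @ [b]) = comp_word v oo comp_word [b]"
    by (rule comp_word_append; use uv z in auto)+
  hence eq: "comp_word u oo a = comp_word v oo b" using uv(4) by simp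
  have lift_ua: "is_lift (D * e) (hom_comp D U1 p q) (hom_comp D U2 p q) (comp_word u oo a)"
    by (rule is_lift_compose[OF U(1) a(1)])
  have lift_vb: "is_lift (D * e) (hom_comp D V1 r s) (hom_comp D V2 r s) (comp_word u oo a)"
    unfolding eq by (rule is_lift_compose[OF V(1) b(1)])
  have "hom_comp D U1 p q = hom_comp D V1 r s" "hom_comp D U2 p q = hom_comp D V2 r s"
    by (rule is_lift_unique[OF lift_ua lift_vb])+
  hence "lift_map D U1 U2 \<circ> lift_map e p q = lift_map D V1 V2 \<circ> lift_map e r s"
    using lift_map_hom_comp[of p e q D U1 U2] lift_map_hom_comp[of r e s D V1 V2] a(1) b(1)
    unfolding is_lift_def by metis
  hence E: "lift_map D U1 U2 (lift_map e p q X) = lift_map D V1 V2 (lift_map e r s X)"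
    by (metis o_apply)
  define \<alpha> \<beta> where "\<alpha> = ln (norm (lift_map e p q X))" and "\<beta> = ln (norm (lift_map e r s X))"
  have "\<bar>ln (norm (lift_map D U1 U2 (lift_map e p q X))) - D * \<alpha>\<bar> \<le> m * (real D - 1)"
    unfolding \<alpha>_def by (intro growth_boundD[OF U(2)] growth_bound_nonzero[OF a(2) X])
  moreover have "\<bar>ln (norm (lift_map D U1 U2 (lift_map e p q X))) - D * \<beta>\<bar> \<le> m * (real D - 1)"
    unfolding \<beta>_def E by (intro growth_boundD[OF V(2)] growth_bound_nonzero[OF b(2) X])
  ultimately have "\<bar>D * \<alpha> - D * \<beta>\<bar> \<le> 2 * (m * (real D - 1))" by linarith
  also have "\<dots> \<le> D * (2 * m)" using m by (simp add: algebra_simps)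
  finally have "D * \<bar>\<alpha> - \<beta>\<bar> \<le> D * (2 * m)"
    by (simp add: abs_mult flip: right_diff_distrib)
  thus ?thesis using D unfolding \<alpha>_def \<beta>_def by (simp add: mult_le_cancel_left)
qed

text \<open>
  The Green function, or escape rate, of a homogeneous map of degree \<open>d\<close>.
\<close>

definition green :: "nat \<Rightarrow> ('a::real_normed_vector \<Rightarrow> 'a) \<Rightarrow> 'a \<Rightarrow> real" where
  "green d F X = lim (\<lambda>n. ln (norm ((F ^^ n) X)) / d ^ n)"

lemma bound_over_power_tendsto_0:
  assumes "d \<ge> (2::nat)"
  shows "(\<lambda>n. c / real d ^ n) \<longlonglongrightarrow> 0"
proof -
  have "(\<lambda>n. c * (1 / real d) ^ n) \<longlonglongrightarrow> c * 0"
    using assms by (intro tendsto_mult tendsto_const LIMSEQ_realpow_zero) auto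
  thus ?thesis by (simp add: power_divide)
qed

lemma green_approx:
  assumes F: "growth_bound m d F" and m: "m \<ge> 0" and d: "d \<ge> 2" and X: "X \<noteq> 0"
  shows "(\<lambda>n. ln (norm ((F ^^ n) X)) / d ^ n) \<longlonglongrightarrow> green d F X"
    and "\<bar>green d F X - ln (norm ((F ^^ n) X)) / d ^ n\<bar> \<le> m / d ^ n"
proof -
  define g where "g = (\<lambda>n. ln (norm ((F ^^ n) X)) / real d ^ n)"
  have d0: "real d ^ n > 0" for n using d by simp
  have step: "\<bar>g (n + k) - g n\<bar> \<le> m / real d ^ n" for n k
  proof -
    have "\<bar>ln (norm ((F ^^ k) ((F ^^ n) X))) - real (d ^ k) * ln (norm ((F ^^ n) X))\<bar>
            \<le> m * (real (d ^ k) - 1)"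
      using growth_boundD[OF growth_bound_funpow[OF F, of k]
              growth_bound_nonzero[OF growth_bound_funpow[OF F, of n] X]] .
    also have "\<dots> \<le> m * real d ^ k" using m by (simp add: mult_left_mono)
    finally have *: "\<bar>ln (norm ((F ^^ (n + k)) X)) - real d ^ k * ln (norm ((F ^^ n) X))\<bar>
            \<le> m * real d ^ k"
      by (simp add: funpow_add add.commute[of n k])
    have "g (n + k) - g n =
        (ln (norm ((F ^^ (n + k)) X)) - real d ^ k * ln (norm ((F ^^ n) X))) / real d ^ (n + k)"
      using d0 by (simp add: g_def diff_divide_distrib power_add)
    hence "\<bar>g (n + k) - g n\<bar> \<le> m * real d ^ k / real d ^ (n + k)"
      using * d0[of "n + k"] by (simp only: abs_divide abs_of_pos divide_right_mono less_imp_le)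
    also have "\<dots> = m / real d ^ n" using d0 by (simp add: power_add)
    finally show ?thesis .
  qed
  have "Cauchy g"
  proof (rule CauchyI')
    fix e :: real assume "0 < e"
    then obtain M where M: "m / real d ^ M < e"
      using order_tendstoD(2)[OF bound_over_power_tendsto_0[OF d, of m]]
      by (metis eventually_sequentially order_refl)
    have "dist (g n) (g n') < e" if "n \<ge> M" "n' > n" for n n'
    proof -
      have "dist (g n) (g n') = \<bar>g (n + (n' - n)) - g n\<bar>" using that by (simp add: dist_real_def)
      also have "\<dots> \<le> m / real d ^ n" by (rule step)
      also have "\<dots> \<le> m / real d ^ M"
        using m d that by (intro divide_left_mono power_increasing mult_pos_pos) auto
      finally show ?thesis using M by simp
    qed
    thus "\<exists>M. \<forall>n\<ge>M. \<forall>n'>n. dist (g n) (g n') < e" by blast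
  qed
  hence lim: "g \<longlonglongrightarrow> green d F X"
    unfolding green_def g_def Cauchy_convergent_iff by (simp add: convergent_LIMSEQ_iff)
  thus "(\<lambda>n. ln (norm ((F ^^ n) X)) / d ^ n) \<longlonglongrightarrow> green d F X" by (simp add: g_def)
  have "(\<lambda>k. \<bar>g (n + k) - g n\<bar>) \<longlonglongrightarrow> \<bar>green d F X - g n\<bar>"
    using LIMSEQ_ignore_initial_segment[OF lim, of n]
    by (intro tendsto_intros) (simp add: add.commute)
  hence "\<bar>green d F X - g n\<bar> \<le> m / real d ^ n"
    using step by (intro LIMSEQ_le_const2) auto
  thus "\<bar>green d F X - ln (norm ((F ^^ n) X)) / d ^ n\<bar> \<le> m / d ^ n" by (simp add: g_def)
qed

lemma green_functional_equation:
  assumes F: "growth_bound m d F" and m: "m \<ge> 0" and d: "d \<ge> 2" and X: "X \<noteq> 0"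
  shows "green d F (F X) = d * green d F X"
proof -
  have "(\<lambda>n. d * (ln (norm ((F ^^ Suc n) X)) / d ^ Suc n)) \<longlonglongrightarrow> d * green d F X"
    using LIMSEQ_Suc[OF green_approx(1)[OF assms]] by (intro tendsto_intros)
  hence "(\<lambda>n. ln (norm ((F ^^ n) (F X))) / d ^ n) \<longlonglongrightarrow> d * green d F X"
    using d by (simp add: funpow_Suc_right del: funpow.simps)
  thus ?thesis
    using green_approx(1)[OF F m d growth_bound_nonzero[OF F X]] LIMSEQ_unique by blast
qed

lemma green_scale:
  assumes L: "is_lift d p q f" and F: "growth_bound m d (lift_map d p q)"
    and m: "m \<ge> 0" and d: "d \<ge> 2" and X: "(x, y) \<noteq> 0" and t: "t \<noteq> 0"
  shows "green d (lift_map d p q) (t * x, t * y) = ln (norm t) + green d (lift_map d p q) (x, y)"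
proof -
  let ?F = "lift_map d p q"
  have "ln (norm ((?F ^^ n) (t * x, t * y))) / d ^ n
        = ln (norm t) + ln (norm ((?F ^^ n) (x, y))) / d ^ n" for n
  proof -
    obtain P Q where PQ: "lift_map (d ^ n) P Q = ?F ^^ n"
      using is_lift_iterate[OF L] by blast
    have "norm ((?F ^^ n) (t * x, t * y)) = norm t ^ (d ^ n) * norm ((?F ^^ n) (x, y))"
      unfolding PQ[symmetric] by (rule norm_lift_map_scale)
    moreover have "norm ((?F ^^ n) (x, y)) > 0"
      using growth_bound_nonzero[OF growth_bound_funpow[OF F] X] by simp
    ultimately have "ln (norm ((?F ^^ n) (t * x, t * y)))
        = d ^ n * ln (norm t) + ln (norm ((?F ^^ n) (x, y)))"
      using t by (simp add: ln_mult ln_realpow)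
    thus ?thesis using d by (simp add: add_divide_distrib)
  qed
  moreover have "(\<lambda>n. ln (norm t) + ln (norm ((?F ^^ n) (x, y))) / d ^ n)
      \<longlonglongrightarrow> ln (norm t) + green d ?F (x, y)"
    by (intro tendsto_intros green_approx(1)[OF F m d X])
  moreover have "(t * x, t * y) \<noteq> 0" using X t by (auto simp: zero_prod_def)
  hence "(\<lambda>n. ln (norm ((?F ^^ n) (t * x, t * y))) / d ^ n) \<longlonglongrightarrow> green d ?F (t * x, t * y)"
    by (rule green_approx(1)[OF F m d])
  ultimately show ?thesis by (simp add: LIMSEQ_unique)
qed

lemma continuous_on_green:
  assumes F: "growth_bound m d (lift_map d p q)" and m: "m \<ge> 0" and d: "d \<ge> 2"
  shows "continuous_on (- {0}) (green d (lift_map d p q))"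
proof (rule uniform_limit_theorem)
  let ?F = "lift_map d p q"
  have cont: "continuous_on S (?F ^^ n)" for n S
  proof (induction n)
    case (Suc n)
    show ?case
      using continuous_on_compose[OF Suc continuous_on_lift_map[of _ d p q]] by simp
  qed (simp add: id_def)
  show "\<forall>\<^sub>F n in sequentially. continuous_on (- {0}) (\<lambda>X. ln (norm ((?F ^^ n) X)) / d ^ n)"
    using growth_bound_nonzero[OF growth_bound_funpow[OF F]] d
    by (intro always_eventually allI continuous_intros cont) auto
  show "uniform_limit (- {0}) (\<lambda>n X. ln (norm ((?F ^^ n) X)) / d ^ n) (green d ?F) sequentially"
  proof (rule uniform_limitI)
    fix e :: real assume "0 < e"
    hence "\<forall>\<^sub>F n in sequentially. m / real d ^ n < e"
      using order_tendstoD(2)[OF bound_over_power_tendsto_0[OF d, of m]] by blast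
    thus "\<forall>\<^sub>F n in sequentially. \<forall>X\<in>- {0}. dist (ln (norm ((?F ^^ n) X)) / d ^ n) (green d ?F X) < e"
    proof eventually_elim
      case (elim n)
      show ?case
      proof
        fix X :: "complex \<times> complex" assume "X \<in> - {0}"
        hence "\<bar>green d ?F X - ln (norm ((?F ^^ n) X)) / d ^ n\<bar> \<le> m / real d ^ n"
          using green_approx(2)[OF F m d, of X n] by simp
        thus "dist (ln (norm ((?F ^^ n) X)) / d ^ n) (green d ?F X) < e"
          using elim by (simp add: dist_real_def abs_minus_commute)
      qed
    qed
  qed
qed simp

lemma green_base_point:
  assumes L: "is_lift d p q f"
  shows "green d (lift_map d p q) (0, 1) = 0"
proof -
  have 0: "lift_map d p q (0, 1) = (0, 1)" using L by (auto simp: is_lift_def lift_map_def hom_eval_1)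
  have "(lift_map d p q ^^ n) (0, 1) = (0, 1)" for n by (induction n) (auto simp: 0)
  thus ?thesis by (simp add: green_def norm_Pair)
qed

text \<open>
  The functional equation in the affine coordinate: the lift multiplies \<open>(p z / q z, 1)\<close> by \<open>q z\<close>.
\<close>

lemma green_affine_equation:
  assumes L: "is_lift d p q f" and F: "growth_bound m d (lift_map d p q)"
    and m: "m \<ge> 0" and d: "d \<ge> 2" and q: "poly q z \<noteq> 0"
  shows "d * green d (lift_map d p q) (z, 1)
       = green d (lift_map d p q) (poly p z / poly q z, 1) + ln (norm (poly q z))"
proof -
  have "lift_map d p q (z, 1) = (poly q z * (poly p z / poly q z), poly q z * 1)"
    using L q by (simp add: lift_map_def is_lift_def hom_eval_1)
  hence "d * green d (lift_map d p q) (z, 1)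
      = green d (lift_map d p q) (poly q z * (poly p z / poly q z), poly q z * 1)"
    using green_functional_equation[OF F m d, of "(z, 1)"] by (simp add: zero_prod_def)
  also have "\<dots> = ln (norm (poly q z)) + green d (lift_map d p q) (poly p z / poly q z, 1)"
    by (rule green_scale[OF L F m d _ q]) (simp add: zero_prod_def)
  finally show ?thesis by simp
qed

lemma iterate_green_bound:
  assumes L: "is_lift d p q f" and F: "growth_bound m d (lift_map d p q)"
    and m: "m \<ge> 0" and d: "d \<ge> 2"
  shows "\<exists>P Q. is_lift (d ^ n) P Q (comp_word (replicate n f)) \<and>
    (\<forall>z. ln (norm (poly P z, poly Q z)) \<le> real d ^ n * green d (lift_map d p q) (z, 1) + m)"
proof -
  obtain P Q where PQ: "is_lift (d ^ n) P Q (comp_word (replicate n f))"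
      "lift_map (d ^ n) P Q = lift_map d p q ^^ n" using is_lift_iterate[OF L] by blast
  have "ln (norm (poly P z, poly Q z)) \<le> real d ^ n * green d (lift_map d p q) (z, 1) + m" for z
  proof -
    have "(lift_map d p q ^^ n) (z, 1) = (poly P z, poly Q z)"
      unfolding PQ(2)[symmetric] using PQ(1) by (simp add: lift_map_def is_lift_def hom_eval_1)
    moreover have "ln (norm ((lift_map d p q ^^ n) (z, 1))) / real d ^ n
        \<le> green d (lift_map d p q) (z, 1) + m / real d ^ n"
      using green_approx(2)[OF F m d, of "(z, 1)" n] by (simp add: zero_prod_def abs_le_iff)
    ultimately have "ln (norm (poly P z, poly Q z))
        \<le> (green d (lift_map d p q) (z, 1) + m / real d ^ n) * real d ^ n"
      using d by (simp add: pos_divide_le_eq)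
    also have "\<dots> = real d ^ n * green d (lift_map d p q) (z, 1) + m"
      using d by (simp add: distrib_right)
    finally show ?thesis by simp
  qed
  thus ?thesis using PQ(1) by blast
qed

lemma green_eq_of_collisions:
  assumes a: "is_lift d p q a" "growth_bound m d (lift_map d p q)"
    and b: "is_lift d r s b" "growth_bound m d (lift_map d r s)"
    and m: "m \<ge> 0" and d: "d \<ge> 2" and X: "X \<noteq> 0"
    and col: "\<And>j. collide (comp_word (replicate j a)) (comp_word (replicate j b))"
  shows "green d (lift_map d p q) X = green d (lift_map d r s) X"
proof -
  let ?A = "lift_map d p q" and ?B = "lift_map d r s"
  have bound: "\<bar>ln (norm ((?A ^^ n) X)) - ln (norm ((?B ^^ n) X))\<bar> \<le> 2 * m" for n
  proof -
    obtain P Q where PQ: "is_lift (d ^ n) P Q (comp_word (replicate n a))"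
      "lift_map (d ^ n) P Q = ?A ^^ n" using is_lift_iterate[OF a(1)] by blast
    obtain R S where RS: "is_lift (d ^ n) R S (comp_word (replicate n b))"
      "lift_map (d ^ n) R S = ?B ^^ n" using is_lift_iterate[OF b(1)] by blast
    show ?thesis
      using collide_norm_bound[OF PQ(1) _ RS(1) _ m _ col X]
        growth_bound_funpow[OF a(2), of n] growth_bound_funpow[OF b(2), of n] d
      unfolding PQ(2) RS(2) by simp
  qed
  have "(\<lambda>n. ln (norm ((?A ^^ n) X)) / d ^ n - ln (norm ((?B ^^ n) X)) / d ^ n)
      \<longlonglongrightarrow> green d ?A X - green d ?B X"
    by (intro tendsto_diff green_approx(1)[OF a(2) m d X] green_approx(1)[OF b(2) m d X])
  moreover have "(\<lambda>n. ln (norm ((?A ^^ n) X)) / d ^ n - ln (norm ((?B ^^ n) X)) / d ^ n) \<longlonglongrightarrow> 0"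
  proof (rule tendsto_rabs_zero_cancel,
      rule tendsto_sandwich[where f = "\<lambda>_. 0" and h = "\<lambda>n. 2 * m / real d ^ n"])
    show "(\<lambda>n. 2 * m / real d ^ n) \<longlonglongrightarrow> 0" by (rule bound_over_power_tendsto_0[OF d])
    show "\<forall>\<^sub>F n in sequentially. \<bar>ln (norm ((?A ^^ n) X)) / d ^ n - ln (norm ((?B ^^ n) X)) / d ^ n\<bar>
        \<le> 2 * m / real d ^ n"
      using bound d by (intro always_eventually allI)
        (simp add: abs_divide divide_right_mono flip: diff_divide_distrib)
  qed auto
  ultimately have "green d ?A X - green d ?B X = 0" by (rule LIMSEQ_unique)
  thus ?thesis by simp
qed

section \<open>Removable singularities of real parts of holomorphic functions\<close>

lemma has_derivative_Re_holomorphic: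
  assumes "h holomorphic_on S" "open S" "z \<in> S"
  shows "((\<lambda>w. Re (h w)) has_derivative (\<lambda>t. Re (deriv h z * t))) (at z)"
proof -
  have "(h has_field_derivative deriv h z) (at z)"
    using holomorphic_derivI[OF assms] .
  hence "(h has_derivative (\<lambda>t. deriv h z * t)) (at z)"
    by (simp add: has_field_derivative_def)
  thus ?thesis by (intro has_derivative_Re)
qed

lemma real_gradient_unique:
  fixes v :: "complex \<Rightarrow> real"
  assumes "(v has_derivative (\<lambda>t. Re (g * t))) (at z)" "(v has_derivative (\<lambda>t. Re (g' * t))) (at z)"
  shows "g = g'"
proof -
  have "(\<lambda>t. Re (g * t)) = (\<lambda>t. Re (g' * t))"
    using has_derivative_unique[OF assms] .
  from fun_cong[OF this, of 1] fun_cong[OF this, of \<i>] show ?thesis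
    by (simp add: complex_eq_iff)
qed

text \<open>
  The map \<open>w \<mapsto> w / (2 A - w)\<close> sends the half-plane \<open>Re w \<le> A\<close> into the closed unit disc, and Cauchy's
  inequality applies to its composition with \<open>h - h z\<close>.
\<close>

lemma Borel_Caratheodory_deriv:
  assumes h: "h holomorphic_on ball z s" and s: "s > 0" and A: "A > 0"
    and bound: "\<And>w. w \<in> ball z s \<Longrightarrow> Re (h w) - Re (h z) \<le> A"
  shows "norm (deriv h z) \<le> 4 * A / s"
proof -
  define H where "H = (\<lambda>w. h w - h z)"
  \<comment> \<open>\<open>\<phi>\<close> maps the disc into the closed unit disc, and \<open>\<phi>' z = h' z / (2 A)\<close>.\<close>
  define \<phi> where "\<phi> = (\<lambda>w. H w / (2 * of_real A - H w))"
  have H: "H holomorphic_on ball z s" unfolding H_def by (intro holomorphic_intros h)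
  have nz: "2 * of_real A - H w \<noteq> 0" if "w \<in> ball z s" for w
  proof
    assume "2 * of_real A - H w = 0"
    hence "Re (H w) = 2 * A" by (simp add: complex_eq_iff)
    thus False using bound[OF that] A by (simp add: H_def)
  qed
  have \<phi>: "\<phi> holomorphic_on ball z s"
    unfolding \<phi>_def by (intro holomorphic_intros H) (use nz in auto)
  have le1: "norm (\<phi> w) \<le> 1" if "w \<in> ball z s" for w
  proof -
    have re: "Re (H w) \<le> A" using bound[OF that] by (simp add: H_def)
    have "(Re (H w))\<^sup>2 \<le> (2 * A - Re (H w))\<^sup>2"
    proof -
      have "0 \<le> 4 * A * (A - Re (H w))" using A re by simp
      thus ?thesis by (simp add: power2_eq_square algebra_simps)
    qed
    hence "norm (H w) \<le> norm (2 * of_real A - H w)"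
      by (simp add: cmod_def)
    thus ?thesis using nz[OF that] by (simp add: \<phi>_def norm_divide divide_le_eq)
  qed
  have "norm ((deriv ^^ 1) \<phi> z) \<le> fact 1 * 1 / (s / 2) ^ 1"
  proof (rule Cauchy_inequality)
    show "\<phi> holomorphic_on ball z (s / 2)" using \<phi> s by (elim holomorphic_on_subset) auto
    show "continuous_on (cball z (s / 2)) \<phi>"
      using \<phi> s by (intro holomorphic_on_imp_continuous_on) (elim holomorphic_on_subset, auto)
    show "norm (\<phi> x) \<le> 1" if "norm (z - x) = s / 2" for x
      using s that by (intro le1) (auto simp: dist_norm)
  qed (use s in simp)
  hence d\<phi>: "norm (deriv \<phi> z) \<le> 2 / s" using s by simp
  have zz: "z \<in> ball z s" using s by simp
  have Hz: "H z = 0" by (simp add: H_def)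
  have dH: "(H has_field_derivative deriv h z) (at z)"
    unfolding H_def using holomorphic_derivI[OF h open_ball zz] by (auto intro!: derivative_eq_intros)
  have "(\<phi> has_field_derivative
     (deriv h z * (2 * of_real A - H z) - H z * (- deriv h z)) / (2 * of_real A - H z)\<^sup>2) (at z)"
    unfolding \<phi>_def using nz[OF zz]
    by (auto intro!: derivative_eq_intros dH simp: power2_eq_square)
  hence "deriv \<phi> z = deriv h z / (2 * of_real A)"
    using A by (intro DERIV_imp_deriv) (simp add: Hz power2_eq_square)
  hence "norm (deriv h z) / (2 * A) \<le> 2 / s"
    using d\<phi> A by (simp add: norm_divide)
  thus ?thesis using A s by (simp add: field_simps)
qed

text \<open>
  On the punctured disc the gradient of \<open>v\<close>, written as \<open>g\<close> with \<open>v' t = Re (g t)\<close>, is holomorphic, for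
  it is the derivative of any local \<open>h\<close>. By continuity of \<open>v\<close> the oscillation of \<open>v\<close> on the disc of radius \<open>\<bar>z\<bar> / 2\<close> about \<open>z\<close>
  tends to \<open>0\<close> with \<open>z\<close>, and the Borel--Caratheodory estimate gives \<open>z g(z) \<rightarrow> 0\<close>. So \<open>g\<close> extends
  to \<open>0\<close>, and a primitive of it is the required function, up to a constant.
\<close>

theorem removable_isolated_singularity_real_part:
  fixes v :: "complex \<Rightarrow> real"
  assumes \<delta>: "\<delta> > 0" and cont: "continuous_on (ball 0 \<delta>) v"
    and loc: "\<And>z0. z0 \<in> ball 0 \<delta> - {0} \<Longrightarrow>
      \<exists>s>0. \<exists>h. h holomorphic_on ball z0 s \<and> (\<forall>z\<in>ball z0 s. v z = Re (h z))"
  shows "\<exists>h. h holomorphic_on ball 0 \<delta> \<and> (\<forall>z\<in>ball 0 \<delta>. v z = Re (h z))"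
proof -
  let ?D = "ball 0 \<delta> - {0} :: complex set"
  have openD: "open ?D" by (intro open_delete open_ball)
  define g where "g = (\<lambda>z. SOME g. (v has_derivative (\<lambda>t. Re (g * t))) (at z))"
  have local: "\<exists>s>0. \<exists>h. h holomorphic_on ball z0 s \<and> ball z0 s \<subseteq> ?D \<and>
     (\<forall>z\<in>ball z0 s. (v has_derivative (\<lambda>t. Re (g z * t))) (at z) \<and> g z = deriv h z)"
    if z0: "z0 \<in> ?D" for z0
  proof -
    obtain s1 h where h: "s1 > 0" "h holomorphic_on ball z0 s1" "\<forall>z\<in>ball z0 s1. v z = Re (h z)"
      using loc[OF z0] by blast
    obtain s2 where s2: "s2 > 0" "ball z0 s2 \<subseteq> ?D"
      using openD z0 unfolding open_contains_ball by blast
    define s where "s = min s1 s2"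
    have "ball z0 s \<subseteq> ball z0 s1" "ball z0 s \<subseteq> ball z0 s2" by (simp_all add: s_def subset_ball)
    moreover have "s > 0" using h(1) s2(1) by (simp add: s_def)
    ultimately have s: "s > 0" "ball z0 s \<subseteq> ?D" "ball z0 s \<subseteq> ball z0 s1"
      using s2(2) by blast+
    have "(v has_derivative (\<lambda>t. Re (g z * t))) (at z) \<and> g z = deriv h z" if z: "z \<in> ball z0 s" for z
    proof -
      have z1: "z \<in> ball z0 s1" using z s by blast
      have "((\<lambda>w. Re (h w)) has_derivative (\<lambda>t. Re (deriv h z * t))) (at z)"
        by (rule has_derivative_Re_holomorphic[OF h(2) open_ball z1])
      hence *: "(v has_derivative (\<lambda>t. Re (deriv h z * t))) (at z)"
        by (rule has_derivative_transform_within_open[OF _ open_ball z1]) (use h(3) in auto)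
      hence "(v has_derivative (\<lambda>t. Re (g z * t))) (at z)"
        unfolding g_def by (rule someI)
      thus ?thesis using real_gradient_unique[OF _ *] by blast
    qed
    thus ?thesis using s h(2) holomorphic_on_subset by blast
  qed
  have grad: "(v has_derivative (\<lambda>t. Re (g z * t))) (at z)" if zD: "z \<in> ?D" for z
  proof -
    obtain s h where "s > 0" "\<forall>w\<in>ball z s. (v has_derivative (\<lambda>t. Re (g w * t))) (at w)"
      using local[OF zD] by blast
    thus ?thesis by simp
  qed
  have hol: "g holomorphic_on ?D"
    unfolding holomorphic_on_open[OF openD]
  proof
    fix z assume "z \<in> ?D"
    then obtain s h where sh: "s > 0" "h holomorphic_on ball z s" "\<forall>w\<in>ball z s. g w = deriv h w"
      using local by blast
    have "deriv h holomorphic_on ball z s" using sh by (intro holomorphic_deriv) auto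
    hence "g holomorphic_on ball z s"
      by (rule holomorphic_transform) (use sh in auto)
    thus "\<exists>f'. (g has_field_derivative f') (at z)"
      using sh(1) holomorphic_derivI[OF _ open_ball] by (metis centre_in_ball)
  qed
  have small: "((\<lambda>z. (z - 0) * g z) \<longlongrightarrow> 0) (at 0)"
  proof (rule tendstoI)
    fix e :: real assume e: "e > 0"
    define A where "A = e / 16"
    have A: "A > 0" using e by (simp add: A_def)
    have "continuous (at 0) v"
      using cont \<delta> by (simp add: continuous_on_eq_continuous_at)
    then obtain \<eta> where \<eta>: "\<eta> > 0" "\<And>z. norm z < \<eta> \<Longrightarrow> \<bar>v z - v 0\<bar> < A / 2"
      using A unfolding continuous_at_eps_delta dist_norm by (metis diff_zero half_gt_zero real_norm_def)
    define r where "r = min \<eta> \<delta> / 2"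
    have r: "r > 0" using \<eta>(1) \<delta> by (simp add: r_def)
    have "norm (z * g z) < e" if z: "z \<noteq> 0" "norm z < r" for z
    proof -
      define s where "s = norm z / 2"
      have s: "s > 0" using z by (simp add: s_def)
      have near: "norm w < \<eta> \<and> norm w < \<delta> \<and> w \<noteq> 0" if "w \<in> ball z s" for w
      proof -
        have "norm (w - z) < norm z / 2" using that by (simp add: s_def dist_norm norm_minus_commute)
        moreover have "norm w \<le> norm z + norm (w - z)" using norm_triangle_sub by blast
        moreover have "norm z \<le> norm w + norm (w - z)"
          by (metis norm_minus_commute norm_triangle_sub)
        moreover have "norm z > 0" using z by simp
        ultimately show ?thesis using z(2) unfolding r_def by auto
      qed
      have sub: "ball z s \<subseteq> ?D"
      proof
        fix w assume "w \<in> ball z s"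
        from near[OF this] show "w \<in> ?D" by simp
      qed
      have "g holomorphic_on ball z s" using hol sub by (rule holomorphic_on_subset)
      then obtain h where h: "\<And>w. w \<in> ball z s \<Longrightarrow> (h has_field_derivative g w) (at w within ball z s)"
        using holomorphic_convex_primitive'[OF convex_ball open_ball] by blast
      hence h': "(h has_field_derivative g w) (at w)" if "w \<in> ball z s" for w
        using h[OF that] that by (simp only: at_within_open[OF _ open_ball])
      have hh: "h holomorphic_on ball z s"
        using h' unfolding holomorphic_on_open[OF open_ball] by blast
      have zz: "z \<in> ball z s" using s by simp
      have dh: "deriv h z = g z" using h'[OF zz] by (rule DERIV_imp_deriv)
      have "((\<lambda>w. Re (h w) - v w) has_derivative (\<lambda>t. 0)) (at w within ball z s)" if w: "w \<in> ball z s" for w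
      proof -
        have "((\<lambda>w. Re (h w)) has_derivative (\<lambda>t. Re (g w * t))) (at w)"
          using h'[OF w] by (intro has_derivative_Re) (simp add: has_field_derivative_def)
        moreover have "(v has_derivative (\<lambda>t. Re (g w * t))) (at w)" using grad w sub by blast
        ultimately have "((\<lambda>w. Re (h w) - v w) has_derivative (\<lambda>t. Re (g w * t) - Re (g w * t))) (at w)"
          by (rule has_derivative_diff)
        thus ?thesis by (simp add: has_derivative_at_withinI)
      qed
      then obtain c where c: "\<forall>w\<in>ball z s. Re (h w) - v w = c"
        using has_derivative_zero_constant[of "ball z s" "\<lambda>w. Re (h w) - v w"] by auto
      have "Re (h w) - Re (h z) \<le> A" if w: "w \<in> ball z s" for w
      proof -
        have "Re (h w) - Re (h z) = v w - v z"
          using c[rule_format, OF w] c[rule_format, OF zz] by linarith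
        moreover have "\<bar>v w - v 0\<bar> < A / 2" "\<bar>v z - v 0\<bar> < A / 2"
          using near[OF w] near[OF zz] \<eta>(2) by blast+
        ultimately show ?thesis by linarith
      qed
      from Borel_Caratheodory_deriv[OF hh s A this] have "norm (g z) \<le> 4 * A / s" by (simp add: dh)
      hence "norm z * norm (g z) \<le> norm z * (4 * A / s)" by (intro mult_left_mono) auto
      also have "\<dots> = e / 2" using z by (simp add: s_def A_def)
      also have "\<dots> < e" using e by simp
      finally show ?thesis by (simp add: norm_mult)
    qed
    thus "\<forall>\<^sub>F z in at 0. dist ((z - 0) * g z) 0 < e"
      unfolding eventually_at using r by (intro exI[of _ r]) (auto simp: dist_norm)
  qed
  have "(\<exists>f. f holomorphic_on ball 0 \<delta> \<and> (\<forall>z\<in>ball 0 \<delta> - {0}. f z = g z))"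
    using holomorphic_on_extend_lim[of g "ball 0 \<delta>" 0] hol small \<delta> by simp
  then obtain f where f: "f holomorphic_on ball 0 \<delta>" "\<forall>z\<in>?D. f z = g z" by blast
  obtain h where h: "\<And>w. w \<in> ball 0 \<delta> \<Longrightarrow> (h has_field_derivative f w) (at w within ball 0 \<delta>)"
    using holomorphic_convex_primitive'[OF convex_ball open_ball f(1)] by blast
  hence h': "(h has_field_derivative f w) (at w)" if "w \<in> ball 0 \<delta>" for w
    using h[OF that] that by (simp only: at_within_open[OF _ open_ball])
  have hh: "h holomorphic_on ball 0 \<delta>"
    using h' unfolding holomorphic_on_open[OF open_ball] by blast
  define c where "c = Re (h 0) - v 0"
  have "Re (h z) - v z = c" if z: "z \<in> ball 0 \<delta>" for z
  proof (rule has_derivative_zero_unique_strong_convex[of "ball 0 \<delta>" "{0}" "\<lambda>z. Re (h z) - v z" 0])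
    show "continuous_on (ball 0 \<delta>) (\<lambda>z. Re (h z) - v z)"
      by (intro continuous_intros cont holomorphic_on_imp_continuous_on hh)
    fix w :: complex assume w: "w \<in> ball 0 \<delta> - {0}"
    have "((\<lambda>w. Re (h w)) has_derivative (\<lambda>t. Re (g w * t))) (at w)"
      using h'[of w] w f(2) by (intro has_derivative_Re) (simp add: has_field_derivative_def)
    from has_derivative_diff[OF this grad[OF w]]
    show "((\<lambda>w. Re (h w) - v w) has_derivative (\<lambda>h. 0)) (at w within ball 0 \<delta>)"
      by (simp add: has_derivative_at_withinI)
  qed (use \<delta> z in \<open>auto simp: c_def\<close>)
  hence "v z = Re (h z - of_real c)" if "z \<in> ball 0 \<delta>" for z
    using that by (simp add: algebra_simps)
  moreover have "(\<lambda>z. h z - of_real c) holomorphic_on ball 0 \<delta>" by (intro holomorphic_intros hh)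
  ultimately show ?thesis by blast
qed

section \<open>Petals of a germ tangent to the identity\<close>

text \<open>
  In this coordinate a germ \<open>z + \<gamma> z ^ (k + 1) + \<dots>\<close> is close to the translation by \<open>1\<close>.
\<close>

definition petal_coord :: "nat \<Rightarrow> complex \<Rightarrow> complex \<Rightarrow> complex" where
  "petal_coord k \<gamma> z = - 1 / (of_nat k * \<gamma> * z ^ k)"

lemma petal_coord_translation:
  assumes k: "k \<ge> 1" and \<gamma>: "\<gamma> \<noteq> 0"
    and lim: "((\<lambda>z. (c z - z) / z ^ Suc k) \<longlongrightarrow> \<gamma>) (at 0)"
  shows "((\<lambda>z. petal_coord k \<gamma> (c z) - petal_coord k \<gamma> z) \<longlongrightarrow> 1) (at 0)"
    and "eventually (\<lambda>z. c z \<noteq> 0) (at 0)"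
proof -
  define q where "q = (\<lambda>z. (c z - z) / z ^ Suc k)"
  define s where "s = (\<lambda>z. z ^ k * q z)"
  have "((\<lambda>z. z ^ k * q z) \<longlongrightarrow> 0 ^ k * \<gamma>) (at 0)"
    unfolding q_def by (intro tendsto_intros lim)
  hence s0: "(s \<longlongrightarrow> 0) (at 0)" using k by (simp add: s_def power_0_left)
  have qnz: "eventually (\<lambda>z. q z \<noteq> 0) (at 0)"
    using tendsto_imp_eventually_ne[OF lim \<gamma>] by (simp add: q_def)
  have znz: "eventually (\<lambda>z::complex. z \<noteq> 0) (at 0)"
    by (simp add: eventually_at_filter)
  have snz: "eventually (\<lambda>z. s z \<noteq> 0) (at 0)"
    using qnz znz by eventually_elim (simp add: s_def)
  have s1: "eventually (\<lambda>z. 1 + s z \<noteq> 0) (at 0)"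
  proof -
    have "((\<lambda>z. 1 + s z) \<longlongrightarrow> 1 + 0) (at 0)" by (intro tendsto_intros s0)
    thus ?thesis using tendsto_imp_eventually_ne[of "\<lambda>z. 1 + s z" 1] by simp
  qed
  have c_eq: "c z = z * (1 + s z)" if "z \<noteq> 0" for z
    using that by (simp add: s_def q_def field_simps)
  show "eventually (\<lambda>z. c z \<noteq> 0) (at 0)"
    using znz s1 by eventually_elim (simp add: c_eq)
  have "((\<lambda>x::complex. inverse ((1 + x) ^ k)) has_field_derivative - of_nat k) (at 0)"
    by (auto intro!: derivative_eq_intros)
  hence "((\<lambda>x::complex. (inverse ((1 + x) ^ k) - 1) / x) \<longlongrightarrow> - of_nat k) (at 0)"
    by (simp add: DERIV_def)
  moreover have "filterlim s (at 0) (at 0)"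
    using s0 snz by (simp add: filterlim_at)
  ultimately have D: "((\<lambda>z. (inverse ((1 + s z) ^ k) - 1) / s z) \<longlongrightarrow> - of_nat k) (at 0)"
    by (rule filterlim_compose)
  have "((\<lambda>z. - ((inverse ((1 + s z) ^ k) - 1) / s z) * q z / (of_nat k * \<gamma>))
      \<longlongrightarrow> - (- of_nat k) * \<gamma> / (of_nat k * \<gamma>)) (at 0)"
    unfolding q_def by (intro tendsto_intros D lim) (use k \<gamma> in auto)
  hence lim1: "((\<lambda>z. - ((inverse ((1 + s z) ^ k) - 1) / s z) * q z / (of_nat k * \<gamma>)) \<longlongrightarrow> 1) (at 0)"
    using k \<gamma> by simp
  have "eventually (\<lambda>z. - ((inverse ((1 + s z) ^ k) - 1) / s z) * q z / (of_nat k * \<gamma>)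
      = petal_coord k \<gamma> (c z) - petal_coord k \<gamma> z) (at 0)"
    using znz snz s1 qnz
  proof eventually_elim
    case (elim z)
    have "q z / s z = 1 / z ^ k" using elim by (simp add: s_def)
    hence "- ((inverse ((1 + s z) ^ k) - 1) / s z) * q z / (of_nat k * \<gamma>)
        = - (inverse ((1 + s z) ^ k) - 1) * (1 / z ^ k) / (of_nat k * \<gamma>)"
      by (metis (no_types, lifting) minus_divide_left times_divide_eq_left times_divide_eq_right)
    also have "\<dots> = - 1 / (of_nat k * \<gamma> * (z * (1 + s z)) ^ k) - - 1 / (of_nat k * \<gamma> * z ^ k)"
      using elim k \<gamma> by (simp add: power_mult_distrib divide_simps)
    finally show ?case using elim by (simp add: petal_coord_def c_eq)
  qed
  from tendsto_cong[OF this] lim1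
  show "((\<lambda>z. petal_coord k \<gamma> (c z) - petal_coord k \<gamma> z) \<longlongrightarrow> 1) (at 0)" by blast
qed

lemma norm_petal_coord: "norm (petal_coord k \<gamma> z) = 1 / (k * norm \<gamma> * norm z ^ k)"
  by (simp add: petal_coord_def norm_divide norm_mult norm_power)

lemma petal_coord_large_imp_small:
  assumes "k \<ge> 1" "\<gamma> \<noteq> 0" "z \<noteq> 0" "\<delta> > 0"
    and "norm (petal_coord k \<gamma> z) > 1 / (k * norm \<gamma> * \<delta> ^ k)"
  shows "norm z < \<delta>"
proof (rule ccontr)
  assume "\<not> norm z < \<delta>"
  hence "\<delta> ^ k \<le> norm z ^ k" using assms(4) by (intro power_mono) auto
  hence "real k * norm \<gamma> * \<delta> ^ k \<le> real k * norm \<gamma> * norm z ^ k"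
    by (intro mult_left_mono) auto
  moreover have "real k * norm \<gamma> * \<delta> ^ k > 0" using assms by simp
  ultimately have "1 / (real k * norm \<gamma> * norm z ^ k) \<le> 1 / (real k * norm \<gamma> * \<delta> ^ k)"
    by (intro divide_left_mono) auto
  thus False using assms(5) by (simp add: norm_petal_coord)
qed

text \<open>
  On the petal the orbits of \<open>c\<close> converge to \<open>0\<close>, where \<open>v\<close> vanishes. So \<open>exp v\<close> is the limit of the moduli
  of the products of \<open>\<rho>\<close> along the orbit. These products are uniformly bounded, and by Montel's theorem
  \<open>exp v\<close> is the modulus of a holomorphic function, whose logarithm has real part \<open>v\<close>.
\<close>

lemma harmonic_on_petal:
  fixes v :: "complex \<Rightarrow> real" and c \<rho> :: "complex \<Rightarrow> complex" and \<gamma> :: complex and k :: nat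
  defines "W \<equiv> petal_coord k \<gamma>"
  assumes \<delta>: "\<delta> > 0" and k: "k \<ge> 1" and \<gamma>: "\<gamma> \<noteq> 0"
    and step: "\<And>z. 0 < norm z \<Longrightarrow> norm z < \<delta> \<Longrightarrow> c z \<noteq> 0 \<and> norm (W (c z) - W z - 1) \<le> 1 / 4"
    and c: "c holomorphic_on ball 0 \<delta>" and \<rho>: "\<rho> holomorphic_on ball 0 \<delta>"
    and \<rho>_nz: "\<And>z. z \<in> ball 0 \<delta> \<Longrightarrow> \<rho> z \<noteq> 0"
    and v: "continuous_on (cball 0 \<delta>) v" "v 0 = 0"
    and eq: "\<And>z. z \<in> ball 0 \<delta> \<Longrightarrow> v z = v (c z) + ln (norm (\<rho> z))"
    and z0: "z0 \<noteq> 0" "Re (W z0) + \<bar>Im (W z0)\<bar> > 2 * (1 / (k * norm \<gamma> * \<delta> ^ k))"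
  shows "\<exists>s>0. \<exists>h. h holomorphic_on ball z0 s \<and> (\<forall>z\<in>ball z0 s. v z = Re (h z))"
proof -
  define R where "R = 1 / (k * norm \<gamma> * \<delta> ^ k)"
  \<comment> \<open>One step of \<open>c\<close> raises \<open>Re W\<close> by at least \<open>3 / 4\<close> and lowers \<open>\<bar>Im W\<bar>\<close> by at most \<open>1 / 4\<close>, so it maps \<open>\<Omega>\<close>
      into itself. The factor \<open>2\<close> compensates for \<open>Re W + \<bar>Im W\<bar> \<le> 2 \<bar>W\<bar>\<close>, so that \<open>\<Omega>\<close> lies in the disc
      of radius \<open>\<delta>\<close>.\<close>
  define \<Omega> where "\<Omega> = {z. z \<noteq> 0 \<and> Re (W z) + \<bar>Im (W z)\<bar> > 2 * R}"
  have R0: "R > 0" using \<delta> k \<gamma> by (simp add: R_def)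
  have small: "norm z < \<delta>" "z \<noteq> 0" if "z \<in> \<Omega>" for z
  proof -
    show z: "z \<noteq> 0" using that by (simp add: \<Omega>_def)
    have "Re (W z) + \<bar>Im (W z)\<bar> \<le> 2 * norm (W z)"
      using complex_Re_le_cmod[of "W z"] abs_Im_le_cmod[of "W z"] by linarith
    hence "norm (W z) > R" using that by (simp add: \<Omega>_def)
    thus "norm z < \<delta>"
      using petal_coord_large_imp_small[OF k \<gamma> z \<delta>] unfolding R_def W_def by blast
  qed
  have \<Omega>_ball: "\<Omega> \<subseteq> ball 0 \<delta>" using small by auto
  have c_step: "c z \<in> \<Omega> \<and> Re (W (c z)) \<ge> Re (W z) + 3 / 4" if z: "z \<in> \<Omega>" for z
  proof -
    have "c z \<noteq> 0" and n: "norm (W (c z) - W z - 1) \<le> 1 / 4"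
      using step[of z] small[OF z] by auto
    have "\<bar>Re (W (c z) - W z - 1)\<bar> \<le> 1 / 4" "\<bar>Im (W (c z) - W z - 1)\<bar> \<le> 1 / 4"
      using n abs_Re_le_cmod abs_Im_le_cmod order_trans by blast+
    hence "\<bar>Re (W (c z)) - Re (W z) - 1\<bar> \<le> 1 / 4" "\<bar>Im (W (c z)) - Im (W z)\<bar> \<le> 1 / 4"
      by simp_all
    thus ?thesis using z \<open>c z \<noteq> 0\<close> unfolding \<Omega>_def mem_Collect_eq by linarith
  qed
  have iter: "(c ^^ n) z \<in> \<Omega> \<and> Re (W ((c ^^ n) z)) \<ge> Re (W z) + 3 / 4 * n" if z: "z \<in> \<Omega>" for z n
  proof (induction n)
    case (Suc n)
    define w where "w = (c ^^ n) z"
    have "Re (W z) + 3 / 4 * real (Suc n) = Re (W z) + 3 / 4 * real n + 3 / 4"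
      by (simp add: algebra_simps)
    also have "\<dots> \<le> Re (W w) + 3 / 4" using Suc by (simp add: w_def)
    also have "\<dots> \<le> Re (W (c w))" using c_step Suc by (simp add: w_def)
    finally show ?case using c_step Suc by (simp add: w_def)
  qed (use z in simp)
  have tends0: "(\<lambda>n. (c ^^ n) z) \<longlonglongrightarrow> 0" if z: "z \<in> \<Omega>" for z
  proof (rule LIMSEQ_I)
    fix e :: real assume e: "e > 0"
    obtain N :: nat where N: "real N > (1 / (k * norm \<gamma> * e ^ k) - Re (W z)) / (3 / 4)"
      using reals_Archimedean2 by blast
    have "norm ((c ^^ n) z) < e" if "n \<ge> N" for n
    proof (rule petal_coord_large_imp_small[OF k \<gamma> _ e])
      show "(c ^^ n) z \<noteq> 0" using iter[OF z, of n] small(2) by blast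
      have "1 / (k * norm \<gamma> * e ^ k) - Re (W z) < real N * (3 / 4)"
        using N by (simp only: pos_divide_less_eq)
      moreover have "real N \<le> real n" using that by simp
      ultimately have "1 / (k * norm \<gamma> * e ^ k) < Re (W ((c ^^ n) z))"
        using iter[OF z, of n] by linarith
      thus "1 / (k * norm \<gamma> * e ^ k) < norm (petal_coord k \<gamma> ((c ^^ n) z))"
        using complex_Re_le_cmod[of "W ((c ^^ n) z)"] unfolding W_def by linarith
    qed
    thus "\<exists>N. \<forall>n\<ge>N. norm ((c ^^ n) z - 0) < e" by auto
  qed
  have "open \<Omega>"
  proof -
    have "continuous_on (- {0}) W"
      unfolding W_def petal_coord_def using k \<gamma> by (intro continuous_intros) auto
    hence cont: "continuous_on (- {0}) (\<lambda>z. Re (W z) + \<bar>Im (W z)\<bar>)" by (intro continuous_intros)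
    have "open (- {0 :: complex})" by (simp add: open_Compl)
    note vim = iffD1[OF continuous_on_open_vimage[OF this] cont]
    have "open ((\<lambda>z. Re (W z) + \<bar>Im (W z)\<bar>) -` {2 * R<..} \<inter> - {0})"
      by (rule vim[rule_format]) (rule open_greaterThan)
    moreover have "(\<lambda>z. Re (W z) + \<bar>Im (W z)\<bar>) -` {2 * R<..} \<inter> - {0} = \<Omega>"
      by (auto simp: \<Omega>_def)
    ultimately show ?thesis by simp
  qed
  moreover have z0\<Omega>: "z0 \<in> \<Omega>" using z0 by (simp add: \<Omega>_def R_def)
  ultimately obtain s where s: "s > 0" "ball z0 s \<subseteq> \<Omega>" unfolding open_contains_ball by blast
  define E where "E = (\<lambda>n z. \<Prod>i<n. \<rho> ((c ^^ i) z))"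
  have c_iter_hol: "(c ^^ n) holomorphic_on \<Omega>" for n
  proof (induction n)
    case (Suc n)
    have "(c ^^ n) ` \<Omega> \<subseteq> ball 0 \<delta>" using iter \<Omega>_ball by blast
    from holomorphic_on_compose_gen[OF Suc c this] show ?case by (simp only: funpow.simps)
  qed (simp add: id_def)
  have E_hol: "E n holomorphic_on \<Omega>" for n
    unfolding E_def
  proof (intro holomorphic_intros)
    fix i
    have "(c ^^ i) ` \<Omega> \<subseteq> ball 0 \<delta>" using iter \<Omega>_ball by blast
    from holomorphic_on_compose_gen[OF c_iter_hol \<rho> this]
    show "(\<lambda>z. \<rho> ((c ^^ i) z)) holomorphic_on \<Omega>" by (simp add: o_def)
  qed
  have E_norm: "norm (E n z) = exp (v z - v ((c ^^ n) z))" if z: "z \<in> \<Omega>" for n z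
  proof (induction n)
    case (Suc n)
    have w: "(c ^^ n) z \<in> ball 0 \<delta>" using iter[OF z, of n] \<Omega>_ball by blast
    have "norm (\<rho> ((c ^^ n) z)) = exp (v ((c ^^ n) z) - v ((c ^^ Suc n) z))"
      using eq[OF w] \<rho>_nz[OF w] by simp
    hence "norm (E (Suc n) z) = exp (v z - v ((c ^^ n) z)) * exp (v ((c ^^ n) z) - v ((c ^^ Suc n) z))"
      using Suc by (simp add: E_def norm_mult)
    also have "\<dots> = exp (v z - v ((c ^^ Suc n) z))" by (subst exp_add[symmetric]) simp
    finally show ?case .
  qed (simp add: E_def)
  have "compact (v ` cball 0 \<delta>)" by (intro compact_continuous_image v compact_cball)
  then obtain M where M: "\<forall>x\<in>v ` cball 0 \<delta>. norm x \<le> M"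
    using compact_imp_bounded bounded_iff by blast
  have vM: "\<bar>v z\<bar> \<le> M" if "z \<in> \<Omega>" for z
    using M small(1)[OF that] by auto
  have E_bound: "norm (E n z) \<le> exp (2 * M)" if z: "z \<in> \<Omega>" for n z
    using E_norm[OF z, of n] vM[OF z] vM[of "(c ^^ n) z"] iter[OF z, of n] by simp
  obtain F r where F: "F holomorphic_on ball z0 s" "strict_mono (r :: nat \<Rightarrow> nat)"
     "\<And>x. x \<in> ball z0 s \<Longrightarrow> ((\<lambda>n. E (r n) x) \<longlongrightarrow> F x) sequentially"
  proof (rule Montel[of "ball z0 s" "range E" E])
    show "h holomorphic_on ball z0 s" if "h \<in> range E" for h
      using that E_hol s(2) holomorphic_on_subset by blast
    show "\<exists>B. \<forall>h\<in>range E. \<forall>z\<in>K. norm (h z) \<le> B" if "K \<subseteq> ball z0 s" for K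
      using E_bound that s(2) by (intro exI[of _ "exp (2 * M)"]) blast
  qed auto
  have F_norm: "norm (F z) = exp (v z)" if z: "z \<in> ball z0 s" for z
  proof (rule LIMSEQ_unique)
    show "(\<lambda>n. norm (E (r n) z)) \<longlonglongrightarrow> norm (F z)" by (intro tendsto_norm F(3) z)
    have z\<Omega>: "z \<in> \<Omega>" using z s(2) by blast
    have "(\<lambda>n. (c ^^ r n) z) \<longlonglongrightarrow> 0"
      using LIMSEQ_subseq_LIMSEQ[OF tends0[OF z\<Omega>] F(2)] by (simp add: o_def)
    moreover have "isCont v 0"
      using continuous_on_interior[OF v(1), of 0] \<delta> by simp
    ultimately have "(\<lambda>n. v ((c ^^ r n) z)) \<longlonglongrightarrow> v 0"
      by (rule isCont_tendsto_compose[rotated])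
    hence "(\<lambda>n. exp (v z - v ((c ^^ r n) z))) \<longlonglongrightarrow> exp (v z - v 0)"
      by (intro tendsto_intros)
    thus "(\<lambda>n. norm (E (r n) z)) \<longlonglongrightarrow> exp (v z)"
      using E_norm[OF z\<Omega>] v(2) by simp
  qed
  have "contractible (ball z0 s)" by (intro convex_imp_contractible convex_ball)
  then obtain h where h: "h holomorphic_on ball z0 s" "\<And>z. z \<in> ball z0 s \<Longrightarrow> F z = exp (h z)"
    using contractible_imp_holomorphic_log[OF F(1)] F_norm by (metis exp_not_eq_zero norm_zero)
  have "v z = Re (h z)" if "z \<in> ball z0 s" for z
    using F_norm[OF that] h(2)[OF that] by simp
  thus ?thesis using s(1) h(1) by blast
qed

text \<open>
  The petals of \<open>c\<close>, where \<open>Re W + \<bar>Im W\<bar>\<close> is large in the coordinate \<open>W\<close>, and those of \<open>c'\<close>, where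
  \<open>- Re W + \<bar>Im W\<bar>\<close> is large, cover a punctured neighbourhood of \<open>0\<close>. In the application \<open>c'\<close> is the
  inverse of \<open>c\<close>.
\<close>

theorem harmonic_near_parabolic_symmetry:
  fixes v :: "complex \<Rightarrow> real" and c \<rho> :: "complex \<Rightarrow> complex" and \<gamma> :: complex and k :: nat
  assumes r: "r > 0" and k: "k \<ge> 1" and \<gamma>: "\<gamma> \<noteq> 0" and v: "continuous_on (ball 0 r) v" "v 0 = 0"
    and c: "c holomorphic_on ball 0 r" "((\<lambda>z. (c z - z) / z ^ Suc k) \<longlongrightarrow> \<gamma>) (at 0)"
    and \<rho>: "\<rho> holomorphic_on ball 0 r" "\<And>z. z \<in> ball 0 r \<Longrightarrow> \<rho> z \<noteq> 0"
    and eq: "\<And>z. z \<in> ball 0 r \<Longrightarrow> v z = v (c z) + ln (norm (\<rho> z))"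
    and c': "c' holomorphic_on ball 0 r" "((\<lambda>z. (c' z - z) / z ^ Suc k) \<longlongrightarrow> - \<gamma>) (at 0)"
    and \<rho>': "\<rho>' holomorphic_on ball 0 r" "\<And>z. z \<in> ball 0 r \<Longrightarrow> \<rho>' z \<noteq> 0"
    and eq': "\<And>z. z \<in> ball 0 r \<Longrightarrow> v z = v (c' z) + ln (norm (\<rho>' z))"
  shows "\<exists>\<delta>>0. \<exists>h. h holomorphic_on ball 0 \<delta> \<and> (\<forall>z\<in>ball 0 \<delta>. v z = Re (h z))"
proof -
  have ev: "\<exists>d>0. \<forall>z. 0 < norm z \<longrightarrow> norm z < d \<longrightarrow>
      c z \<noteq> 0 \<and> norm (petal_coord k \<gamma> (c z) - petal_coord k \<gamma> z - 1) \<le> 1 / 4"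
    if "\<gamma> \<noteq> 0" "((\<lambda>z. (c z - z) / z ^ Suc k) \<longlongrightarrow> \<gamma>) (at 0)" for c \<gamma>
  proof -
    have "eventually (\<lambda>z. dist (petal_coord k \<gamma> (c z) - petal_coord k \<gamma> z) 1 < 1 / 4) (at 0)"
      using petal_coord_translation(1)[OF k that] by (rule tendstoD) simp
    with petal_coord_translation(2)[OF k that]
    have "eventually (\<lambda>z. c z \<noteq> 0 \<and>
            norm (petal_coord k \<gamma> (c z) - petal_coord k \<gamma> z - 1) \<le> 1 / 4) (at 0)"
      by eventually_elim (simp add: dist_norm)
    thus ?thesis unfolding eventually_at by auto
  qed
  obtain d1 where d1: "d1 > 0" "\<And>z. 0 < norm z \<Longrightarrow> norm z < d1 \<Longrightarrow>
      c z \<noteq> 0 \<and> norm (petal_coord k \<gamma> (c z) - petal_coord k \<gamma> z - 1) \<le> 1 / 4"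
    using ev[OF \<gamma> c(2)] by blast
  have \<gamma>': "- \<gamma> \<noteq> 0" using \<gamma> by simp
  obtain d2 where d2: "d2 > 0" "\<And>z. 0 < norm z \<Longrightarrow> norm z < d2 \<Longrightarrow>
      c' z \<noteq> 0 \<and> norm (petal_coord k (-\<gamma>) (c' z) - petal_coord k (-\<gamma>) z - 1) \<le> 1 / 4"
    using ev[OF \<gamma>' c'(2)] by blast
  define \<delta> where "\<delta> = min (min d1 d2) (r / 2)"
  have \<delta>: "\<delta> > 0" "\<delta> \<le> d1" "\<delta> \<le> d2" "\<delta> < r" using d1 d2 r by (auto simp: \<delta>_def)
  have sub: "ball 0 \<delta> \<subseteq> ball (0::complex) r" "cball 0 \<delta> \<subseteq> ball (0::complex) r" using \<delta> by auto
  define R where "R = 1 / (k * norm \<gamma> * \<delta> ^ k)"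
  have "\<exists>h. h holomorphic_on ball 0 (\<delta> / 2) \<and> (\<forall>z\<in>ball 0 (\<delta> / 2). v z = Re (h z))"
  proof (rule removable_isolated_singularity_real_part)
    show "0 < \<delta> / 2" using \<delta> by simp
    have "ball 0 (\<delta> / 2) \<subseteq> ball (0::complex) r" using \<delta> by auto
    thus "continuous_on (ball 0 (\<delta> / 2)) v" using v(1) continuous_on_subset by blast
    fix z0 :: complex assume "z0 \<in> ball 0 (\<delta> / 2) - {0}"
    hence z0: "z0 \<noteq> 0" "norm z0 < \<delta> / 2" by auto
    have large: "norm (petal_coord k \<gamma> z0) > 2 * R"
    proof -
      have "norm z0 ^ k < (\<delta> / 2) ^ k" using z0 k by (intro power_strict_mono) auto
      also have "\<dots> = \<delta> ^ k / 2 ^ k" by (simp add: power_divide)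
      also have "\<dots> \<le> \<delta> ^ k / 2"
        using \<delta> k self_le_power[of "2::real" k] by (intro divide_left_mono) auto
      finally have "real k * norm \<gamma> * norm z0 ^ k < real k * norm \<gamma> * (\<delta> ^ k / 2)"
        using k \<gamma> by (intro mult_strict_left_mono) auto
      moreover have "real k * norm \<gamma> * norm z0 ^ k > 0" using k \<gamma> z0 by simp
      ultimately have "1 / (real k * norm \<gamma> * (\<delta> ^ k / 2)) < 1 / (real k * norm \<gamma> * norm z0 ^ k)"
        by (intro divide_strict_left_mono) auto
      thus ?thesis by (simp add: R_def norm_petal_coord)
    qed
    have neg: "petal_coord k (-\<gamma>) z0 = - petal_coord k \<gamma> z0" by (simp add: petal_coord_def)
    have tri: "norm (petal_coord k \<gamma> z0) \<le> \<bar>Re (petal_coord k \<gamma> z0)\<bar> + \<bar>Im (petal_coord k \<gamma> z0)\<bar>"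
      by (rule cmod_le)
    show "\<exists>s>0. \<exists>h. h holomorphic_on ball z0 s \<and> (\<forall>z\<in>ball z0 s. v z = Re (h z))"
    proof (cases "Re (petal_coord k \<gamma> z0) \<ge> 0")
      case True
      show ?thesis
      proof (rule harmonic_on_petal[OF \<delta>(1) k \<gamma>, of c \<rho>])
        show "2 * (1 / (k * norm \<gamma> * \<delta> ^ k)) < Re (petal_coord k \<gamma> z0) + \<bar>Im (petal_coord k \<gamma> z0)\<bar>"
          using True large tri unfolding R_def by linarith
      qed (use d1 \<delta> c \<rho> v eq z0 sub in
          \<open>auto intro: holomorphic_on_subset continuous_on_subset\<close>)
    next
      case False
      show ?thesis
      proof (rule harmonic_on_petal[OF \<delta>(1) k \<gamma>', of c' \<rho>'])
        show "2 * (1 / (k * norm (-\<gamma>) * \<delta> ^ k))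
            < Re (petal_coord k (-\<gamma>) z0) + \<bar>Im (petal_coord k (-\<gamma>) z0)\<bar>"
          using False large tri unfolding R_def neg by simp
      qed (use d2 \<delta> c' \<rho>' v eq' z0 sub in
          \<open>auto intro: holomorphic_on_subset continuous_on_subset\<close>)
    qed
  qed
  thus ?thesis using \<delta>(1) by (intro exI[of _ "\<delta> / 2"]) auto
qed

section \<open>Coinciding words of rational germs tangent to the identity\<close>

lemma local_inverse_tangent_to_identity:
  assumes f: "f holomorphic_on ball 0 R" "f 0 = (0::complex)" "deriv f 0 = 1" and R: "R > 0"
  shows "\<exists>\<rho>>0. \<exists>I. I holomorphic_on ball 0 \<rho> \<and> deriv I 0 = 1 \<and>
     (\<forall>w\<in>ball 0 \<rho>. I w \<in> ball 0 R \<and> f (I w) = w) \<and> eventually (\<lambda>z. I (f z) = z) (nhds 0)"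
proof -
  have z: "0 \<in> ball (0::complex) R" "deriv f 0 \<noteq> 0" using R f(3) by auto
  obtain r where r: "r > 0" "ball 0 r \<subseteq> ball (0::complex) R" "open (f ` ball 0 r)" "inj_on f (ball 0 r)"
    by (rule has_complex_derivative_locally_invertible[OF f(1) z(1) open_ball z(2)]) (rule that)
  have hol: "f holomorphic_on ball 0 r" using f(1) r(2) by (rule holomorphic_on_subset)
  obtain I where I: "I holomorphic_on (f ` ball 0 r)"
       "\<And>z. z \<in> ball 0 r \<Longrightarrow> deriv f z * deriv I (f z) = 1" "\<And>z. z \<in> ball 0 r \<Longrightarrow> I (f z) = z"
    by (rule holomorphic_has_inverse[OF hol open_ball r(4)]) blast
  have z0: "0 \<in> ball (0::complex) r" using r(1) by simp
  hence "0 \<in> f ` ball 0 r" using f(2) by (metis imageI)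
  then obtain \<rho> where \<rho>: "\<rho> > 0" "ball 0 \<rho> \<subseteq> f ` ball 0 r"
    using r(3) unfolding open_contains_ball by blast
  have "I holomorphic_on ball 0 \<rho>" using I(1) \<rho>(2) by (rule holomorphic_on_subset)
  moreover have "deriv I 0 = 1" using I(2)[OF z0] f(2,3) by simp
  moreover have "I w \<in> ball 0 R \<and> f (I w) = w" if w: "w \<in> ball 0 \<rho>" for w
  proof -
    obtain z where "z \<in> ball 0 r" "w = f z" using \<rho>(2) w by blast
    thus ?thesis using I(3) r(2) by auto
  qed
  moreover have "eventually (\<lambda>z. z \<in> ball 0 r) (nhds (0::complex))"
    using z0 by (intro eventually_nhds_in_open) auto
  hence "eventually (\<lambda>z. I (f z) = z) (nhds 0)" by eventually_elim (rule I(3))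
  ultimately show ?thesis using \<rho>(1) by blast
qed

text \<open>
  Strict differentiability at \<open>0\<close>, from the mean value inequality for \<open>I z - z\<close>.
\<close>

lemma strictly_differentiable_at:
  fixes I :: "complex \<Rightarrow> complex"
  assumes "I holomorphic_on ball 0 \<rho>" "\<rho> > 0" "deriv I 0 = 1" "e > 0"
  shows "\<exists>\<eta>>0. \<eta> \<le> \<rho> \<and> (\<forall>x\<in>ball 0 \<eta>. \<forall>y\<in>ball 0 \<eta>. norm (I x - I y - (x - y)) \<le> e * norm (x - y))"
proof -
  have "deriv I holomorphic_on ball 0 \<rho>" using assms by (intro holomorphic_deriv) auto
  hence "isCont (deriv I) 0"
    using assms(2) holomorphic_on_imp_continuous_on continuous_on_interior by fastforce
  hence "eventually (\<lambda>z. dist (deriv I z) 1 < e) (at 0)"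
    using assms(3,4) unfolding isCont_def by (metis tendstoD)
  then obtain d where d: "d > 0" "\<And>z. z \<noteq> 0 \<Longrightarrow> norm z < d \<Longrightarrow> norm (deriv I z - 1) < e"
    unfolding eventually_at dist_norm by auto
  define \<eta> where "\<eta> = min d \<rho>"
  have \<eta>: "\<eta> > 0" "\<eta> \<le> \<rho>" using d(1) assms(2) by (auto simp: \<eta>_def)
  have "norm (I x - I y - (x - y)) \<le> e * norm (x - y)" if "x \<in> ball 0 \<eta>" "y \<in> ball 0 \<eta>" for x y
  proof -
    have "norm ((I x - x) - (I y - y)) \<le> e * norm (x - y)"
    proof (rule field_differentiable_bound[OF convex_ball _ _ that])
      fix z assume z: "z \<in> ball (0::complex) \<eta>"
      hence "z \<in> ball 0 \<rho>" using \<eta>(2) by auto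
      hence "(I has_field_derivative deriv I z) (at z)"
        using holomorphic_derivI[OF assms(1) open_ball] by blast
      hence "((\<lambda>z. I z - z) has_field_derivative (deriv I z - 1)) (at z)"
        by (intro derivative_intros)
      thus "((\<lambda>z. I z - z) has_field_derivative (deriv I z - 1)) (at z within ball 0 \<eta>)"
        by (rule has_field_derivative_at_within)
      show "norm (deriv I z - 1) \<le> e"
        using d(2)[of z] z assms(3,4) by (cases "z = 0") (auto simp: \<eta>_def less_imp_le)
    qed
    thus ?thesis by (simp add: algebra_simps)
  qed
  thus ?thesis using \<eta> by blast
qed

text \<open>
  The germ \<open>c = inverse f \<circ> g\<close>. Its difference from the identity has the same leading term as \<open>g - f\<close>,
  because \<open>c z - z\<close> is the difference of the values of \<open>inverse f\<close> at \<open>g z\<close> and \<open>f z\<close>.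
\<close>

lemma transition_germ:
  fixes f g :: "complex \<Rightarrow> complex"
  assumes f: "f holomorphic_on ball 0 R" "f 0 = 0" "deriv f 0 = 1"
    and g: "g holomorphic_on ball 0 R" "g 0 = 0" and R: "R > 0"
    and lim: "((\<lambda>z. (g z - f z) / z ^ Suc k) \<longlongrightarrow> \<beta>) (at 0)"
  shows "\<exists>r>0. \<exists>c. r \<le> R \<and> c holomorphic_on ball 0 r \<and>
     (\<forall>z\<in>ball 0 r. c z \<in> ball 0 R \<and> f (c z) = g z) \<and>
     ((\<lambda>z. (c z - z) / z ^ Suc k) \<longlongrightarrow> \<beta>) (at 0)"
proof -
  obtain \<rho> I where \<rho>: "\<rho> > 0" and I: "I holomorphic_on ball 0 \<rho>" "deriv I 0 = 1"
     "\<And>w. w \<in> ball 0 \<rho> \<Longrightarrow> I w \<in> ball 0 R \<and> f (I w) = w" "eventually (\<lambda>z. I (f z) = z) (nhds 0)"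
    using local_inverse_tangent_to_identity[OF f R] by blast
  have cont: "isCont f 0" "isCont g 0"
    using f(1) g(1) R holomorphic_on_imp_continuous_on continuous_on_interior by fastforce+
  hence lim0: "(f \<longlongrightarrow> 0) (at 0)" "(g \<longlongrightarrow> 0) (at 0)"
    using f(2) g(2) by (simp_all add: isCont_def)
  obtain r0 where r0: "r0 > 0" "\<And>z. norm z < r0 \<Longrightarrow> norm (g z) < \<rho>"
    using cont(2) \<rho> g(2) unfolding continuous_at_eps_delta dist_norm by (metis diff_zero)
  define r where "r = min r0 R"
  have r: "r > 0" "r \<le> R" "r \<le> r0" using r0(1) R by (auto simp: r_def)
  define c where "c = (\<lambda>z. I (g z))"
  have g\<rho>: "g z \<in> ball 0 \<rho>" if "z \<in> ball 0 r" for z using that r0(2) r(3) by auto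
  have "I \<circ> g holomorphic_on ball 0 r"
  proof (rule holomorphic_on_compose_gen[OF _ I(1)])
    show "g holomorphic_on ball 0 r" using g(1) r(2) by (elim holomorphic_on_subset) auto
  qed (use g\<rho> in blast)
  hence c_hol: "c holomorphic_on ball 0 r" by (simp add: c_def o_def)
  have c_eq: "c z \<in> ball 0 R \<and> f (c z) = g z" if "z \<in> ball 0 r" for z
    unfolding c_def using I(3)[OF g\<rho>[OF that]] by blast
  have diff0: "((\<lambda>z. (c z - z) / z ^ Suc k - (g z - f z) / z ^ Suc k) \<longlongrightarrow> 0) (at 0)"
  proof (rule tendstoI)
    fix e :: real assume e: "e > 0"
    define e' where "e' = e / (2 * (norm \<beta> + 1))"
    have e': "e' > 0" using e by (simp add: e'_def add_nonneg_pos)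
    obtain \<eta> where \<eta>: "\<eta> > 0" "\<eta> \<le> \<rho>"
       "\<And>x y. x \<in> ball 0 \<eta> \<Longrightarrow> y \<in> ball 0 \<eta> \<Longrightarrow> norm (I x - I y - (x - y)) \<le> e' * norm (x - y)"
      using strictly_differentiable_at[OF I(1) \<rho> I(2) e'] by blast
    have ev1: "eventually (\<lambda>z. norm (f z) < \<eta>) (at 0)" "eventually (\<lambda>z. norm (g z) < \<eta>) (at 0)"
      using tendstoD[OF lim0(1) \<eta>(1)] tendstoD[OF lim0(2) \<eta>(1)] by (simp_all add: dist_norm)
    have ev2: "eventually (\<lambda>z. I (f z) = z) (at 0)"
      using I(4) by (simp add: eventually_nhds_conv_at)
    have "eventually (\<lambda>z. dist ((g z - f z) / z ^ Suc k) \<beta> < 1) (at 0)"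
      using lim by (rule tendstoD) simp
    hence ev3: "eventually (\<lambda>z. norm ((g z - f z) / z ^ Suc k) \<le> norm \<beta> + 1) (at 0)"
    proof eventually_elim
      case (elim z)
      thus ?case using norm_triangle_sub[of "(g z - f z) / z ^ Suc k" \<beta>] by (simp add: dist_norm)
    qed
    show "\<forall>\<^sub>F z in at 0. dist ((c z - z) / z ^ Suc k - (g z - f z) / z ^ Suc k) 0 < e"
      using ev1 ev2 ev3
    proof eventually_elim
      case (elim z)
      have "norm ((c z - z) - (g z - f z)) = norm (I (g z) - I (f z) - (g z - f z))"
        using elim by (simp add: c_def)
      also have "\<dots> \<le> e' * norm (g z - f z)" using elim by (intro \<eta>(3)) auto
      finally have "norm ((c z - z) - (g z - f z)) / norm (z ^ Suc k)
          \<le> e' * norm (g z - f z) / norm (z ^ Suc k)"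
        by (rule divide_right_mono) simp
      hence "norm (((c z - z) - (g z - f z)) / z ^ Suc k) \<le> e' * norm ((g z - f z) / z ^ Suc k)"
        by (simp only: norm_divide times_divide_eq_right)
      also have "\<dots> \<le> e' * (norm \<beta> + 1)" using elim e' by (intro mult_left_mono) auto
      also have "\<dots> = e / 2"
      proof -
        have "norm \<beta> + 1 > 0" by (simp add: add_nonneg_pos)
        thus ?thesis by (simp add: e'_def field_simps)
      qed
      also have "\<dots> < e" using e by simp
      finally show ?case by (simp only: dist_norm diff_zero diff_divide_distrib)
    qed
  qed
  have "((\<lambda>z. ((c z - z) / z ^ Suc k - (g z - f z) / z ^ Suc k) + (g z - f z) / z ^ Suc k)
      \<longlongrightarrow> 0 + \<beta>) (at 0)"
    by (rule tendsto_add[OF diff0 lim])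
  hence "((\<lambda>z. (c z - z) / z ^ Suc k) \<longlongrightarrow> \<beta>) (at 0)"
    by (simp only: diff_add_cancel add_0)
  thus ?thesis using r(1,2) c_hol c_eq by blast
qed

lemma has_fps_expansion_leading_term:
  fixes f :: "complex \<Rightarrow> complex"
  assumes f: "f has_fps_expansion F" and F: "\<And>i. i < n \<Longrightarrow> F $ i = 0" "F $ n \<noteq> 0"
  shows "((\<lambda>z. f z / z ^ n) \<longlongrightarrow> F $ n) (at 0)"
proof -
  have sub: "subdegree F = n" by (rule subdegreeI) (use F in auto)
  have "(\<lambda>x. if x = 0 then F $ n else f x / x ^ n) has_fps_expansion fps_shift n F"
    by (rule has_fps_expansion_shift[OF f]) (use sub in auto)
  hence "continuous (at 0) (\<lambda>x. if x = 0 then F $ n else f x / x ^ n)"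
    by (rule has_fps_expansion_imp_continuous)
  hence "((\<lambda>x. if x = 0 then F $ n else f x / x ^ n) \<longlongrightarrow> F $ n) (at 0)"
    by (simp add: isCont_def)
  thus ?thesis
    by (rule Lim_transform_eventually) (simp add: eventually_at_filter)
qed

lemma comp_word_replicate_leading:
  assumes a: "a $ 0 = 0" "a $ 1 = 1" and k: "k \<ge> 1" "\<forall>n\<le>k. a $ n = fps_X $ n"
  shows "comp_word (replicate n a) $ Suc k = of_nat n * a $ Suc k"
proof -
  have X: "comp_word (replicate n fps_X) = fps_X" for n
    by (induction n) simp_all
  have E: "eval_int_poly (position_poly a (replicate n a)) 1 = of_nat n"
    by (induction n) (simp_all add: eval_position_poly_Cons)
  have "1 * (comp_word (replicate n a) $ Suc k - comp_word (replicate (length (replicate n a)) fps_X) $ Suc k)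
     = (a $ Suc k - fps_X $ Suc k) * 1 ^ length (replicate n a) *
         eval_int_poly (position_poly a (replicate n a)) (1 ^ k)"
    by (rule jet_comp_word[of fps_X 1 a k "replicate n a", THEN conjunct2]) (use a k in auto)
  thus ?thesis using k(1) by (simp only: X E power_one mult_1) (simp add: E)
qed

text \<open>
  Dividing the lift \<open>(P, Q)\<close> of the \<open>n\<close>-th iterate by \<open>exp (d\<^sup>n H)\<close>, where \<open>Re H\<close> is the Green function, gives
  functions bounded by \<open>exp m\<close> near \<open>0\<close>, the second of which is \<open>1\<close> at \<open>0\<close>. Hence \<open>P / Q\<close> is bounded on
  a disc that does not depend on \<open>n\<close>, and so are the coefficients of the iterates. But the first
  coefficient in which \<open>a\<close> differs from the identity grows linearly under iteration.
\<close>

lemma harmonic_green_imp_identity: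
  assumes L: "is_lift d p q a" and gb: "growth_bound m d (lift_map d p q)" and m: "m \<ge> 0" and d: "d \<ge> 2"
    and a1: "a $ 1 = 1" and \<delta>: "\<delta> > 0" and h: "h holomorphic_on ball 0 \<delta>"
    and eq: "\<And>z. z \<in> ball 0 \<delta> \<Longrightarrow> d * green d (lift_map d p q) (z, 1) = Re (h z)"
  shows "a = fps_X"
proof (rule ccontr)
  assume "a \<noteq> fps_X"
  define j where "j = (LEAST n. a $ n \<noteq> fps_X $ n)"
  have "\<exists>n. a $ n \<noteq> fps_X $ n" using \<open>a \<noteq> fps_X\<close> by (auto simp: fps_eq_iff)
  from LeastI_ex[OF this] have j: "a $ j \<noteq> fps_X $ j" "\<And>n. n < j \<Longrightarrow> a $ n = fps_X $ n"
    unfolding j_def by (auto dest: not_less_Least)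
  have a0: "a $ 0 = 0" using is_lift_nth_0[OF L] .
  have "j \<noteq> 0"
  proof
    assume "j = 0"
    thus False using j(1) a0 by simp
  qed
  moreover have "j \<noteq> 1"
  proof
    assume "j = 1"
    thus False using j(1) a1 by simp
  qed
  ultimately obtain k where k: "j = Suc k" "k \<ge> 1" by (metis One_nat_def Suc_leI gr0I not0_implies_Suc)
  have coeff: "comp_word (replicate n a) $ j = of_nat n * a $ j" for n
    unfolding k(1) by (rule comp_word_replicate_leading[OF a0 a1 k(2)]) (use j(2) k in auto)
  have aj: "a $ j \<noteq> 0" using j(1) k by simp
  define H where "H = (\<lambda>z. (h z - h 0) / of_nat d)"
  have H_hol: "H holomorphic_on ball 0 \<delta>" unfolding H_def by (intro holomorphic_intros h) (use d in auto)
  have "Re (h 0) = 0" using eq[of 0] green_base_point[OF L] \<delta> by simp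
  hence H_green: "green d (lift_map d p q) (z, 1) = Re (H z)" if "z \<in> ball 0 \<delta>" for z
    using eq[OF that] d by (simp add: H_def field_simps)
  \<comment> \<open>Below, \<open>T\<close> has \<open>T 0 = 1\<close> and a derivative bounded by \<open>4 exp m / \<delta>\<close> on the disc of radius \<open>\<delta> / 2\<close>,
      so \<open>T\<close> stays within \<open>1 / 2\<close> of \<open>1\<close> on the disc of radius \<open>r\<close>.\<close>
  define r where "r = \<delta> / (8 * exp m)"
  have r: "r > 0" "r \<le> \<delta> / 8"
    using \<delta> m by (auto simp: r_def field_simps)
  define C where "C = 2 * exp m / (r / 2) ^ j"
  have bound: "norm (comp_word (replicate n a) $ j) \<le> C" for n
  proof -
    obtain P Q where PQ: "is_lift (d ^ n) P Q (comp_word (replicate n a))"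
       "\<And>z. ln (norm (poly P z, poly Q z)) \<le> real d ^ n * green d (lift_map d p q) (z, 1) + m"
      using iterate_green_bound[OF L gb m d] by blast
    define e where "e = (\<lambda>z. exp (- (of_nat d ^ n * H z)))"
    have e_hol: "e holomorphic_on ball 0 \<delta>" unfolding e_def by (intro holomorphic_intros H_hol)
    have nb: "norm (poly P z * e z) \<le> exp m" "norm (poly Q z * e z) \<le> exp m" if z: "z \<in> ball 0 \<delta>" for z
    proof -
      have nz: "(poly P z, poly Q z) \<noteq> 0"
      proof -
        have "lift_map (d ^ n) P Q (z, 1) \<noteq> 0"
          using PQ(1) unfolding is_lift_def by (simp add: zero_prod_def)
        thus ?thesis using PQ(1) unfolding is_lift_def by (simp add: lift_map_def hom_eval_1)
      qed
      have "norm (poly P z, poly Q z) = exp (ln (norm (poly P z, poly Q z)))" using nz by simp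
      also have "\<dots> \<le> exp (real d ^ n * Re (H z) + m)"
        using PQ(2)[of z] unfolding H_green[OF z] by simp
      finally have le: "norm (poly P z, poly Q z) \<le> exp (real d ^ n * Re (H z)) * exp m"
        by (simp add: exp_add)
      have ne: "norm (e z) = exp (- (real d ^ n * Re (H z)))"
        unfolding e_def by (simp flip: of_nat_power)
      have "norm (poly P z, poly Q z) * norm (e z) \<le> (exp (real d ^ n * Re (H z)) * exp m) * norm (e z)"
        using le by (rule mult_right_mono) simp
      also have "\<dots> = exp m" unfolding ne by (simp add: exp_minus field_simps)
      finally have "norm (poly P z, poly Q z) * norm (e z) \<le> exp m" .
      moreover have "norm (poly P z) \<le> norm (poly P z, poly Q z)" "norm (poly Q z) \<le> norm (poly P z, poly Q z)"
        by (simp_all add: norm_Pair real_le_rsqrt)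
      ultimately show "norm (poly P z * e z) \<le> exp m" "norm (poly Q z * e z) \<le> exp m"
        unfolding norm_mult by (meson mult_right_mono norm_ge_zero order_trans)+
    qed
    define T where "T = (\<lambda>z. poly Q z * e z)"
    have T_hol: "T holomorphic_on ball 0 \<delta>" unfolding T_def by (intro holomorphic_intros e_hol)
    have T0: "T 0 = 1" using PQ(1) by (simp add: T_def e_def H_def is_lift_def)
    have T_deriv: "norm (deriv T w) \<le> 4 * exp m / \<delta>" if w: "w \<in> ball 0 (\<delta> / 2)" for w
    proof -
      have sub: "cball w (\<delta> / 4) \<subseteq> ball 0 \<delta>"
      proof
        fix x assume "x \<in> cball w (\<delta> / 4)"
        hence "norm (x - w) \<le> \<delta> / 4" by (simp add: dist_norm norm_minus_commute)
        moreover have "norm x \<le> norm w + norm (x - w)" by (rule norm_triangle_sub)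
        ultimately show "x \<in> ball 0 \<delta>" using w \<delta> by simp
      qed
      have "norm ((deriv ^^ 1) T w) \<le> fact 1 * exp m / (\<delta> / 4) ^ 1"
      proof (rule Cauchy_inequality)
        show "T holomorphic_on ball w (\<delta> / 4)"
          using T_hol sub ball_subset_cball holomorphic_on_subset by blast
        show "continuous_on (cball w (\<delta> / 4)) T"
          using T_hol sub holomorphic_on_imp_continuous_on holomorphic_on_subset by blast
        show "norm (T x) \<le> exp m" if "norm (w - x) = \<delta> / 4" for x
        proof -
          have "x \<in> cball w (\<delta> / 4)" using that by (simp add: dist_norm)
          thus ?thesis using nb(2) sub unfolding T_def by blast
        qed
      qed (use \<delta> in simp)
      thus ?thesis by (simp add: mult.commute)
    qed
    have T_half: "norm (T z) \<ge> 1 / 2" if z: "z \<in> ball 0 r" for z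
    proof -
      have z': "z \<in> ball 0 (\<delta> / 2)" using z r \<delta> by simp
      have "norm (T z - T 0) \<le> 4 * exp m / \<delta> * norm (z - 0)"
      proof (rule field_differentiable_bound[OF convex_ball[of 0 "\<delta> / 2"] _ T_deriv z'])
        fix w :: complex assume "w \<in> ball 0 (\<delta> / 2)"
        hence "w \<in> ball 0 \<delta>" using \<delta> by simp
        thus "(T has_field_derivative deriv T w) (at w within ball 0 (\<delta> / 2))"
          using holomorphic_derivI[OF T_hol open_ball] has_field_derivative_at_within by blast
      qed (use \<delta> in auto)
      also have "\<dots> \<le> 4 * exp m / \<delta> * r" using z \<delta> by (intro mult_left_mono) auto
      also have "\<dots> = 1 / 2" using \<delta> by (simp add: r_def)
      finally have "norm (1 - T z) \<le> 1 / 2" using T0 by (simp add: norm_minus_commute)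
      moreover have "norm (1::complex) \<le> norm (T z) + norm (1 - T z)" by (rule norm_triangle_sub)
      ultimately show ?thesis by simp
    qed
    have ez: "e z \<noteq> 0" for z by (simp add: e_def)
    have r\<delta>: "ball 0 r \<subseteq> ball (0::complex) \<delta>" using r \<delta> by auto
    have Q_nz: "poly Q z \<noteq> 0" if "z \<in> ball 0 r" for z
      using T_half[OF that] by (auto simp: T_def)
    have F_bound: "norm (poly P z / poly Q z) \<le> 2 * exp m" if z: "z \<in> ball 0 r" for z
    proof -
      have "poly P z / poly Q z = (poly P z * e z) / T z"
        using ez[of z] by (simp add: T_def)
      hence "norm (poly P z / poly Q z) = norm (poly P z * e z) / norm (T z)"
        by (simp only: norm_divide)
      also have "\<dots> \<le> exp m / (1 / 2)"
        using T_half[OF z] nb(1)[of z] z r\<delta> by (intro frac_le) auto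
      finally show ?thesis by simp
    qed
    have F_hol: "(\<lambda>z. poly P z / poly Q z) holomorphic_on ball 0 r"
      using Q_nz by (intro holomorphic_intros) auto
    have sub2: "cball 0 (r / 2) \<subseteq> ball (0::complex) r" using r by auto
    have "norm ((deriv ^^ j) (\<lambda>z. poly P z / poly Q z) 0) \<le> fact j * (2 * exp m) / (r / 2) ^ j"
    proof (rule Cauchy_inequality)
      show "(\<lambda>z. poly P z / poly Q z) holomorphic_on ball 0 (r / 2)"
        using F_hol sub2 ball_subset_cball holomorphic_on_subset by blast
      show "continuous_on (cball 0 (r / 2)) (\<lambda>z. poly P z / poly Q z)"
        using F_hol sub2 holomorphic_on_imp_continuous_on holomorphic_on_subset by blast
      show "norm (poly P x / poly Q x) \<le> 2 * exp m" if "norm (0 - x) = r / 2" for x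
        using that r by (intro F_bound) simp
    qed (use r in simp)
    hence "norm ((deriv ^^ j) (\<lambda>z. poly P z / poly Q z) 0) / fact j \<le> C"
      by (simp add: C_def divide_le_eq mult_ac)
    moreover have "comp_word (replicate n a) $ j = (deriv ^^ j) (\<lambda>z. poly P z / poly Q z) 0 / fact j"
      by (rule fps_nth_fps_expansion[OF is_lift_imp_rational(1)[OF PQ(1)]])
    ultimately show ?thesis by (simp add: norm_divide)
  qed
  obtain n :: nat where "real n > C / norm (a $ j)" using reals_Archimedean2 by blast
  hence "real n * norm (a $ j) > C" using aj by (simp add: pos_divide_less_eq)
  thus False using bound[of n] unfolding coeff norm_mult by simp
qed

text \<open>
  The Green functions of the lifts of \<open>a\<close> and \<open>b\<close> agree. Writing the functional equation for \<open>b\<close> at \<open>z\<close> and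
  for \<open>a\<close> at \<open>c z\<close>, where \<open>a (c z) = b z\<close>, one obtains the invariance of the Green function under \<open>c\<close>
  up to \<open>ln \<bar>\<rho> z\<bar>\<close>; exchanging \<open>a\<close> and \<open>b\<close> gives the same for the inverse of \<open>c\<close>.
\<close>

theorem parabolic_collisions_trivial:
  assumes a: "is_lift d p q a" "a $ 1 = 1" and b: "is_lift d r s b" "b $ 1 = 1" and d: "d \<ge> 2"
    and col: "\<And>j. collide (comp_word (replicate j a)) (comp_word (replicate j b))"
  shows "a = b"
proof (rule ccontr)
  assume "a \<noteq> b"
  obtain ma mb where mab: "ma \<ge> 0" "growth_bound ma d (lift_map d p q)"
      "mb \<ge> 0" "growth_bound mb d (lift_map d r s)"
    using is_lift_growth_bound[OF a(1) d] is_lift_growth_bound[OF b(1) d] by blast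
  define m where "m = max ma mb"
  have m: "m \<ge> 0" using mab by (simp add: m_def)
  have gba: "growth_bound m d (lift_map d p q)"
    by (rule growth_bound_mono[OF mab(2)]) (use d in \<open>auto simp: m_def\<close>)
  have gbb: "growth_bound m d (lift_map d r s)"
    by (rule growth_bound_mono[OF mab(4)]) (use d in \<open>auto simp: m_def\<close>)
  define u where "u = (\<lambda>z. green d (lift_map d p q) (z, 1))"
  have ub: "u z = green d (lift_map d r s) (z, 1)" for z
    unfolding u_def by (rule green_eq_of_collisions[OF a(1) gba b(1) gbb m d _ col]) (simp add: zero_prod_def)
  have u_cont: "continuous_on UNIV u"
    unfolding u_def
    by (rule continuous_on_compose2[OF continuous_on_green[OF gba m d]])
       (auto intro!: continuous_intros simp: zero_prod_def)
  have u0: "u 0 = 0" unfolding u_def by (rule green_base_point[OF a(1)])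
  define fa fb where "fa = (\<lambda>z. poly p z / poly q z)" and "fb = (\<lambda>z. poly r z / poly s z)"
  have ua: "d * u z = u (fa z) + ln (norm (poly q z))" if "poly q z \<noteq> 0" for z
    unfolding u_def fa_def by (rule green_affine_equation[OF a(1) gba m d that])
  have ub': "d * u z = u (fb z) + ln (norm (poly s z))" if "poly s z \<noteq> 0" for z
    unfolding ub fb_def by (rule green_affine_equation[OF b(1) gbb m d that])
  have exp_a: "fa has_fps_expansion a" and exp_b: "fb has_fps_expansion b"
    unfolding fa_def fb_def using is_lift_imp_rational(1)[OF a(1)] is_lift_imp_rational(1)[OF b(1)] .
  have vals: "poly p 0 = 0" "poly q 0 = 1" "poly r 0 = 0" "poly s 0 = 1"
    using a(1) b(1) by (auto simp: is_lift_def)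
  have "open {z. poly q z \<noteq> 0 \<and> poly s z \<noteq> 0}"
    by (intro open_Collect_conj open_Collect_neq continuous_intros)
  moreover have "0 \<in> {z. poly q z \<noteq> 0 \<and> poly s z \<noteq> 0}" using vals by simp
  ultimately obtain R where R: "R > 0" "ball 0 R \<subseteq> {z. poly q z \<noteq> 0 \<and> poly s z \<noteq> 0}"
    unfolding open_contains_ball by blast
  have hol: "fa holomorphic_on ball 0 R" "fb holomorphic_on ball 0 R"
    unfolding fa_def fb_def using R(2) by (intro holomorphic_intros; auto)+
  have f0: "fa 0 = 0" "fb 0 = 0" using vals by (simp_all add: fa_def fb_def)
  have df: "deriv fa 0 = 1" "deriv fb 0 = 1"
    using fps_nth_fps_expansion[OF exp_a, of 1] fps_nth_fps_expansion[OF exp_b, of 1] a(2) b(2) by simp_all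
  define j where "j = (LEAST n. a $ n \<noteq> b $ n)"
  have "\<exists>n. a $ n \<noteq> b $ n" using \<open>a \<noteq> b\<close> by (auto simp: fps_eq_iff)
  from LeastI_ex[OF this] have j: "a $ j \<noteq> b $ j" "\<And>n. n < j \<Longrightarrow> a $ n = b $ n"
    unfolding j_def by (auto dest: not_less_Least)
  have "j \<noteq> 0" "j \<noteq> 1"
    using j(1) is_lift_nth_0[OF a(1)] is_lift_nth_0[OF b(1)] a(2) b(2) by metis+
  then obtain k where k: "j = Suc k" "k \<ge> 1" by (metis One_nat_def Suc_leI gr0I not0_implies_Suc)
  define \<beta> where "\<beta> = b $ j - a $ j"
  have \<beta>: "\<beta> \<noteq> 0" using j(1) by (simp add: \<beta>_def)
  have lim1: "((\<lambda>z. (fb z - fa z) / z ^ Suc k) \<longlongrightarrow> \<beta>) (at 0)"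
    using has_fps_expansion_leading_term[OF has_fps_expansion_diff[OF exp_b exp_a], of j] j k
    by (simp add: \<beta>_def)
  have lim2: "((\<lambda>z. (fa z - fb z) / z ^ Suc k) \<longlongrightarrow> - \<beta>) (at 0)"
    using has_fps_expansion_leading_term[OF has_fps_expansion_diff[OF exp_a exp_b], of j] j k
    by (simp add: \<beta>_def)
  obtain r1 c where c: "r1 > 0" "r1 \<le> R" "c holomorphic_on ball 0 r1"
      "\<And>z. z \<in> ball 0 r1 \<Longrightarrow> c z \<in> ball 0 R \<and> fa (c z) = fb z"
      "((\<lambda>z. (c z - z) / z ^ Suc k) \<longlongrightarrow> \<beta>) (at 0)"
    using transition_germ[OF hol(1) f0(1) df(1) hol(2) f0(2) R(1) lim1] by blast
  obtain r2 c' where c': "r2 > 0" "r2 \<le> R" "c' holomorphic_on ball 0 r2"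
      "\<And>z. z \<in> ball 0 r2 \<Longrightarrow> c' z \<in> ball 0 R \<and> fb (c' z) = fa z"
      "((\<lambda>z. (c' z - z) / z ^ Suc k) \<longlongrightarrow> - \<beta>) (at 0)"
    using transition_germ[OF hol(2) f0(2) df(2) hol(1) f0(1) R(1) lim2] by blast
  define \<rho> where "\<rho> = min r1 r2"
  have \<rho>: "\<rho> > 0" "ball 0 \<rho> \<subseteq> ball (0::complex) r1" "ball 0 \<rho> \<subseteq> ball (0::complex) r2"
      "ball 0 \<rho> \<subseteq> ball (0::complex) R"
    using c c' by (auto simp: \<rho>_def)
  have nz: "poly q z \<noteq> 0" "poly s z \<noteq> 0" if "z \<in> ball 0 R" for z using R(2) that by auto
  have c_hol: "c holomorphic_on ball 0 \<rho>" and c'_hol: "c' holomorphic_on ball 0 \<rho>"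
    using c(3) c'(3) \<rho>(2,3) holomorphic_on_subset by blast+
  have c_R: "c z \<in> ball 0 R" "fa (c z) = fb z" "c' z \<in> ball 0 R" "fb (c' z) = fa z"
    if "z \<in> ball 0 \<rho>" for z using c(4) c'(4) \<rho>(2,3) that by blast+
  have "\<exists>\<delta>>0. \<exists>h. h holomorphic_on ball 0 \<delta> \<and> (\<forall>z\<in>ball 0 \<delta>. real d * u z = Re (h z))"
  proof (rule harmonic_near_parabolic_symmetry[OF \<rho>(1) k(2) \<beta> _ _ c_hol c(5) _ _ _ c'_hol c'(5)])
    show "continuous_on (ball 0 \<rho>) (\<lambda>z. real d * u z)"
      by (intro continuous_intros continuous_on_subset[OF u_cont]) auto
    show "real d * u 0 = 0" using u0 by simp
    show "(\<lambda>z. poly s z / poly q (c z)) holomorphic_on ball 0 \<rho>"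
      using c_R nz by (intro holomorphic_intros c_hol) auto
    show "(\<lambda>z. poly q z / poly s (c' z)) holomorphic_on ball 0 \<rho>"
      using c_R nz by (intro holomorphic_intros c'_hol) auto
    fix z :: complex assume z: "z \<in> ball 0 \<rho>"
    have zR: "z \<in> ball 0 R" using z \<rho>(4) by blast
    show "poly s z / poly q (c z) \<noteq> 0" "poly q z / poly s (c' z) \<noteq> 0"
      using nz c_R[OF z] zR by auto
    show "real d * u z = real d * u (c z) + ln (norm (poly s z / poly q (c z)))"
      using ub'[OF nz(2)[OF zR]] ua[OF nz(1)[OF c_R(1)[OF z]]] c_R(2)[OF z]
        nz(2)[OF zR] nz(1)[OF c_R(1)[OF z]] by (simp add: norm_divide ln_div)
    show "real d * u z = real d * u (c' z) + ln (norm (poly q z / poly s (c' z)))"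
      using ua[OF nz(1)[OF zR]] ub'[OF nz(2)[OF c_R(3)[OF z]]] c_R(4)[OF z]
        nz(1)[OF zR] nz(2)[OF c_R(3)[OF z]] by (simp add: norm_divide ln_div)
  qed
  then obtain \<delta> h where h: "\<delta> > 0" "h holomorphic_on ball 0 \<delta>"
    "\<And>z. z \<in> ball 0 \<delta> \<Longrightarrow> real d * u z = Re (h z)" by blast
  have "a = fps_X"
    by (rule harmonic_green_imp_identity[OF a(1) gba m d a(2) h(1,2)]) (use h(3) in \<open>simp add: u_def\<close>)
  moreover have "b = fps_X"
    by (rule harmonic_green_imp_identity[OF b(1) gbb m d b(2) h(1,2)]) (use h(3) in \<open>simp add: ub\<close>)
  ultimately show False using \<open>a \<noteq> b\<close> by simp
qed

section \<open>Rational groups without free semigroups\<close>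

lemma fps_compose_cancel_left:
  fixes s x y :: "complex fps"
  assumes "s oo x = s oo y" "s $ 0 = 0" "s $ 1 \<noteq> 0" "x $ 0 = 0" "y $ 0 = 0"
  shows "x = y"
proof -
  have "fps_inv s oo (s oo x) = fps_inv s oo (s oo y)" using assms(1) by simp
  thus ?thesis
    using fps_inv[OF assms(2,3)] assms(2,4,5) by (simp add: fps_compose_assoc)
qed

lemma fps_compose_nth_1: "(f oo g) $ 1 = f $ 1 * (g $ 1 :: complex)" if "g $ 0 = 0"
  by (simp add: fps_compose_nth)

lemma fps_X_rational: "fps_X \<in> rational_elements"
  using is_lift_imp_rational(2)[OF is_lift_id(1)] .

lemma image_word_prod_eq_semigroup_generate:
  assumes "\<And>x. x \<in> B \<Longrightarrow> x $ 0 = 0"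
  shows "comp_word ` {w \<in> lists B. w \<noteq> []} = semigroup_generate fps_sgrp B"
proof
  have "comp_word w \<in> semigroup_generate fps_sgrp B" if "set w \<subseteq> B" "w \<noteq> []" for w
    using that(2,1)
  proof (induction w rule: list_nonempty_induct)
    case (single x)
    thus ?case using semigroup_generate.incl[of x B fps_sgrp] by simp
  next
    case (cons x w)
    have "x \<otimes>\<^bsub>fps_sgrp\<^esub> comp_word w \<in> semigroup_generate fps_sgrp B"
      by (rule semigroup_generate.mult[OF semigroup_generate.incl]) (use cons in auto)
    thus ?case by (simp add: fps_sgrp_def)
  qed
  thus "comp_word ` {w \<in> lists B. w \<noteq> []} \<subseteq> semigroup_generate fps_sgrp B" by auto
next
  show "semigroup_generate fps_sgrp B \<subseteq> comp_word ` {w \<in> lists B. w \<noteq> []}"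
  proof
    fix x assume "x \<in> semigroup_generate fps_sgrp B"
    thus "x \<in> comp_word ` {w \<in> lists B. w \<noteq> []}"
    proof induction
      case (incl a)
      thus ?case by (intro image_eqI[of _ _ "[a]"]) auto
    next
      case (mult x y)
      then obtain w v where wv: "x = comp_word w" "w \<in> lists B" "w \<noteq> []" "y = comp_word v" "v \<in> lists B"
        by blast
      have "comp_word (w @ v) = x oo y"
        unfolding wv(1,4) by (rule comp_word_append) (use wv assms in auto)
      thus ?case using wv by (intro image_eqI[of _ _ "w @ v"]) (auto simp: fps_sgrp_def)
    qed
  qed
qed

lemma not_free_imp_collide:
  assumes G: "subgroup G fps_grp"
    and nofree: "\<not> (\<exists>T. T \<subseteq> G \<and> noncyclic_free_semigroup fps_sgrp T \<and> rational_semigroup T)"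
    and ab: "a \<in> G \<inter> rational_elements" "b \<in> G \<inter> rational_elements"
  shows "collide a b"
proof (cases "a = b")
  case True
  show ?thesis unfolding collide_def True by (intro exI[of _ "[]"]) simp
next
  case False
  define T where "T = semigroup_generate fps_sgrp {a, b}"
  have carr: "x $ 0 = 0" "x $ 1 \<noteq> 0" if "x \<in> G" for x
    using subgroup.subset[OF G] that by (auto simp: fps_grp_def)
  have "T \<subseteq> G"
  proof
    fix x assume "x \<in> T"
    thus "x \<in> G"
      unfolding T_def
    proof induction
      case (mult x y)
      thus ?case using subgroup.m_closed[OF G, of x y] by (simp add: fps_grp_def fps_sgrp_def)
    qed (use ab in auto)
  qed
  moreover have "rational_semigroup T"
    unfolding rational_semigroup_def T_def using ab by (intro exI[of _ "{a, b}"]) auto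
  ultimately have "\<not> noncyclic_free_semigroup fps_sgrp T" using nofree by blast
  hence "\<not> free_semigroup_on fps_sgrp T {a, b}"
    unfolding noncyclic_free_semigroup_def using False by blast
  moreover have "{a, b} \<subseteq> carrier fps_sgrp" using ab carr(1) by (auto simp: fps_sgrp_def)
  moreover have wp: "word_prod fps_sgrp = comp_word"
    by (simp add: word_prod_def fps_sgrp_def fun_eq_iff)
  moreover have "comp_word ` {w \<in> lists {a, b}. w \<noteq> []} = T"
    unfolding T_def by (rule image_word_prod_eq_semigroup_generate) (use ab carr in auto)
  ultimately have "\<not> inj_on comp_word {w \<in> lists {a, b}. w \<noteq> []}"
    unfolding free_semigroup_on_def bij_betw_def by metis
  then obtain w1 w2 where w: "w1 \<noteq> w2" "set w1 \<subseteq> {a, b}" "set w2 \<subseteq> {a, b}" "comp_word w1 = comp_word w2"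
    unfolding inj_on_def by (auto simp: in_lists_conv_set subset_iff)
  have "a $ 0 = 0" "a $ 1 \<noteq> 0" "b $ 0 = 0" "b $ 1 \<noteq> 0" using ab carr by blast+
  thus ?thesis by (rule collideI[OF _ _ _ _ w])
qed

definition root_of_unity :: "complex \<Rightarrow> bool" where
  "root_of_unity l \<longleftrightarrow> (\<exists>n>0. l ^ n = 1)"

lemma root_of_unity_cancel:
  assumes "root_of_unity (x * y)" "root_of_unity y"
  shows "root_of_unity x"
proof -
  obtain m n where "m > 0" "n > 0" "(x * y) ^ m = 1" "y ^ n = 1"
    using assms unfolding root_of_unity_def by blast
  hence "(x * y) ^ (m * n) = 1" "y ^ (m * n) = 1"
    by (simp_all add: power_mult mult.commute[of m n]) (metis power_mult mult.commute power_one)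
  hence "x ^ (m * n) = 1" by (simp add: power_mult_distrib)
  thus ?thesis using \<open>m > 0\<close> \<open>n > 0\<close> unfolding root_of_unity_def
    by (intro exI[of _ "m * n"]) simp
qed

theorem theorem5:
  fixes G :: "complex fps set"
  assumes "rational_subgroup G"
    and "\<not> (\<exists>T. T \<subseteq> G \<and> noncyclic_free_semigroup fps_sgrp T \<and> rational_semigroup T)"
  shows "amenable (fps_grp\<lparr>carrier := G\<rparr>)"
proof -
  obtain A where A: "A \<subseteq> rational_elements \<inter> carrier fps_grp" "G = generate fps_grp A"
    and G: "subgroup G fps_grp"
    using assms(1) unfolding rational_subgroup_def by blast
  define S where "S = G \<inter> rational_elements"
  have G0: "x $ 0 = 0" "x $ 1 \<noteq> 0" if "x \<in> G" for x
    using subgroup.subset[OF G] that by (auto simp: fps_grp_def)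
  have G_mult: "x oo y \<in> G" if "x \<in> G" "y \<in> G" for x y
    using subgroup.m_closed[OF G that] by (simp add: fps_grp_def fps_sgrp_def)
  have X_G: "fps_X \<in> G"
    using subgroup.one_closed[OF G] by (simp add: fps_grp_def fps_sgrp_def)
  have SG: "x \<in> G" if "x \<in> S" for x using that by (simp add: S_def)
  have S_mult: "x oo y \<in> S" if "x \<in> S" "y \<in> S" for x y
    using that G_mult rational_elements_compose by (simp add: S_def)
  have X_S: "fps_X \<in> S" using X_G fps_X_rational by (simp add: S_def)
  have S_word: "comp_word w \<in> S" if "set w \<subseteq> S" for w
    using that by (induction w) (auto intro: X_S S_mult)
  have assoc: "x oo (y oo z) = x oo y oo z" if "y \<in> G" "z \<in> G" for x y z
    using G0(1)[OF that(1)] G0(1)[OF that(2)] by (simp add: fps_compose_assoc)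
  have cancel: "x = y" if "s oo x = s oo y" "s \<in> G" "x \<in> G" "y \<in> G" for s x y
    using fps_compose_cancel_left[OF that(1)] G0 that by blast
  have mult1: "(x oo y) $ 1 = x $ 1 * y $ 1" if "y \<in> G" for x y
    using fps_compose_nth_1 G0(1)[OF that] by blast
  have col: "collide x y" if "x \<in> S" "y \<in> S" for x y
    using not_free_imp_collide[OF G assms(2)] that unfolding S_def by blast
  have col_pow: "collide (comp_word (replicate j x)) (comp_word (replicate j y))"
    if "x \<in> S" "y \<in> S" for x y j
    using that by (intro col S_word) auto

  have same_multiplier: "x = y" if "x \<in> S" "y \<in> S" "x $ 1 = y $ 1" "\<not> root_of_unity (y $ 1)" for x y
  proof (rule ccontr)
    assume "x \<noteq> y"
    hence "\<exists>n>0. (y $ 1) ^ n = 1"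
      using equal_multiplier_root_of_unity[of x "y $ 1" y] col_pow[OF that(1,2)] that(3)
        G0[OF SG[OF that(1)]] G0[OF SG[OF that(2)]] by blast
    thus False using that(4) by (simp add: root_of_unity_def)
  qed

  \<comment> \<open>If \<open>t \<circ> g\<close> and \<open>t' \<circ> g'\<close> are in \<open>S\<close>, then a common left multiple \<open>U \<circ> (t \<circ> g) = V \<circ> t'\<close> clears the
      denominators of \<open>g \<circ> g'\<close>.\<close>
  have ore: "\<exists>t\<in>S. t oo g \<in> S" if "g \<in> G" for g
    using that unfolding A(2)
  proof (induction g rule: generate.induct)
    case one
    show ?case using X_S by (intro bexI[of _ fps_X]) (simp_all add: fps_grp_def fps_sgrp_def)
  next
    case (incl h)
    hence "h \<in> S" using A by (auto simp: S_def intro: generate.incl)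
    thus ?case using X_S G0(1)[OF SG] by (intro bexI[of _ fps_X]) simp_all
  next
    case (inv h)
    hence h: "h \<in> S" "h \<in> carrier fps_grp" using A by (auto simp: S_def intro: generate.incl)
    have "h \<otimes>\<^bsub>fps_grp\<^esub> inv\<^bsub>fps_grp\<^esub> h = \<one>\<^bsub>fps_grp\<^esub>"
      using group.r_inv[OF group_fps_grp h(2)] .
    hence "h oo inv\<^bsub>fps_grp\<^esub> h = fps_X" by (simp add: fps_grp_def fps_sgrp_def)
    thus ?case using h(1) X_S by (intro bexI[of _ h]) simp_all
  next
    case (eng g g')
    then obtain t t' where t: "t \<in> S" "t oo g \<in> S" "t' \<in> S" "t' oo g' \<in> S" by blast
    have gG: "g \<in> G" "g' \<in> G" using eng by (simp_all add: A(2))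
    obtain u v where uv: "set u \<subseteq> {t oo g, t'}" "set v \<subseteq> {t oo g, t'}"
       "comp_word (u @ [t oo g]) = comp_word (v @ [t'])"
      using col[OF t(2,3)] unfolding collide_def by blast
    have z: "x $ 0 = 0" if "x \<in> {t oo g, t'}" for x using that t G0(1) SG by blast
    have UV: "comp_word u \<in> S" "comp_word v \<in> S" using uv t by (auto intro!: S_word)
    have "comp_word (u @ [t oo g]) = comp_word u oo comp_word [t oo g]"
      "comp_word (v @ [t']) = comp_word v oo comp_word [t']"
      by (rule comp_word_append; use uv z in auto)+
    hence eq: "comp_word u oo (t oo g) = comp_word v oo t'" using uv(3) by simp
    have "(comp_word u oo t) oo (g oo g') = (comp_word u oo (t oo g)) oo g'"
      using gG t SG by (simp add: assoc G_mult)
    also have "\<dots> = comp_word v oo (t' oo g')"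
      unfolding eq using gG t SG by (simp add: assoc)
    finally have "(comp_word u oo t) oo (g oo g') \<in> S" using S_mult[OF UV(2) t(4)] by simp
    thus ?case using S_mult[OF UV(1) t(1)] by (auto simp: fps_grp_def fps_sgrp_def)
  qed

  have fractions_commute: "g oo g' = g' oo g"
    if g: "g \<in> G" "t \<in> S" "t oo g \<in> S" and g': "g' \<in> G" "t' \<in> S" "t' oo g' \<in> S"
      and comm: "\<And>x y. x \<in> {t, t oo g, t', t' oo g'} \<Longrightarrow> y \<in> {t, t oo g, t', t' oo g'} \<Longrightarrow> x oo y = y oo x"
    for g t g' t'
  proof (rule cancel)
    note G' = g(1) g'(1) SG[OF g(2)] SG[OF g'(2)]
    have "(t oo t') oo (g oo g') = t' oo (t oo g) oo g'"
      using comm[of t t'] G' by (simp add: assoc G_mult)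
    also have "\<dots> = (t oo g) oo (t' oo g')"
      using comm[of t' "t oo g"] G' by (simp add: assoc G_mult)
    also have "\<dots> = (t' oo g') oo (t oo g)" by (rule comm) auto
    also have "\<dots> = t oo (t' oo g') oo g"
      using comm[of t "t' oo g'"] G' by (simp add: assoc G_mult)
    also have "\<dots> = (t oo t') oo (g' oo g)" using G' by (simp add: assoc G_mult)
    finally show "(t oo t') oo (g oo g') = (t oo t') oo (g' oo g)" .
  qed (use g(1,2) g'(1,2) SG G_mult in auto)

  define H where "H = fps_grp\<lparr>carrier := G\<rparr>"
  have H: "group H" unfolding H_def using subgroup.subgroup_is_group[OF G group_fps_grp] .
  have HG [simp]: "carrier H = G" by (simp add: H_def)
  have H_mult [simp]: "x \<otimes>\<^bsub>H\<^esub> y = x oo y" for x y by (simp add: H_def fps_grp_def fps_sgrp_def)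
  have H_one [simp]: "\<one>\<^bsub>H\<^esub> = fps_X" by (simp add: H_def fps_grp_def fps_sgrp_def)
  have "amenable H"
  proof (cases "\<exists>s\<in>S. \<not> root_of_unity (s $ 1)")
    case True
    then obtain s where s: "s \<in> S" "\<not> root_of_unity (s $ 1)" by blast
    \<comment> \<open>If the multiplier of \<open>f \<circ> g\<close> is a root of unity, that of \<open>s \<circ> f \<circ> g\<close> is not.\<close>
    have comm_S: "f oo g = g oo f" if "f \<in> S" "g \<in> S" for f g
    proof (cases "root_of_unity (g $ 1 * f $ 1)")
      case False
      thus ?thesis using that
        by (intro same_multiplier S_mult) (simp_all add: mult1[unfolded One_nat_def] SG mult.commute)
    next
      case True
      hence nr: "\<not> root_of_unity (s $ 1 * (g $ 1 * f $ 1))" using root_of_unity_cancel s(2) by blast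
      have "s oo (f oo g) = s oo (g oo f)"
      proof (rule same_multiplier)
        show "(s oo (f oo g)) $ 1 = (s oo (g oo f)) $ 1"
          using that SG by (simp only: mult1 G_mult mult.commute)
        show "\<not> root_of_unity ((s oo (g oo f)) $ 1)"
          using that SG nr by (simp only: mult1 G_mult not_False_eq_True)
      qed (use that s S_mult in auto)
      from cancel[OF this SG[OF s(1)]] show ?thesis
        using G_mult[OF SG SG] that by blast
    qed
    have comm_G: "g oo g' = g' oo g" if "g \<in> G" "g' \<in> G" for g g'
    proof -
      obtain t where t: "t \<in> S" "t oo g \<in> S" using ore[OF \<open>g \<in> G\<close>] by blast
      obtain t' where t': "t' \<in> S" "t' oo g' \<in> S" using ore[OF \<open>g' \<in> G\<close>] by blast
      show ?thesis
        by (rule fractions_commute[OF that(1) t that(2) t']) (rule comm_S; use t t' in auto)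
    qed
    show ?thesis
    proof (rule amenable_metabelian[OF H, of G])
      fix g n assume "g \<in> carrier H" "n \<in> G"
      thus "\<exists>n'\<in>G. g \<otimes>\<^bsub>H\<^esub> n = n' \<otimes>\<^bsub>H\<^esub> g"
        using comm_G[of g n] unfolding HG H_mult by blast
    next
      fix g h assume "g \<in> carrier H" "h \<in> carrier H"
      hence gh: "g \<in> G" "h \<in> G" by simp_all
      have "fps_X oo (g oo h) = g oo h" using G0(1)[OF G_mult[OF gh]] by simp
      hence "h oo g = fps_X oo (g oo h)" using comm_G[OF gh] by simp
      thus "\<exists>n\<in>G. h \<otimes>\<^bsub>H\<^esub> g = n \<otimes>\<^bsub>H\<^esub> (g \<otimes>\<^bsub>H\<^esub> h)"
        unfolding H_mult using X_G by blast
    qed (use comm_G in simp_all)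
  next
    case False
    hence rou: "root_of_unity (s $ 1)" if "s \<in> S" for s using that by blast
    have comm_S: "f oo g = g oo f" if f: "f \<in> S" "f $ 1 = 1" and g: "g \<in> S" "g $ 1 = 1" for f g
    proof -
      obtain d p q where Lf: "is_lift d p q f" using rational_imp_is_lift f(1) unfolding S_def by blast
      obtain e r s where Lg: "is_lift e r s g" using rational_imp_is_lift g(1) unfolding S_def by blast
      have de: "d \<ge> 1" "e \<ge> 1" using is_lift_degree_pos[OF Lf] is_lift_degree_pos[OF Lg] f g by auto
      show ?thesis
      proof (cases "d * e \<ge> 2")
        case True
        show ?thesis
        proof (rule parabolic_collisions_trivial)
          show "is_lift (d * e) (hom_comp d p r s) (hom_comp d q r s) (f oo g)"
            by (rule is_lift_compose[OF Lf Lg])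
          show "is_lift (d * e) (hom_comp e r p q) (hom_comp e s p q) (g oo f)"
            using is_lift_compose[OF Lg Lf] by (simp add: mult.commute)
          show "(f oo g) $ 1 = 1" "(g oo f) $ 1 = 1" using f g SG by (simp_all only: mult1 mult_1)
          show "collide (comp_word (replicate j (f oo g))) (comp_word (replicate j (g oo f)))" for j
            using f g by (intro col_pow S_mult)
        qed (rule True)
      next
        case False
        have "d \<le> d * e" "e \<le> d * e" using de by simp_all
        hence "d = 1" "e = 1" using de False by linarith+
        thus ?thesis using degree_1_lifts_commute Lf Lg f g by blast
      qed
    qed
    have tangent_fraction: "\<exists>t\<in>S. t $ 1 = 1 \<and> t oo g \<in> S \<and> (t oo g) $ 1 = 1"
      if g: "g \<in> G" "g $ 1 = 1" for g
    proof -
      obtain t where t: "t \<in> S" "t oo g \<in> S" using ore[OF g(1)] by blast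
      obtain n where n: "n > 0" "(t $ 1) ^ n = 1" using rou[OF t(1)] unfolding root_of_unity_def by blast
      \<comment> \<open>Multiplying numerator and denominator of the fraction \<open>g\<close> by the power \<open>P\<close> of \<open>t\<close> makes both tangent to
          the identity, for \<open>n\<close> is the order of the multiplier of \<open>t\<close> or a multiple of it.\<close>
      define P where "P = comp_word (replicate (n - 1) t)"
      have P: "P \<in> S" unfolding P_def using t(1) by (intro S_word) auto
      have "P $ 1 = (t $ 1) ^ (n - 1)"
        unfolding P_def by (rule comp_word_replicate_nth(2)[OF G0(1)[OF SG[OF t(1)]]])
      hence "(P oo t) $ 1 = (t $ 1) ^ (n - 1) * t $ 1" using mult1[OF SG[OF t(1)]] by simp
      also have "\<dots> = (t $ 1) ^ n" using n(1) by (metis power_minus_mult)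
      finally have 1: "(P oo t) $ 1 = 1" using n(2) by simp
      have eq: "P oo t oo g = P oo (t oo g)" using t SG g by (simp add: assoc)
      have "(P oo t oo g) $ 1 = 1" using mult1[OF g(1)] 1 g(2) by simp
      moreover have "P oo t oo g \<in> S" unfolding eq by (rule S_mult[OF P t(2)])
      ultimately show ?thesis using 1 S_mult[OF P t(1)] by blast
    qed
    define N where "N = {g \<in> G. g $ 1 = 1}"
    interpret H: group H by fact
    have inv1: "(inv\<^bsub>H\<^esub> g) $ 1 * g $ 1 = 1" "inv\<^bsub>H\<^esub> g \<in> G" if "g \<in> G" for g
    proof -
      show "inv\<^bsub>H\<^esub> g \<in> G" using H.inv_closed[of g] that by simp
      have "inv\<^bsub>H\<^esub> g oo g = fps_X" using H.l_inv[of g] that by simp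
      hence "(inv\<^bsub>H\<^esub> g oo g) $ 1 = 1" by simp
      thus "(inv\<^bsub>H\<^esub> g) $ 1 * g $ 1 = 1" using mult1[OF that] by simp
    qed
    have inN: "x oo inv\<^bsub>H\<^esub> y \<in> N \<and> x = (x oo inv\<^bsub>H\<^esub> y) oo y" if "x \<in> G" "y \<in> G" "x $ 1 = y $ 1" for x y
    proof -
      have "inv\<^bsub>H\<^esub> y oo y = fps_X" using H.l_inv[of y] that by simp
      hence "(x oo inv\<^bsub>H\<^esub> y) oo y = x"
        using assoc[OF inv1(2)[OF that(2)] that(2), of x] by simp
      moreover have "(x oo inv\<^bsub>H\<^esub> y) $ 1 = 1"
        using mult1[OF inv1(2)[OF that(2)], of x] inv1(1)[OF that(2)] that(3) by (simp add: mult.commute)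
      ultimately show ?thesis using G_mult[OF that(1) inv1(2)[OF that(2)]] by (simp add: N_def)
    qed
    show ?thesis
    proof (rule amenable_metabelian[OF H, of N])
      show "N \<subseteq> carrier H" by (auto simp: N_def)
      fix g g' assume "g \<in> N" "g' \<in> N"
      hence g: "g \<in> G" "g $ 1 = 1" "g' \<in> G" "g' $ 1 = 1" by (auto simp: N_def)
      obtain t where t: "t \<in> S" "t $ 1 = 1" "t oo g \<in> S" "(t oo g) $ 1 = 1"
        using tangent_fraction[OF g(1,2)] by blast
      obtain t' where t': "t' \<in> S" "t' $ 1 = 1" "t' oo g' \<in> S" "(t' oo g') $ 1 = 1"
        using tangent_fraction[OF g(3,4)] by blast
      have "g oo g' = g' oo g"
      proof (rule fractions_commute[OF g(1) t(1,3) g(3) t'(1,3)])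
        fix x y assume "x \<in> {t, t oo g, t', t' oo g'}" "y \<in> {t, t oo g, t', t' oo g'}"
        hence "x \<in> S" "x $ 1 = 1" "y \<in> S" "y $ 1 = 1" using t t' by blast+
        thus "x oo y = y oo x" by (rule comm_S)
      qed
      thus "g \<otimes>\<^bsub>H\<^esub> g' = g' \<otimes>\<^bsub>H\<^esub> g" by simp
    next
      fix g n assume "g \<in> carrier H" "n \<in> N"
      hence gn: "g \<in> G" "n \<in> G" "n $ 1 = 1" by (auto simp: N_def)
      have "(g oo n) $ 1 = g $ 1" using mult1[OF gn(2), of g] gn(3) by simp
      from inN[OF G_mult[OF gn(1,2)] gn(1) this]
      show "\<exists>n'\<in>N. g \<otimes>\<^bsub>H\<^esub> n = n' \<otimes>\<^bsub>H\<^esub> g" by auto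
    next
      fix g h assume "g \<in> carrier H" "h \<in> carrier H"
      hence gh: "g \<in> G" "h \<in> G" by auto
      have "(h oo g) $ 1 = (g oo h) $ 1" using mult1[OF gh(1), of h] mult1[OF gh(2), of g] by (simp add: mult.commute)
      from inN[OF G_mult[OF gh(2,1)] G_mult[OF gh] this]
      show "\<exists>n\<in>N. h \<otimes>\<^bsub>H\<^esub> g = n \<otimes>\<^bsub>H\<^esub> (g \<otimes>\<^bsub>H\<^esub> h)" by auto
    qed
  qed
  thus ?thesis by (simp add: H_def)
qed

end
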